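(* (i) Suppose $$\delta_H:=\liminf_{t\downarrow0}\frac{\alpha(t)+|\gamma(t)|}{\eta(1/t)}>0 .$$ Then for some constant $C_H^*$ depending only on $\delta_H$, $$\bar a(x)\le C_H^*\,\frac{x}{m(x)}\qquad\text{for all sufficiently large integers }x\ge1 .$$ (ii) If $\dfrac{\alpha(t)+|\gamma(t)|}{t\,m(1/t)}\to0$ as $t\downarrow0$, then $\dfrac{\bar a(x)}{x/m(x)}\to\infty$ as $x\to\infty$. The converse of this implication is not true in general: there are random walks satisfying the standing assumptions for which $\bar a(x)m(x)/x\to\infty$ but $[\alpha(t)+|\gamma(t)|]/[t\,m(1/t)]$ does not tend to $0$ as $t\downarrow 0$.
   Context: Let $X,X_1,X_2,\dots$ be i.i.d. integer-valued random variables and $S_n=X_1+\dots+X_n$, $S_0=0$. Standing assumptions: the random walk $S$ is irreducible as a Markov chain on $\mathbb Z$, $EX=0$, and $EX^2=\infty$. The potential function is $a(x)=\sum_{n=0}^\infty\big(P[S_n=0]-P[S_n=-x]\big)$, $x\in\mathbb Z$ (the series converges), and $\bar a(x)=\frac12[a(x)+a(-x)]$. For real $x\ge0$, $t\geq 0$: $\mu_-(x)=P[X<-x]$, $\mu_+(x)=P[X>x]$, $\mu=\mu_-+\mu_+$; $\eta(x)=\int_x^\infty\mu(y)\,dy$; $m(x)=\int_0^x\eta(s)\,ds$; $\alpha(t)=\int_0^\infty\mu(y)\sin(ty)\,dy$ (as an improper integral); $\beta_\pm(t)=\int_0^\infty\mu_\pm(y)(1-\cos ty)\,dy$; $\gamma(t)=\beta_+(t)-\beta_-(t)$.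 With $\psi(t)=Ee^{itX}$ one has $1-\psi(t)=t\alpha(t)+it\gamma(t)$. *)

theory Defs
  imports "HOL-Probability.Probability"
begin

text \<open>
  All quantities depend only on the law of the step \<open>X\<close>, so a random walk is represented by its step
  distribution \<open>p\<close>.  The law of \<open>S\<^sub>n = X\<^sub>1 + \<dots> + X\<^sub>n\<close> is the image, under summation, of the law of
  \<open>n\<close> independent copies of \<open>X\<close>.
\<close>

definition walk_law :: "int pmf \<Rightarrow> nat \<Rightarrow> int pmf" where
  "walk_law p n = map_pmf (\<lambda>X. \<Sum>i\<in>{1..n}. X i) (Pi_pmf {1..n} 0 (\<lambda>_. p))"

definition irreducible_walk :: "int pmf \<Rightarrow> bool" where
  "irreducible_walk p \<longleftrightarrow> (\<forall>x y. \<exists>n. pmf (map_pmf (\<lambda>s. x + s) (walk_law p n)) y > 0)"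

definition standing_assms :: "int pmf \<Rightarrow> bool" where
  "standing_assms p \<longleftrightarrow>
     irreducible_walk p \<and>
     integrable (measure_pmf p) real_of_int \<and>
     measure_pmf.expectation p real_of_int = 0 \<and>
     (\<integral>\<^sup>+ k. ennreal ((real_of_int k)\<^sup>2) \<partial>measure_pmf p) = \<infinity>"

text \<open>
  The series need not converge absolutely; \<open>suminf\<close> is the limit of its partial sums.
\<close>

definition potential :: "int pmf \<Rightarrow> int \<Rightarrow> real" where
  "potential p x = (\<Sum>n. pmf (walk_law p n) 0 - pmf (walk_law p n) (- x))"

definition sym_potential :: "int pmf \<Rightarrow> int \<Rightarrow> real" where
  "sym_potential p x = (potential p x + potential p (- x)) / 2"

definition mu_minus :: "int pmf \<Rightarrow> real \<Rightarrow> real" where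
  "mu_minus p x = measure_pmf.prob p {k. real_of_int k < - x}"

definition mu_plus :: "int pmf \<Rightarrow> real \<Rightarrow> real" where
  "mu_plus p x = measure_pmf.prob p {k. real_of_int k > x}"

definition mu :: "int pmf \<Rightarrow> real \<Rightarrow> real" where
  "mu p x = mu_minus p x + mu_plus p x"

definition eta :: "int pmf \<Rightarrow> real \<Rightarrow> real" where
  "eta p x = (LBINT y:{x..}. mu p y)"

definition m_fun :: "int pmf \<Rightarrow> real \<Rightarrow> real" where
  "m_fun p x = (LBINT s:{0..x}. eta p s)"

definition alpha :: "int pmf \<Rightarrow> real \<Rightarrow> real" where
  "alpha p t = Lim at_top (\<lambda>R::real. LBINT y:{0..R}. mu p y * sin (t * y))"

definition beta_plus :: "int pmf \<Rightarrow> real \<Rightarrow> real" where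
  "beta_plus p t = (LBINT y:{0..}. mu_plus p y * (1 - cos (t * y)))"

definition beta_minus :: "int pmf \<Rightarrow> real \<Rightarrow> real" where
  "beta_minus p t = (LBINT y:{0..}. mu_minus p y * (1 - cos (t * y)))"

definition gamma :: "int pmf \<Rightarrow> real \<Rightarrow> real" where
  "gamma p t = beta_plus p t - beta_minus p t"

text \<open>
  The lower limit is taken in the extended reals, since it may be infinite.
\<close>

definition delta_H :: "int pmf \<Rightarrow> ereal" where
  "delta_H p = Liminf (at_right 0) (\<lambda>t. ereal ((alpha p t + \<bar>gamma p t\<bar>) / eta p (1 / t)))"

end

theory Submission imports Defs begin

text \<open>
  Let \<open>\<psi>\<close> be the characteristic function of the step, so that \<open>1 - \<psi>(t) = t(\<alpha>(t) + i\<gamma>(t))\<close>.  The symmetrized potential is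
  the integral of \<open>(1 - cos tx) \<alpha> / (t(\<alpha>\<^sup>2 + \<gamma>\<^sup>2))\<close> over \<open>[0, \<pi>]\<close>, divided by \<open>\<pi>\<close> (\<open>sym_potential_eq\<close>, \<open>Re_kern\<close>).
  All estimates compare this integrand with \<open>c(1/t) / (t m(1/t))\<^sup>2\<close>, where
  \<open>c(x) = \<integral>\<^sub>0\<^sup>x y \<mu>(y) dy = m(x) - x \<eta>(x)\<close>.  The reason is that \<open>m' = \<eta>\<close>, whence \<open>(x/m(x))' = c(x)/m(x)\<^sup>2\<close>
  (\<open>ratio_deriv\<close>): the integral of the comparison function from \<open>1/x\<close> to a constant is \<open>x/m(x)\<close> up to a constant.

  Two pointwise inequalities connect \<open>\<alpha>\<close> with \<open>c\<close>: \<open>\<alpha>(t) \<le> 4 t c(1/t)\<close> and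
  \<open>2 t c(1/t) \<le> 3 \<alpha>(t) + \<eta>(1/t)\<close> (\<open>alpha_le_trunc\<close>, \<open>trunc_le_alpha_eta\<close>).  For the upper bound,
  \<open>\<alpha> + \<bar>\<gamma>\<bar> \<ge> d \<eta>(1/t)\<close> and the second inequality give \<open>\<alpha> + \<bar>\<gamma>\<bar> \<ge> (d/3) t m(1/t)\<close>; by the first, the integrand is
  at most a multiple of the comparison function (\<open>sym_potential_upper_bound\<close>).  For the lower bound,
  \<open>\<alpha> + \<bar>\<gamma>\<bar> \<le> e t m(1/t)\<close> gives \<open>\<alpha>\<^sup>2 + \<gamma>\<^sup>2 \<le> (e t m(1/t))\<^sup>2\<close>.  The numerator \<open>\<alpha>\<close> need not be comparable to \<open>t c(1/t)\<close>
  pointwise, but it is on average over every block \<open>[s, 16s]\<close>, even in the presence of the factor \<open>1 - cos tx\<close>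
  (\<open>cos_product_integral_ge\<close>).  Hence the potential is at least a multiple of \<open>e\<^sup>-\<^sup>2 x/m(x)\<close> with \<open>e\<close> arbitrarily
  small (\<open>sym_potential_ratio_at_top\<close>).  The converse fails for a symmetric walk on rapidly growing scales: \<open>\<alpha>\<close> is
  comparable to \<open>t m(1/t)\<close> at the reciprocals of the scales but so small between them that the potential is
  large compared with \<open>x/m(x)\<close> everywhere (\<open>lacunary_ratio_at_top\<close>, \<open>lacunary_not_tendsto_0\<close>).

  The series defining the potential need not converge absolutely, and a bounded Fourier integrand is available only
  after symmetrization: for the sum of the partial sums at \<open>x\<close> and \<open>-x\<close> it is \<open>(1 - cos tx)/(1 - \<psi>(t))\<close>, up to a
  factor that is bounded by \<open>2\<close>, and the limit follows by dominated convergence.  The individual partial sums are nonnegative by a maximum principle, hence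
  bounded, and in fact sublinear because the variance is infinite.  By compactness they have limit points, each of
  which solves the Poisson equation; two of them differ by a sublinear harmonic function with bounded increments,
  which vanishes by the Choquet-Deny theorem (\<open>bounded_harmonic_const\<close>, \<open>potential_limit_unique\<close>).
\<close>

section \<open>Fourier representation of the walk\<close>

abbreviation expect :: "'a pmf \<Rightarrow> ('a \<Rightarrow> 'b) \<Rightarrow> 'b::{banach,second_countable_topology}" where
  "expect p f \<equiv> measure_pmf.expectation p f"

lemma pmf_lborel_Fubini:
  fixes p :: "int pmf" and f :: "int \<Rightarrow> real \<Rightarrow> 'b::{banach,second_countable_topology}"
  assumes f: "\<And>k. integrable lborel (f k)"
    and n: "integrable (measure_pmf p) (\<lambda>k. \<integral>t. norm (f k t) \<partial>lborel)"
  shows "integrable lborel (\<lambda>t. expect p (\<lambda>k. f k t))"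
    and "(\<integral>t. expect p (\<lambda>k. f k t) \<partial>lborel)
           = expect p (\<lambda>k. \<integral>t. f k t \<partial>lborel)"
proof -
  interpret pair_sigma_finite "measure_pmf p" "lborel :: real measure"
    by unfold_locales
  have m: "case_prod f \<in> borel_measurable (measure_pmf p \<Otimes>\<^sub>M lborel)"
  proof -
    have "case_prod f \<in> borel_measurable (count_space UNIV \<Otimes>\<^sub>M lborel)"
      by (intro measurable_pair_measure_countable1) (use f in auto)
    then show ?thesis
      by (simp cong: measurable_cong_sets sets_pair_measure_cong)
  qed
  have i: "integrable (measure_pmf p \<Otimes>\<^sub>M lborel) (case_prod f)"
    by (rule Fubini_integrable[OF m]) (use f n in auto)
  show "integrable lborel (\<lambda>t. expect p (\<lambda>k. f k t))"
    using integrable_snd[OF i] .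
  show "(\<integral>t. expect p (\<lambda>k. f k t) \<partial>lborel)
           = expect p (\<lambda>k. \<integral>t. f k t \<partial>lborel)"
    using Fubini_integral[OF i] .
qed

text \<open>
  The form in which Fubini is used throughout: integrands bounded on a compact interval.
\<close>

lemma pmf_Icc_Fubini:
  fixes p :: "int pmf" and f :: "int \<Rightarrow> real \<Rightarrow> 'b::{banach,second_countable_topology}"
  assumes f: "\<And>k. f k \<in> borel_measurable borel"
    and B: "\<And>k t. a \<le> t \<Longrightarrow> t \<le> b \<Longrightarrow> norm (f k t) \<le> B"
  shows "set_integrable lborel {a..b} (\<lambda>t. expect p (\<lambda>k. f k t))"
    and "(LBINT t:{a..b}. expect p (\<lambda>k. f k t))
           = expect p (\<lambda>k. LBINT t:{a..b}. f k t)"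
proof -
  define g where "g k t = indicator {a..b} t *\<^sub>R f k t" for k t
  have bd: "norm (g k t) \<le> norm (indicator {a..b} t *\<^sub>R B)" for k t
    using B[of t k] by (auto simp: g_def indicator_def)
  have iB: "integrable lborel (\<lambda>t. indicator {a..b} t *\<^sub>R B)"
    by (simp add: emeasure_lborel_Icc_eq)
  have gi: "integrable lborel (g k)" for k
    by (rule Bochner_Integration.integrable_bound[OF iB]) (use f bd in \<open>auto simp: g_def[abs_def] simp del: norm_scaleR real_norm_def\<close>)
  have ni: "integrable (measure_pmf p) (\<lambda>k. \<integral>t. norm (g k t) \<partial>lborel)"
  proof (rule measure_pmf.integrable_const_bound)
    show "AE k in measure_pmf p. norm (\<integral>t. norm (g k t) \<partial>lborel) \<le> (\<integral>t. norm (indicator {a..b} t *\<^sub>R B) \<partial>lborel)"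
    proof (rule AE_I2)
      fix k
      have "(\<integral>t. norm (g k t) \<partial>lborel) \<le> (\<integral>t. norm (indicator {a..b} t *\<^sub>R B) \<partial>lborel)"
        using bd by (intro integral_mono integrable_norm gi iB)
      moreover have "0 \<le> (\<integral>t. norm (g k t) \<partial>lborel)" by simp
      ultimately show "norm (\<integral>t. norm (g k t) \<partial>lborel) \<le> (\<integral>t. norm (indicator {a..b} t *\<^sub>R B) \<partial>lborel)"
        by (simp only: real_norm_def abs_of_nonneg)
    qed
  qed auto
  have e: "expect p (\<lambda>k. g k t) = indicator {a..b} t *\<^sub>R expect p (\<lambda>k. f k t)" for t
    by (auto simp: g_def indicator_def)
  show "set_integrable lborel {a..b} (\<lambda>t. expect p (\<lambda>k. f k t))"
    "(LBINT t:{a..b}. expect p (\<lambda>k. f k t))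
           = expect p (\<lambda>k. LBINT t:{a..b}. f k t)"
    using pmf_lborel_Fubini[OF gi ni] unfolding set_integrable_def set_lebesgue_integral_def e
    by (simp_all add: g_def[abs_def])
qed

lemma walk_law_0: "walk_law p 0 = return_pmf 0"
  by (simp add: walk_law_def)

lemma walk_law_Suc:
  "walk_law p (Suc n) = map_pmf (\<lambda>(k, s). k + s) (pair_pmf p (walk_law p n))"
proof -
  have A: "{1..Suc n} = insert (Suc n) {1..n}" by auto
  have B: "(\<Sum>i\<in>{1..n}. if i = Suc n then y else f i) = (\<Sum>i\<in>{1..n}. f i)" for y and f :: "nat \<Rightarrow> int"
    by (intro sum.cong) auto
  show ?thesis
    unfolding walk_law_def A
    by (simp add: Pi_pmf_insert pair_map_pmf2 map_pmf_comp case_prod_unfold B)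
qed

definition walk_prob :: "int pmf \<Rightarrow> nat \<Rightarrow> int \<Rightarrow> real" where
  "walk_prob p n x = pmf (walk_law p n) x"

lemma walk_prob_0: "walk_prob p 0 x = (if x = 0 then 1 else 0)"
  by (simp add: walk_prob_def walk_law_0 indicator_def)

lemma walk_prob_Suc: "walk_prob p (Suc n) x = expect p (\<lambda>k. walk_prob p n (x - k))"
proof -
  have "walk_law p (Suc n) = bind_pmf p (\<lambda>k. map_pmf (\<lambda>s. s + k) (walk_law p n))"
    unfolding walk_law_Suc pair_pmf_def
    by (simp add: map_bind_pmf map_pmf_def[symmetric] bind_return_pmf map_pmf_comp add.commute)
  moreover have "pmf (map_pmf (\<lambda>s. s + k) (walk_law p n)) x = pmf (walk_law p n) (x - k)" for k
    using pmf_map_inj'[of "\<lambda>s. s + k" "walk_law p n" "x - k"] by (simp add: inj_def)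
  ultimately show ?thesis
    by (simp add: walk_prob_def pmf_bind)
qed

lemma borel_measurable_cis[measurable]: "cis \<in> borel_measurable borel"
  by (intro borel_measurable_continuous_onI continuous_intros)

definition chf :: "int pmf \<Rightarrow> real \<Rightarrow> complex" where
  "chf p t = expect p (\<lambda>k. cis (t * real_of_int k))"

lemma integrable_cis: "integrable (measure_pmf p) (\<lambda>k. cis (t * real_of_int k))"
  by (rule measure_pmf.integrable_const_bound[where B=1]) auto

lemma integrable_bounded_pmf:
  fixes f :: "'a \<Rightarrow> 'b::{banach,second_countable_topology}"
  assumes "\<And>k. norm (f k) \<le> B"
  shows "integrable (measure_pmf p) f"
  by (rule measure_pmf.integrable_const_bound[where B=B]) (use assms in auto)

lemma integrable_one_minus_cos:
  fixes f :: "'a \<Rightarrow> real"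
  shows "integrable (measure_pmf q) (\<lambda>k. 1 - cos (f k))"
  by (rule integrable_bounded_pmf[where B=2]) (auto simp: abs_le_iff intro: order_trans[OF _ add_mono])

lemma norm_chf_le: "norm (chf p t) \<le> 1"
proof -
  have "norm (chf p t) \<le> expect p (\<lambda>k. norm (cis (t * real_of_int k)))"
    unfolding chf_def by (rule integral_norm_bound)
  then show ?thesis by simp
qed

lemma Re_chf: "Re (chf p t) = expect p (\<lambda>k. cos (t * real_of_int k))"
  unfolding chf_def by (subst integral_Re[symmetric]) (auto intro: integrable_cis)

lemma Im_chf: "Im (chf p t) = expect p (\<lambda>k. sin (t * real_of_int k))"
  unfolding chf_def by (subst integral_Im[symmetric]) (auto intro: integrable_cis)

lemma continuous_on_chf: "continuous_on S (chf p)"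
proof -
  have "isCont (chf p) t" for t
    unfolding continuous_at_sequentially
  proof (intro allI impI)
    fix s assume "s \<longlonglongrightarrow> t"
    then show "(chf p \<circ> s) \<longlonglongrightarrow> chf p t"
      unfolding chf_def comp_def
      by (intro integral_dominated_convergence[where w="\<lambda>_. 1"]) (auto intro!: AE_I2 tendsto_intros)
  qed
  then show ?thesis by (simp add: continuous_at_imp_continuous_on)
qed

lemma borel_measurable_chf[measurable]: "chf p \<in> borel_measurable borel"
  by (rule borel_measurable_continuous_onI[OF continuous_on_chf])

lemma set_integrable_bounded_Icc:
  fixes f :: "real \<Rightarrow> 'b::{banach,second_countable_topology}"
  assumes "f \<in> borel_measurable borel" "\<And>t. a \<le> t \<Longrightarrow> t \<le> b \<Longrightarrow> norm (f t) \<le> B"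
  shows "set_integrable lborel {a..b} f"
  unfolding set_integrable_def
proof (rule Bochner_Integration.integrable_bound)
  show "integrable lborel (\<lambda>t. indicator {a..b} t *\<^sub>R B)" by (simp add: emeasure_lborel_Icc_eq)
  show "AE x in lborel. norm (indicator {a..b} x *\<^sub>R f x) \<le> norm (indicator {a..b} x *\<^sub>R B)"
    using assms(2) by (intro AE_I2) (force simp: indicator_def)
qed (use assms(1) in auto)

lemma has_integral_cos:
  fixes a b c :: real
  assumes "a \<le> b" "c \<noteq> 0"
  shows "((\<lambda>t. cos (t * c)) has_integral (sin (b * c) / c - sin (a * c) / c)) {a..b}"
proof -
  have d: "((\<lambda>t. sin (t * c) / c) has_real_derivative cos (t * c)) (at t within {a..b})" for t
    using assms by (auto intro!: derivative_eq_intros)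
  show ?thesis
    by (rule fundamental_theorem_of_calculus[OF assms(1)])
       (use d in \<open>simp_all add: has_real_derivative_iff_has_vector_derivative\<close>)
qed

lemma integral_cos_int:
  fixes x :: int
  shows "(LBINT t:{0..pi}. cos (t * real_of_int x)) = (if x = 0 then pi else 0)"
proof (cases "x = 0")
  case True
  then show ?thesis by (simp add: set_lebesgue_integral_def)
next
  case False
  define r where "r = real_of_int x"
  have r: "r \<noteq> 0" using False by (simp add: r_def)
  have "((\<lambda>t. cos (t * r)) has_integral (sin (pi * r) / r - sin (0 * r) / r)) {0..pi}"
    by (rule has_integral_cos) (use r in auto)
  moreover have "sin (pi * r) = 0"
    unfolding r_def by (rule sin_npi_int)
  ultimately have i: "((\<lambda>t. cos (t * r)) has_integral 0) {0..pi}"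
    by simp
  have "set_integrable lborel {0..pi} (\<lambda>t. cos (t * r))"
    by (rule set_integrable_bounded_Icc[where B=1]) auto
  from set_borel_integral_eq_integral(2)[OF this] integral_unique[OF i]
  have "(LBINT t:{0..pi}. cos (t * r)) = 0" by simp
  then show ?thesis using False unfolding r_def by (simp only: if_False)
qed

lemma norm_chf_power_le: "norm (chf p t ^ n) \<le> 1"
  by (simp add: norm_power power_le_one norm_chf_le)

text \<open>
  Fourier inversion in real form: the integrand is the even part of \<open>\<psi>\<^sup>n e\<^sup>-\<^sup>i\<^sup>x\<^sup>t\<close>, so half of the
  period suffices.  Induction on the number of steps replaces the multiplicativity of characteristic
  functions.
\<close>

lemma walk_prob_Fourier:
  "walk_prob p n x = (LBINT t:{0..pi}. Re (chf p t ^ n * cis (- (t * real_of_int x)))) / pi"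
proof (induction n arbitrary: x)
  case 0
  show ?case
    using integral_cos_int[of x] by (simp add: walk_prob_0)
next
  case (Suc n)
  let ?f = "\<lambda>k t. Re (chf p t ^ n * cis (- (t * real_of_int (x - k))))"
  have bd: "norm (?f k t) \<le> 1" for k t
  proof -
    have "norm (?f k t) \<le> norm (chf p t ^ n * cis (- (t * real_of_int (x - k))))"
      unfolding real_norm_def by (rule abs_Re_le_cmod)
    also have "\<dots> \<le> 1"
      unfolding norm_mult norm_cis mult_1_right by (rule norm_chf_power_le)
    finally show ?thesis .
  qed
  have E: "expect p (\<lambda>k. ?f k t) = Re (chf p t ^ Suc n * cis (- (t * real_of_int x)))" for t
  proof -
    have e: "?f k t = Re ((chf p t ^ n * cis (- (t * real_of_int x))) * cis (t * real_of_int k))" for k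
      by (simp only: mult.assoc cis_mult) (simp add: right_diff_distrib)
    have "expect p (\<lambda>k. ?f k t)
        = Re (expect p (\<lambda>k. (chf p t ^ n * cis (- (t * real_of_int x))) * cis (t * real_of_int k)))"
      unfolding e by (rule integral_Re) (intro integrable_mult_right integrable_cis)
    also have "expect p (\<lambda>k. (chf p t ^ n * cis (- (t * real_of_int x))) * cis (t * real_of_int k))
        = chf p t ^ n * cis (- (t * real_of_int x)) * chf p t"
      unfolding chf_def by (rule integral_mult_right_zero)
    finally show ?thesis by (simp only: power_Suc mult_ac)
  qed
  have F: "(LBINT t:{0..pi}. expect p (\<lambda>k. ?f k t))
      = expect p (\<lambda>k. LBINT t:{0..pi}. ?f k t)"
    by (rule pmf_Icc_Fubini(2)[OF _ bd]) measurable
  have "walk_prob p (Suc n) x = expect p (\<lambda>k. (LBINT t:{0..pi}. ?f k t) / pi)"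
    unfolding walk_prob_Suc Suc.IH ..
  also have "\<dots> = expect p (\<lambda>k. LBINT t:{0..pi}. ?f k t) / pi"
    by (rule integral_divide_zero)
  finally show ?case unfolding F[symmetric] E .
qed

section \<open>The characteristic function near the origin\<close>

lemma one_minus_cos_le: "1 - cos u \<le> u\<^sup>2 / 2" for u :: real
proof -
  obtain t where "cos u = (\<Sum>m<2. cos_coeff m * u ^ m) + (cos (t + 1/2 * real 2 * pi) / fact 2) * u ^ 2"
    using Maclaurin_cos_expansion[of u 2] by blast
  then have e: "cos u = 1 - cos t * u\<^sup>2 / 2"
    by (simp add: cos_coeff_def numeral_2_eq_2)
  have "cos t * u\<^sup>2 \<le> 1 * u\<^sup>2" by (intro mult_right_mono) auto
  then show ?thesis unfolding e by simp
qed

lemma one_minus_cos_ge: "u\<^sup>2 / 3 \<le> 1 - cos u" if "\<bar>u\<bar> \<le> 1" for u :: real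
proof -
  obtain t where "cos u = (\<Sum>m<3. cos_coeff m * u ^ m) + (cos (t + 1/2 * real 3 * pi) / fact 3) * u ^ 3"
    using Maclaurin_cos_expansion[of u 3] by blast
  then have e: "cos u = 1 - u\<^sup>2 / 2 + cos (t + 1/2 * real 3 * pi) * u ^ 3 / 6"
    by (simp add: cos_coeff_def eval_nat_numeral)
  have "cos (t + 1/2 * real 3 * pi) * u ^ 3 \<le> \<bar>cos (t + 1/2 * real 3 * pi)\<bar> * \<bar>u ^ 3\<bar>"
    by (metis abs_ge_self abs_mult)
  also have "\<dots> \<le> 1 * \<bar>u ^ 3\<bar>" by (intro mult_right_mono) auto
  also have "\<dots> = \<bar>u\<bar> * u\<^sup>2" by (simp add: power_abs[symmetric] eval_nat_numeral abs_mult)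
  also have "\<dots> \<le> 1 * u\<^sup>2" using that by (intro mult_right_mono) auto
  finally have "cos (t + 1/2 * real 3 * pi) * u ^ 3 / 6 \<le> u\<^sup>2 / 6" by linarith
  then show ?thesis unfolding e by linarith
qed

text \<open>
  The range \<open>\<bar>u\<bar> \<le> 3\<close> is what a tripling of the argument needs: \<open>cos\<close> is decreasing on \<open>[0, 3] \<subseteq> [0, \<pi>]\<close>,
  so beyond \<open>1\<close> the bound at \<open>1\<close> persists.
\<close>

lemma one_minus_cos_ge_min: "min 1 (u\<^sup>2) / 3 \<le> 1 - cos u" if "\<bar>u\<bar> \<le> 3" for u :: real
proof (cases "\<bar>u\<bar> \<le> 1")
  case True
  then show ?thesis using one_minus_cos_ge[OF True] by (auto simp: min_def)
next
  case False
  have "cos \<bar>u\<bar> \<le> cos 1" using that False pi_gt3 by (intro cos_monotone_0_pi_le) auto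
  moreover have "1 / 3 \<le> 1 - cos (1::real)" using one_minus_cos_ge[of 1] by simp
  ultimately show ?thesis by (auto simp: min_def)
qed

text \<open>
  Where \<open>cos u\<close> returns to \<open>1\<close> the first term on the right is useless, but there \<open>\<bar>u\<bar> > 3\<close> and the overshoot
  \<open>\<bar>u\<bar> - 1\<close> takes over.  Taking expectations at \<open>u = tX\<close> gives the lower bound for \<open>3\<alpha>(t) + \<eta>(1/t)\<close>.
\<close>

lemma min_one_square_le: "min 1 (u\<^sup>2) \<le> 3 * (1 - cos u) + max 0 (\<bar>u\<bar> - 1)" for u :: real
proof (cases "\<bar>u\<bar> \<le> 3")
  case True
  have "0 \<le> max 0 (\<bar>u\<bar> - 1)" by simp
  then show ?thesis using one_minus_cos_ge_min[OF True] by argo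
next
  case False
  then have "min 1 (u\<^sup>2) \<le> \<bar>u\<bar> - 1" by linarith
  moreover have "0 \<le> 3 * (1 - cos u)" by simp
  ultimately show ?thesis by linarith
qed

lemma one_minus_cos_le_min: "1 - cos u \<le> 2 * min 1 (u\<^sup>2)" for u :: real
proof -
  have "1 - cos u \<le> 2" using cos_ge_minus_one[of u] by linarith
  moreover have "1 - cos u \<le> u\<^sup>2 / 2" "0 \<le> u\<^sup>2" by (rule one_minus_cos_le) simp
  ultimately have "1 - cos u \<le> 2 * 1" "1 - cos u \<le> 2 * u\<^sup>2" by linarith+
  then show ?thesis unfolding min_def by (simp split: if_split)
qed

lemma set_pmf_walk_law_subset:
  assumes "0 \<in> H" "\<And>a b. a \<in> H \<Longrightarrow> b \<in> H \<Longrightarrow> a + b \<in> H" "set_pmf p \<subseteq> H"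
  shows "set_pmf (walk_law p n) \<subseteq> H"
proof (induction n)
  case (Suc n)
  then show ?case using assms by (auto simp: walk_law_Suc)
qed (use assms in \<open>simp add: walk_law_0\<close>)

text \<open>
  Irreducibility is used only in this form: a property of increments that is closed under addition and
  holds on the support of the step holds for every integer.
\<close>

lemma irreducible_walk_submonoid:
  assumes irr: "irreducible_walk p"
    and H: "0 \<in> H" "\<And>a b. a \<in> H \<Longrightarrow> b \<in> H \<Longrightarrow> a + b \<in> H" "set_pmf p \<subseteq> H"
  shows "y \<in> H"
proof -
  obtain n where "pmf (map_pmf (\<lambda>s. 0 + s) (walk_law p n)) y > 0"
    using irr unfolding irreducible_walk_def by blast
  then have "y \<in> set_pmf (walk_law p n)" by (simp add: set_pmf_iff)
  then show ?thesis using set_pmf_walk_law_subset[OF H] by blast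
qed

locale heavy_walk =
  fixes p :: "int pmf"
  assumes standing: "standing_assms p"
begin

lemma irreducible: "irreducible_walk p"
  and integrable_step[simp]: "integrable (measure_pmf p) real_of_int"
  and mean_zero: "expect p real_of_int = 0"
  and second_moment: "(\<integral>\<^sup>+ k. ennreal ((real_of_int k)\<^sup>2) \<partial>measure_pmf p) = \<infinity>"
  using standing unfolding standing_assms_def by auto

lemma integrable_abs_step[simp]: "integrable (measure_pmf p) (\<lambda>k. \<bar>real_of_int k\<bar>)"
  by (intro integrable_abs integrable_step)

lemma one_minus_Re_chf: "1 - Re (chf p t) = expect p (\<lambda>k. 1 - cos (t * real_of_int k))"
proof -
  have "integrable (measure_pmf p) (\<lambda>k. cos (t * real_of_int k))"
    by (rule integrable_bounded_pmf[where B=1]) simp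
  then show ?thesis by (simp add: Re_chf)
qed

text \<open>
  If \<open>\<psi>(t) = 1\<close> then \<open>tk\<close> is a multiple of \<open>2\<pi>\<close> for all \<open>k\<close> in the support, hence for \<open>k = 1\<close>.
\<close>

lemma Re_chf_less_1:
  assumes "0 < t" "t \<le> pi"
  shows "Re (chf p t) < 1"
proof (rule ccontr)
  assume "\<not> Re (chf p t) < 1"
  moreover have "0 \<le> expect p (\<lambda>k. 1 - cos (t * real_of_int k))"
    by (intro integral_nonneg_AE AE_I2) simp
  ultimately have "expect p (\<lambda>k. 1 - cos (t * real_of_int k)) = 0"
    using one_minus_Re_chf[of t] by linarith
  then have "AE k in measure_pmf p. 1 - cos (t * real_of_int k) = 0"
    by (subst (asm) integral_nonneg_eq_0_iff_AE[OF integrable_one_minus_cos]) (auto intro!: AE_I2)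
  then have sub: "set_pmf p \<subseteq> {k. cos (t * real_of_int k) = 1}"
    by (auto simp: AE_measure_pmf_iff)
  have "1 \<in> {k. cos (t * real_of_int k) = 1}"
  proof (rule irreducible_walk_submonoid[OF irreducible _ _ sub])
    fix a b :: int assume "a \<in> {k. cos (t * real_of_int k) = 1}" "b \<in> {k. cos (t * real_of_int k) = 1}"
    then have a: "cos (t * real_of_int a) = 1" and b: "cos (t * real_of_int b) = 1" by auto
    then have "sin (t * real_of_int a) = 0" using sin_cos_squared_add[of "t * real_of_int a"] by simp
    then show "a + b \<in> {k. cos (t * real_of_int k) = 1}"
      using a b by (simp add: distrib_left cos_add)
  qed simp
  then have "cos t = 1" by simp
  moreover have "cos t < cos 0" using assms by (intro cos_monotone_0_pi) auto
  ultimately show False by simp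
qed

lemma truncated_second_moment_unbounded:
  obtains N :: nat where
    "K \<le> expect p (\<lambda>k. if \<bar>k\<bar> \<le> int N then (real_of_int k)\<^sup>2 else 0)"
proof -
  let ?f = "\<lambda>N k. if \<bar>k\<bar> \<le> int N then (real_of_int k)\<^sup>2 else 0"
  have "(\<integral>\<^sup>+ k. (SUP N. ennreal (?f N k)) \<partial>measure_pmf p) = (SUP N. \<integral>\<^sup>+ k. ennreal (?f N k) \<partial>measure_pmf p)"
    by (intro nn_integral_monotone_convergence_SUP) (auto simp: mono_def le_fun_def intro!: ennreal_leI)
  moreover have "(SUP N. ennreal (?f N k)) = ennreal ((real_of_int k)\<^sup>2)" for k
  proof (rule antisym)
    show "(SUP N. ennreal (?f N k)) \<le> ennreal ((real_of_int k)\<^sup>2)"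
      by (intro SUP_least ennreal_leI) auto
    show "ennreal ((real_of_int k)\<^sup>2) \<le> (SUP N. ennreal (?f N k))"
      by (rule SUP_upper2[of "nat \<bar>k\<bar>"]) auto
  qed
  ultimately have "(SUP N. \<integral>\<^sup>+ k. ennreal (?f N k) \<partial>measure_pmf p) = top"
    using second_moment by simp
  then have "ennreal K < (SUP N. \<integral>\<^sup>+ k. ennreal (?f N k) \<partial>measure_pmf p)" by (simp only: ennreal_less_top)
  then obtain N where N: "ennreal K < (\<integral>\<^sup>+ k. ennreal (?f N k) \<partial>measure_pmf p)"
    unfolding less_SUP_iff by blast
  have "integrable (measure_pmf p) (?f N)"
    by (rule integrable_bounded_pmf[where B="(real N)\<^sup>2"])
       (auto simp: abs_le_square_iff[symmetric])
  then have "(\<integral>\<^sup>+ k. ennreal (?f N k) \<partial>measure_pmf p) = ennreal (expect p (?f N))"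
    by (intro nn_integral_eq_integral) auto
  with N have "ennreal K < ennreal (expect p (?f N))" by simp
  then have "\<not> expect p (?f N) \<le> K" using ennreal_leI leD by blast
  then have "K \<le> expect p (?f N)" by linarith
  then show ?thesis by (rule that)
qed

text \<open>
  Infinite variance makes \<open>\<bar>1 - \<psi>(t)\<bar>\<close> larger than any multiple of \<open>t\<^sup>2\<close> near \<open>0\<close>; the constant \<open>c\<close> absorbs the
  compact rest of the interval.  With \<open>K = 1\<close> this bounds the Fourier integrand of the potential, and
  with \<open>K\<close> large it makes the potential sublinear.
\<close>

lemma inverse_one_minus_chf_bound:
  assumes K: "0 < K"
  obtains c where "0 \<le> c"
    "\<And>t. 0 < t \<Longrightarrow> t \<le> pi \<Longrightarrow> inverse (norm (1 - chf p t)) \<le> 1 / (K * t\<^sup>2) + c"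
proof -
  obtain N :: nat where N: "3 * K \<le> expect p (\<lambda>k. if \<bar>k\<bar> \<le> int N then (real_of_int k)\<^sup>2 else 0)"
    by (rule truncated_second_moment_unbounded)
  \<comment> \<open>For t below d and \<bar>k\<bar> at most N, the argument t k lies in [-1, 1].\<close>
  define d where "d = min pi (1 / (real N + 1))"
  have d: "0 < d" "d \<le> pi" "d \<le> 1 / (real N + 1)" by (auto simp: d_def)
  have Re_le: "1 - Re (chf p t) \<le> norm (1 - chf p t)" for t
    using complex_Re_le_cmod[of "1 - chf p t"] by simp
  have near: "K * t\<^sup>2 \<le> norm (1 - chf p t)" if t: "0 < t" "t \<le> d" for t
  proof -
    have "K * t\<^sup>2 \<le> t\<^sup>2 / 3 * expect p (\<lambda>k. if \<bar>k\<bar> \<le> int N then (real_of_int k)\<^sup>2 else 0)"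
      using mult_left_mono[OF N, of "t\<^sup>2 / 3"] by (simp add: mult_ac)
    also have "\<dots> = expect p (\<lambda>k. t\<^sup>2 / 3 * (if \<bar>k\<bar> \<le> int N then (real_of_int k)\<^sup>2 else 0))"
      by (rule integral_mult_right_zero[symmetric])
    also have "\<dots> \<le> expect p (\<lambda>k. 1 - cos (t * real_of_int k))"
    proof (rule integral_mono[OF _ integrable_one_minus_cos])
      show "integrable (measure_pmf p) (\<lambda>k. t\<^sup>2 / 3 * (if \<bar>k\<bar> \<le> int N then (real_of_int k)\<^sup>2 else 0))"
        by (intro integrable_mult_right integrable_bounded_pmf[where B="(real N)\<^sup>2"])
           (auto simp: abs_le_square_iff[symmetric])
      fix k :: int
      show "t\<^sup>2 / 3 * (if \<bar>k\<bar> \<le> int N then (real_of_int k)\<^sup>2 else 0) \<le> 1 - cos (t * real_of_int k)"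
      proof (cases "\<bar>k\<bar> \<le> int N")
        case True
        then have "\<bar>real_of_int k\<bar> \<le> real N" by linarith
        then have "\<bar>t * real_of_int k\<bar> \<le> 1 / (real N + 1) * real N"
          unfolding abs_mult using t d by (intro mult_mono) auto
        also have "\<dots> \<le> 1" by (simp add: field_simps)
        finally show ?thesis using True one_minus_cos_ge[of "t * real_of_int k"]
          by (simp add: power_mult_distrib)
      qed simp
    qed
    finally show ?thesis using Re_le[of t] one_minus_Re_chf[of t] by linarith
  qed
  have "compact {d..pi}" "{d..pi} \<noteq> {}" using d by auto
  moreover have "continuous_on {d..pi} (\<lambda>t. norm (1 - chf p t))"
    by (intro continuous_intros continuous_on_chf)
  ultimately obtain s where s: "s \<in> {d..pi}" "\<And>t. t \<in> {d..pi} \<Longrightarrow> norm (1 - chf p s) \<le> norm (1 - chf p t)"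
    using continuous_attains_inf[of "{d..pi}" "\<lambda>t. norm (1 - chf p t)"] by metis
  have sp: "0 < norm (1 - chf p s)"
    using Re_chf_less_1[of s] s(1) d Re_le[of s] by auto
  show ?thesis
  proof (rule that[of "inverse (norm (1 - chf p s))"])
    fix t :: real assume t: "0 < t" "t \<le> pi"
    show "inverse (norm (1 - chf p t)) \<le> 1 / (K * t\<^sup>2) + inverse (norm (1 - chf p s))"
    proof (cases "t \<le> d")
      case True
      have "inverse (norm (1 - chf p t)) \<le> inverse (K * t\<^sup>2)"
        using near[OF t(1) True] K t by (intro le_imp_inverse_le) auto
      then show ?thesis using sp by (simp add: divide_inverse add_increasing2)
    next
      case False
      then have "inverse (norm (1 - chf p t)) \<le> inverse (norm (1 - chf p s))"
        using s(2)[of t] sp t by (intro le_imp_inverse_le) auto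
      moreover have "0 \<le> 1 / (K * t\<^sup>2)" using K by simp
      ultimately show ?thesis by linarith
    qed
  qed (use sp in simp)
qed

lemma support_has_two_points:
  obtains a b where "a \<in> set_pmf p" "b \<in> set_pmf p" "a \<noteq> b"
proof (rule ccontr)
  assume no: "\<not> thesis"
  obtain a where a: "a \<in> set_pmf p" using set_pmf_not_empty[of p] by auto
  then have "set_pmf p = {a}" using no that by auto
  then have "p = return_pmf a" using set_pmf_subset_singleton[of p a] by simp
  then show False using second_moment by simp
qed

text \<open>
  If \<open>\<bar>\<psi>(t)\<bar> = 1\<close>, then \<open>e\<^sup>i\<^sup>t\<^sup>k\<close> takes a single value on the support, so \<open>t(a - b)\<close> is a multiple of \<open>2\<pi>\<close> for
  two distinct support points.  For a periodic walk this happens inside \<open>(0, \<pi>]\<close>, but only on a null set.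
\<close>

lemma countable_norm_chf_eq_1: "countable {t. norm (chf p t) = 1}"
proof -
  obtain a b where ab: "a \<in> set_pmf p" "b \<in> set_pmf p" "a \<noteq> b"
    by (rule support_has_two_points)
  have "{t. norm (chf p t) = 1} \<subseteq> (\<lambda>n. of_int n * (2 * pi) / real_of_int (a - b)) ` (UNIV :: int set)"
  proof
    fix t assume "t \<in> {t. norm (chf p t) = 1}"
    then have n1: "norm (chf p t) = 1" by simp
    define w where "w = cnj (chf p t)"
    have w: "norm w = 1" using n1 by (simp add: w_def)
    have int: "integrable (measure_pmf p) (\<lambda>k. w * cis (t * real_of_int k))"
      by (intro integrable_mult_right integrable_cis)
    have R1: "Re (w * cis (t * real_of_int k)) \<le> 1" for k
      using complex_Re_le_cmod[of "w * cis (t * real_of_int k)"] w by (simp add: norm_mult)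
    have "expect p (\<lambda>k. w * cis (t * real_of_int k)) = w * chf p t"
      unfolding chf_def by (rule integral_mult_right_zero)
    also have "\<dots> = 1" using n1 complex_norm_square[of "chf p t"] unfolding w_def by (simp add: mult.commute)
    finally have "expect p (\<lambda>k. Re (w * cis (t * real_of_int k))) = 1"
      unfolding integral_Re[OF int] by (simp only: one_complex.simps)
    then have "expect p (\<lambda>k. 1 - Re (w * cis (t * real_of_int k))) = 0"
      using integrable_Re[OF int] by simp
    then have "AE k in measure_pmf p. 1 - Re (w * cis (t * real_of_int k)) = 0"
      using integrable_Re[OF int] R1
      by (subst (asm) integral_nonneg_eq_0_iff_AE) (auto intro!: AE_I2)
    then have "Re (w * cis (t * real_of_int k)) = 1" if "k \<in> set_pmf p" for k
      using that by (auto simp: AE_measure_pmf_iff)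
    then have one: "w * cis (t * real_of_int k) = 1" if "k \<in> set_pmf p" for k
    proof -
      let ?z = "w * cis (t * real_of_int k)"
      have "Re ?z = 1" using \<open>\<And>k. k \<in> set_pmf p \<Longrightarrow> Re (w * cis (t * real_of_int k)) = 1\<close> that .
      moreover have "norm ?z = 1" using w by (simp add: norm_mult)
      ultimately show ?thesis using cmod_power2[of ?z] by (intro complex_eqI) auto
    qed
    have "w * cis (t * real_of_int a) = w * cis (t * real_of_int b)" using one ab by simp
    then have "cis (t * real_of_int a) = cis (t * real_of_int b)" using w by auto
    then have "cis (t * real_of_int a - t * real_of_int b) = 1"
      by (simp add: cis_divide[symmetric])
    then have "cos (t * real_of_int (a - b)) = 1"
      by (simp add: complex_eq_iff right_diff_distrib)
    then obtain n :: int where "t * real_of_int (a - b) = of_int n * 2 * pi"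
      using cos_one_2pi_int by (metis mult.assoc)
    then have "t = of_int n * (2 * pi) / real_of_int (a - b)"
      using ab by (simp add: field_simps)
    then show "t \<in> (\<lambda>n. of_int n * (2 * pi) / real_of_int (a - b)) ` (UNIV :: int set)" by blast
  qed
  then show ?thesis by (rule countable_subset) simp
qed

lemma AE_norm_chf_less_1: "AE t in lborel. norm (chf p t) < 1"
proof -
  have "AE t in lborel. t \<notin> {t. norm (chf p t) = 1}"
    by (rule AE_not_in[OF countable_imp_null_set_lborel[OF countable_norm_chf_eq_1]])
  then show ?thesis
  proof eventually_elim
    case (elim t)
    then show ?case using norm_chf_le[of p t] by (simp add: less_le)
  qed
qed

lemma chf_power_integral_tendsto_0:
  fixes g :: "real \<Rightarrow> complex"
  assumes g: "g \<in> borel_measurable borel" and B: "\<And>t. 0 \<le> t \<Longrightarrow> t \<le> pi \<Longrightarrow> norm (g t) \<le> B"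
  shows "(\<lambda>n. LBINT t:{0..pi}. Re (chf p t ^ n * g t)) \<longlonglongrightarrow> 0"
proof -
  have "(\<lambda>n. \<integral>t. indicator {0..pi} t *\<^sub>R Re (chf p t ^ n * g t) \<partial>lborel) \<longlonglongrightarrow> (\<integral>t. (0::real) \<partial>(lborel :: real measure))"
  proof (rule integral_dominated_convergence[where w="\<lambda>t. indicator {0..pi} t *\<^sub>R B"])
    show "integrable lborel (\<lambda>t. indicator {0..pi} t *\<^sub>R B)" by (simp add: emeasure_lborel_Icc_eq)
    show "AE t in lborel. (\<lambda>n. indicator {0..pi} t *\<^sub>R Re (chf p t ^ n * g t)) \<longlonglongrightarrow> 0"
      using AE_norm_chf_less_1
    proof eventually_elim
      case (elim t)
      have "(\<lambda>n. chf p t ^ n * g t) \<longlonglongrightarrow> 0 * g t"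
        by (intro tendsto_mult tendsto_const LIMSEQ_power_zero elim)
      then have "(\<lambda>n. indicator {0..pi} t *\<^sub>R Re (chf p t ^ n * g t)) \<longlonglongrightarrow> indicator {0..pi} t *\<^sub>R Re (0 * g t)"
        by (intro tendsto_scaleR tendsto_const tendsto_Re)
      then show ?case by simp
    qed
    fix n
    show "AE t in lborel. norm (indicator {0..pi} t *\<^sub>R Re (chf p t ^ n * g t)) \<le> indicator {0..pi} t *\<^sub>R B"
    proof (rule AE_I2)
      fix t :: real
      have "\<bar>Re (chf p t ^ n * g t)\<bar> \<le> norm (chf p t ^ n) * norm (g t)"
        using abs_Re_le_cmod[of "chf p t ^ n * g t"] by (simp add: norm_mult)
      also have "\<dots> \<le> 1 * norm (g t)" by (intro mult_right_mono norm_chf_power_le) auto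
      finally show "norm (indicator {0..pi} t *\<^sub>R Re (chf p t ^ n * g t)) \<le> indicator {0..pi} t *\<^sub>R B"
        using B[of t] by (auto simp: indicator_def)
    qed
  qed (use g in measurable)
  then show ?thesis by (simp add: set_lebesgue_integral_def)
qed

lemma walk_prob_tendsto_0: "(\<lambda>n. walk_prob p n x) \<longlonglongrightarrow> 0"
proof -
  have "(\<lambda>n. (LBINT t:{0..pi}. Re (chf p t ^ n * cis (- (t * real_of_int x)))) / pi) \<longlonglongrightarrow> 0 / pi"
    by (intro tendsto_divide tendsto_const chf_power_integral_tendsto_0[where B=1]) auto
  then show ?thesis by (simp add: walk_prob_Fourier)
qed

end

section \<open>Harmonic functions and the maximum principle\<close>

lemma pmf_times_le_expectation:
  fixes f :: "'a \<Rightarrow> real"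
  assumes "integrable (measure_pmf p) f" "\<And>k. 0 \<le> f k"
  shows "pmf p z * f z \<le> expect p f"
proof -
  have "pmf p z * f z = expect p (\<lambda>k. indicator {z} k * f z)"
    by (simp add: measure_pmf_single)
  also have "\<dots> \<le> expect p f"
  proof (rule integral_mono[OF _ assms(1)])
    show "integrable (measure_pmf p) (\<lambda>k. indicator {z} k * f z)"
      by (rule integrable_bounded_pmf[where B="f z"]) (use assms in \<open>auto simp: indicator_def\<close>)
  qed (use assms in \<open>auto simp: indicator_def\<close>)
  finally show ?thesis .
qed

text \<open>
  The discrete Choquet-Deny theorem.  For \<open>z\<close> in the support let \<open>M\<close> be the supremum of the harmonic function
  \<open>d(x) = g(x + z) - g(x)\<close>.  If \<open>d\<close> is within \<open>e\<close> of \<open>M\<close> at \<open>x\<close>, then averaging shows that it is within \<open>e/p(z)\<close>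
  of \<open>M\<close> at \<open>x + z\<close>.  Starting close enough to \<open>M\<close>, it stays above \<open>M/2\<close> along many steps \<open>z\<close>, and the
  telescoping sum contradicts the boundedness of \<open>g\<close> unless \<open>M \<le> 0\<close>.  The same for \<open>-g\<close> gives \<open>d = 0\<close>.
\<close>

lemma bounded_harmonic_const:
  fixes g :: "int \<Rightarrow> real"
  assumes irr: "irreducible_walk p" and B: "\<And>x. \<bar>g x\<bar> \<le> B"
    and harm: "\<And>x. expect p (\<lambda>k. g (x + k)) = g x"
  shows "g x = g 0"
proof -
  have half: "f (x + z) - f x \<le> 0"
    if fB: "\<And>x. \<bar>f x\<bar> \<le> B" and fh: "\<And>x. expect p (\<lambda>k. f (x + k)) = f x"
      and z: "z \<in> set_pmf p" for f :: "int \<Rightarrow> real" and x z :: int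
  proof (rule ccontr)
    assume pos: "\<not> f (x + z) - f x \<le> 0"
    define d where "d x = f (x + z) - f x" for x
    define M where "M = (SUP x. d x)"
    define q where "q = pmf p z"
    have q: "0 < q" using z by (simp add: q_def pmf_positive)
    have q1: "q \<le> 1" by (simp add: q_def pmf_le_1)
    have dB: "\<bar>d x\<bar> \<le> 2 * B" for x
      using fB[of "x + z"] fB[of x] unfolding d_def by linarith
    have bdd: "bdd_above (range d)"
      using dB by (intro bdd_aboveI[of _ "2 * B"]) (auto simp: abs_le_iff)
    have dM: "d x \<le> M" for x unfolding M_def by (rule cSUP_upper[OF _ bdd]) simp
    have M: "0 < M" using dM[of x] pos unfolding d_def by linarith
    have fi: "integrable (measure_pmf p) (\<lambda>k. f (x + k))" for x
      by (rule integrable_bounded_pmf[where B=B]) (use fB in auto)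
    have di: "integrable (measure_pmf p) (\<lambda>k. d (x + k))" for x
      by (rule integrable_bounded_pmf[where B="2*B"]) (use dB in auto)
    have dh: "expect p (\<lambda>k. d (x + k)) = d x" for x
      using fh[of "x + z"] fh[of x] fi[of "x+z"] fi[of x] by (simp add: d_def add_ac)
    have step: "M - e / q \<le> d (x + z)" if "M - e \<le> d x" for x e
    proof -
      have "q * (M - d (x + z)) \<le> expect p (\<lambda>k. M - d (x + k))"
        unfolding q_def by (rule pmf_times_le_expectation) (use di dM in auto)
      also have "\<dots> = M - d x" using di dh by simp
      also have "\<dots> \<le> e" using that by linarith
      finally show ?thesis using q by (simp add: field_simps)
    qed
    have iter: "M - e / q ^ j \<le> d (x + int j * z)" if "M - e \<le> d x" for x e j
    proof (induction j)
      case (Suc j)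
      from step[OF Suc] show ?case by (simp add: field_simps)
    qed (use that in simp)
    obtain J :: nat where J: "2 * B < real J * (M / 2)"
      using M reals_Archimedean3[of "M / 2"] half_gt_zero by blast
    \<comment> \<open>After j < J steps the loss e / q ^ j is still at most M / 2.\<close>
    define e where "e = q ^ J * (M / 2)"
    have e: "0 < e" using q M by (simp add: e_def)
    then obtain y where y: "M - e \<le> d y"
    proof -
      have "M - e < (SUP x. d x)" using e unfolding M_def by simp
      then obtain y where "M - e < d y" unfolding less_cSUP_iff[OF UNIV_not_empty bdd] by blast
      then show ?thesis using that[of y] by simp
    qed
    have low: "M / 2 \<le> d (y + int j * z)" if "j < J" for j
    proof -
      have "q ^ J \<le> q ^ j" using that q q1 by (intro power_decreasing) auto
      then have "e / q ^ j \<le> M / 2" using q M by (simp add: e_def field_simps)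
      then show ?thesis using iter[OF y, of j] by linarith
    qed
    have "real J * (M / 2) = (\<Sum>j<J. M / 2)" by simp
    also have "\<dots> \<le> (\<Sum>j<J. d (y + int j * z))" by (intro sum_mono low) simp
    also have "\<dots> = (\<Sum>j<J. f (y + int (Suc j) * z) - f (y + int j * z))"
      by (simp add: d_def algebra_simps)
    also have "\<dots> = f (y + int J * z) - f (y + int 0 * z)" by (rule sum_lessThan_telescope)
    also have "\<dots> \<le> 2 * B" using fB[of "y + int J * z"] fB[of y] by simp
    finally show False using J by linarith
  qed
  have eq: "g (x + z) = g x" if z: "z \<in> set_pmf p" for x z
  proof -
    have "g (x + z) - g x \<le> 0" by (rule half[OF B harm z])
    moreover have "(- g (x + z)) - (- g x) \<le> 0"
      by (rule half[of "\<lambda>x. - g x", OF _ _ z]) (use B harm in auto)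
    ultimately show ?thesis by linarith
  qed
  have "x \<in> {z. \<forall>y. g (y + z) = g y}"
  proof (rule irreducible_walk_submonoid[OF irr])
    fix a b assume "a \<in> {z. \<forall>y. g (y + z) = g y}" "b \<in> {z. \<forall>y. g (y + z) = g y}"
    then show "a + b \<in> {z. \<forall>y. g (y + z) = g y}" by (simp add: add.assoc[symmetric])
  qed (use eq in auto)
  then show ?thesis by (metis (mono_tags, lifting) add_0 mem_Collect_eq)
qed

lemma expectation_le_const:
  fixes f :: "int \<Rightarrow> real"
  assumes "\<And>k. f k \<le> C" "integrable (measure_pmf p) f"
  shows "expect p f \<le> C"
proof -
  have "expect p f \<le> expect p (\<lambda>_. C)"
    using assms by (intro integral_mono) auto
  then show ?thesis by simp
qed

lemma walk_prob_nonneg: "0 \<le> walk_prob p n x" and walk_prob_le_1: "walk_prob p n x \<le> 1"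
  by (simp_all add: walk_prob_def pmf_le_1)

text \<open>
  The expected number of visits to \<open>0\<close> before time \<open>n\<close> by the walk started at \<open>x\<close>.
\<close>

definition green :: "int pmf \<Rightarrow> nat \<Rightarrow> int \<Rightarrow> real" where
  "green p n x = (\<Sum>k<n. walk_prob p k (- x))"

lemma green_nonneg: "0 \<le> green p n x" and green_le: "green p n x \<le> real n"
  unfolding green_def using walk_prob_nonneg walk_prob_le_1
  by (auto intro!: sum_nonneg order_trans[OF sum_bounded_above[where K=1]])

lemma integrable_green: "integrable (measure_pmf p) (\<lambda>k. green q n (x + k))"
  by (rule integrable_bounded_pmf[where B="real n"]) (simp add: green_nonneg green_le)

lemma integrable_walk_prob: "integrable (measure_pmf p) (\<lambda>k. walk_prob q n (x - k))"
  by (rule integrable_bounded_pmf[where B=1]) (simp add: walk_prob_nonneg walk_prob_le_1)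

lemma green_Suc:
  "green p (Suc n) x = (if x = 0 then 1 else 0) + expect p (\<lambda>k. green p n (x + k))"
proof -
  have "green p (Suc n) x = walk_prob p 0 (- x) + (\<Sum>k<n. walk_prob p (Suc k) (- x))"
    unfolding green_def by (rule sum.lessThan_Suc_shift)
  also have "(\<Sum>k<n. walk_prob p (Suc k) (- x)) = expect p (\<lambda>k. \<Sum>j<n. walk_prob p j (- x - k))"
    unfolding walk_prob_Suc by (intro Bochner_Integration.integral_sum[symmetric] integrable_walk_prob)
  finally show ?thesis by (simp add: walk_prob_0 green_def)
qed

text \<open>
  A time-dependent subsolution that is bounded by \<open>C\<close> at the origin is bounded by \<open>C\<close> everywhere.  The source
  term of the recursion for \<open>green\<close> sits at the origin, so this replaces hitting-time decompositions.
\<close>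

lemma maximum_principle:
  fixes D :: "nat \<Rightarrow> int \<Rightarrow> real"
  assumes "\<And>x. D 0 x \<le> C" "\<And>n. D n 0 \<le> C"
    and "\<And>n x. x \<noteq> 0 \<Longrightarrow> D (Suc n) x \<le> expect p (\<lambda>k. D n (x + k))"
    and "\<And>n x. integrable (measure_pmf p) (\<lambda>k. D n (x + k))"
  shows "D n x \<le> C"
proof (induction n arbitrary: x)
  case (Suc n)
  show ?case
  proof (cases "x = 0")
    case False
    then have "D (Suc n) x \<le> expect p (\<lambda>k. D n (x + k))" by (rule assms(3))
    also have "\<dots> \<le> C" by (intro expectation_le_const Suc assms)
    finally show ?thesis .
  qed (use assms in simp)
qed (use assms in simp)

text \<open>
  The partial sums of the series defining the potential, written as a difference of Green functions.
\<close>

definition pot_sum :: "int pmf \<Rightarrow> nat \<Rightarrow> int \<Rightarrow> real" where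
  "pot_sum p n x = green p n 0 - green p n x"

lemma pot_sum_0[simp]: "pot_sum p n 0 = 0" by (simp add: pot_sum_def)

lemma pot_sum_eq: "pot_sum p n x = (\<Sum>k<n. pmf (walk_law p k) 0 - pmf (walk_law p k) (- x))"
  by (simp add: pot_sum_def green_def walk_prob_def sum_subtractf)

text \<open>
  By the maximum principle the truncated Green function is largest at its own pole.
\<close>

lemma pot_sum_nonneg: "0 \<le> pot_sum p n x"
proof -
  have "green p n x - green p n 0 \<le> 0"
  proof (rule maximum_principle[where D="\<lambda>n x. green p n x - green p n 0" and p=p])
    fix n and x :: int assume "x \<noteq> 0"
    then have "green p (Suc n) x - green p (Suc n) 0
        = expect p (\<lambda>k. green p n (x + k)) - green p (Suc n) 0"
      by (simp add: green_Suc)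
    also have "\<dots> \<le> expect p (\<lambda>k. green p n (x + k)) - green p n 0"
      by (simp add: green_def walk_prob_nonneg)
    finally show "green p (Suc n) x - green p (Suc n) 0 \<le> expect p (\<lambda>k. green p n (x + k) - green p n 0)"
      by (simp add: integrable_green)
  qed (simp_all add: integrable_green, simp_all add: green_def)
  then show ?thesis by (simp add: pot_sum_def)
qed

text \<open>
  The increment in \<open>x\<close> by \<open>y\<close> is a difference of two Green functions whose positive source sits at \<open>0\<close>, where
  the increment equals \<open>pot_sum p n y\<close>; the maximum principle carries this bound to all \<open>x\<close>.
\<close>

lemma pot_sum_increment_le:
  assumes C: "\<And>n. pot_sum p n y \<le> C"
  shows "pot_sum p n (x + y) - pot_sum p n x \<le> C"
proof -
  have "green p n x - green p n (x + y) \<le> C"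
  proof (rule maximum_principle[where D="\<lambda>n x. green p n x - green p n (x + y)" and p=p])
    show i: "integrable (measure_pmf p) (\<lambda>k. green p n (x + k) - green p n (x + k + y))" for n x
      using integrable_green[of p p n x] integrable_green[of p p n "x + y"] by (simp add: add_ac)
    fix n and x :: int assume "x \<noteq> 0"
    then have "green p (Suc n) x - green p (Suc n) (x + y)
        \<le> expect p (\<lambda>k. green p n (x + k)) - expect p (\<lambda>k. green p n (x + y + k))"
      by (simp add: green_Suc)
    also have "\<dots> = expect p (\<lambda>k. green p n (x + k) - green p n (x + y + k))"
      by (intro Bochner_Integration.integral_diff[symmetric] integrable_green)
    finally show "green p (Suc n) x - green p (Suc n) (x + y)
        \<le> expect p (\<lambda>k. green p n (x + k) - green p n (x + k + y))"
      by (simp add: add_ac)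
  qed (use C[of 0] C in \<open>auto simp: pot_sum_def green_def\<close>)
  then show ?thesis by (simp add: pot_sum_def)
qed

lemma pot_sum_Suc: "pot_sum p (Suc n) x = pot_sum p n x + walk_prob p n 0 - walk_prob p n (- x)"
  by (simp add: pot_sum_def green_def)

text \<open>
  Since \<open>P[S\<^sub>n = -x] \<rightarrow> 0\<close>, every limit of the partial sums solves the Poisson equation with source at the origin.
\<close>

lemma expectation_pot_sum:
  "expect p (\<lambda>k. pot_sum p n (x + k))
     = pot_sum p n x - walk_prob p n (- x) + (if x = 0 then 1 else 0)"
proof -
  have "expect p (\<lambda>k. pot_sum p n (x + k))
      = green p n 0 - expect p (\<lambda>k. green p n (x + k))"
    unfolding pot_sum_def by (simp add: integrable_green)
  also have "\<dots> = green p n 0 - green p (Suc n) x + (if x = 0 then 1 else 0)"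
    by (simp add: green_Suc)
  also have "green p (Suc n) x = green p n x + walk_prob p n (- x)" by (simp add: green_def)
  finally show ?thesis by (simp add: pot_sum_def)
qed

lemma pot_sum_symmetrized:
  "pot_sum p n x + pot_sum p n (- x)
     = 2 / pi * (LBINT t:{0..pi}. (1 - cos (t * real_of_int x)) * Re (\<Sum>k<n. chf p t ^ k))"
proof (induction n)
  case 0
  show ?case by (simp add: pot_sum_def green_def set_lebesgue_integral_def)
next
  case (Suc n)
  define c where "c t = 1 - cos (t * real_of_int x)" for t
  let ?R = "\<lambda>y t. Re (chf p t ^ n * cis (- (t * real_of_int y)))"
  have Rb: "\<bar>Re (chf p t ^ n * w)\<bar> \<le> norm w" for t w
  proof -
    have "\<bar>Re (chf p t ^ n * w)\<bar> \<le> norm (chf p t ^ n) * norm w"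
      using abs_Re_le_cmod[of "chf p t ^ n * w"] by (simp only: norm_mult)
    also have "\<dots> \<le> 1 * norm w" by (intro mult_right_mono norm_chf_power_le) auto
    finally show ?thesis by simp
  qed
  have int: "set_integrable lborel {0..pi} (?R y)" for y
  proof (rule set_integrable_bounded_Icc[where B=1])
    show "norm (?R y t) \<le> 1" for t
      unfolding real_norm_def by (rule order_trans[OF Rb]) simp
  qed measurable
  have i1: "set_integrable lborel {0..pi} (\<lambda>t. c t * Re (chf p t ^ n))"
    and i2: "set_integrable lborel {0..pi} (\<lambda>t. c t * Re (\<Sum>k<n. chf p t ^ k))"
    unfolding c_def
    by (rule borel_integrable_atLeastAtMost', auto intro!: continuous_intros continuous_on_chf)+
  have pt: "2 * ?R 0 t - ?R (- x) t - ?R x t = 2 * (c t * Re (chf p t ^ n))" for t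
    by (simp add: c_def algebra_simps)
  have "2 * (LBINT t:{0..pi}. ?R 0 t) - (LBINT t:{0..pi}. ?R (- x) t) - (LBINT t:{0..pi}. ?R x t)
      = (LBINT t:{0..pi}. 2 * ?R 0 t - ?R (- x) t - ?R x t)"
    using int by (simp only: set_integral_diff set_integrable_mult_right_iff set_integral_mult_right)
  also have "\<dots> = 2 * (LBINT t:{0..pi}. c t * Re (chf p t ^ n))"
    unfolding pt by (rule set_integral_mult_right)
  finally have v: "2 * walk_prob p n 0 - walk_prob p n (- x) - walk_prob p n x = 2 / pi * (LBINT t:{0..pi}. c t * Re (chf p t ^ n))"
    unfolding walk_prob_Fourier by (simp add: field_simps)
  have "pot_sum p (Suc n) x + pot_sum p (Suc n) (- x)
      = (pot_sum p n x + pot_sum p n (- x)) + (2 * walk_prob p n 0 - walk_prob p n (- x) - walk_prob p n x)"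
    by (simp add: pot_sum_Suc)
  also have "\<dots> = 2 / pi * ((LBINT t:{0..pi}. c t * Re (\<Sum>k<n. chf p t ^ k)) + (LBINT t:{0..pi}. c t * Re (chf p t ^ n)))"
    unfolding v Suc.IH c_def by (rule distrib_left[symmetric])
  also have "(LBINT t:{0..pi}. c t * Re (\<Sum>k<n. chf p t ^ k)) + (LBINT t:{0..pi}. c t * Re (chf p t ^ n))
     = (LBINT t:{0..pi}. c t * Re (\<Sum>k<n. chf p t ^ k) + c t * Re (chf p t ^ n))"
    by (rule set_integral_add(2)[OF i2 i1, symmetric])
  also have "\<dots> = (LBINT t:{0..pi}. c t * Re (\<Sum>k<Suc n. chf p t ^ k))"
    by (simp add: distrib_left)
  finally show ?case unfolding c_def .
qed

section \<open>Convergence of the potential series\<close>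

text \<open>
  The right-hand side has an explicit primitive, which shows that the integral over \<open>t\<close> grows linearly in \<open>x\<close>.
\<close>

lemma one_minus_cos_div_square_le:
  fixes x t :: real assumes "t \<noteq> 0"
  shows "(1 - cos (t * x)) / t\<^sup>2 \<le> 5 / 2 * (x\<^sup>2 / (1 + (x * t)\<^sup>2))"
proof -
  let ?u = "t * x"
  have "(1 - cos ?u) * (1 + ?u\<^sup>2) = (1 - cos ?u) + (1 - cos ?u) * ?u\<^sup>2" by (simp add: algebra_simps)
  also have "\<dots> \<le> ?u\<^sup>2 / 2 + 2 * ?u\<^sup>2"
  proof (intro add_mono mult_right_mono one_minus_cos_le)
    show "1 - cos ?u \<le> 2" using cos_ge_minus_one[of ?u] by linarith
  qed simp
  finally have *: "(1 - cos ?u) * (1 + ?u\<^sup>2) \<le> 5 / 2 * ?u\<^sup>2" by simp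
  have pos: "0 < 1 + ?u\<^sup>2" by (simp add: add_pos_nonneg)
  have "(1 - cos ?u) \<le> 5 / 2 * ?u\<^sup>2 / (1 + ?u\<^sup>2)"
    using * pos by (simp only: pos_le_divide_eq)
  then have "(1 - cos ?u) / t\<^sup>2 \<le> 5 / 2 * ?u\<^sup>2 / (1 + ?u\<^sup>2) / t\<^sup>2"
    by (intro divide_right_mono) auto
  also have "\<dots> = 5 / 2 * (x\<^sup>2 / (1 + (x * t)\<^sup>2))"
    using assms by (simp add: power_mult_distrib mult.commute)
  finally show ?thesis .
qed

lemma integral_Lorentzian_le:
  fixes x :: real
  shows "(LBINT t:{0..pi}. x\<^sup>2 / (1 + (x * t)\<^sup>2)) \<le> \<bar>x\<bar> * (pi / 2)"
proof -
  have nz: "1 + (x * t)\<^sup>2 \<noteq> 0" for t :: real by (metis add_pos_nonneg less_irrefl zero_le_power2 zero_less_one)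
  have d: "((\<lambda>t. x * arctan (x * t)) has_real_derivative x\<^sup>2 / (1 + (x * t)\<^sup>2)) (at t within {0..pi})" for t
    using nz by (auto intro!: derivative_eq_intros simp: field_simps power2_eq_square)
  have "((\<lambda>t. x\<^sup>2 / (1 + (x * t)\<^sup>2)) has_integral (x * arctan (x * pi) - x * arctan (x * 0))) {0..pi}"
    by (rule fundamental_theorem_of_calculus)
       (use d in \<open>simp_all add: has_real_derivative_iff_has_vector_derivative\<close>)
  then have i: "integral {0..pi} (\<lambda>t. x\<^sup>2 / (1 + (x * t)\<^sup>2)) = x * arctan (x * pi)"
    by (intro integral_unique) simp
  have "set_integrable lborel {0..pi} (\<lambda>t. x\<^sup>2 / (1 + (x * t)\<^sup>2))"
    by (rule borel_integrable_atLeastAtMost') (auto intro!: continuous_intros simp: nz)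
  from set_borel_integral_eq_integral(2)[OF this]
  have "(LBINT t:{0..pi}. x\<^sup>2 / (1 + (x * t)\<^sup>2)) = x * arctan (x * pi)" unfolding i .
  also have "\<dots> \<le> \<bar>x\<bar> * \<bar>arctan (x * pi)\<bar>" by (metis abs_ge_self abs_mult)
  also have "\<dots> \<le> \<bar>x\<bar> * (pi / 2)"
    using arctan_bounded[of "x * pi"] by (intro mult_left_mono) auto
  finally show ?thesis .
qed

context heavy_walk
begin

text \<open>
  The Fourier integrand of the symmetrized potential.  At \<open>t = 0\<close> both numerator and denominator vanish, and
  the value is \<open>0\<close> by the convention for division.
\<close>

definition kern :: "int \<Rightarrow> real \<Rightarrow> complex" where
  "kern x t = of_real (1 - cos (t * real_of_int x)) / (1 - chf p t)"

lemma kern_measurable[measurable]: "kern x \<in> borel_measurable borel"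
  unfolding kern_def[abs_def] by measurable

lemma norm_kern_le:
  assumes K: "0 < K" and c: "0 \<le> c"
    "\<And>t. 0 < t \<Longrightarrow> t \<le> pi \<Longrightarrow> inverse (norm (1 - chf p t)) \<le> 1 / (K * t\<^sup>2) + c"
    and t: "0 \<le> t" "t \<le> pi"
  shows "norm (kern x t) \<le> 5 / (2 * K) * ((real_of_int x)\<^sup>2 / (1 + (real_of_int x * t)\<^sup>2)) + 2 * c"
proof (cases "t = 0")
  case True
  then show ?thesis using K c by (simp add: kern_def)
next
  case False
  let ?a = "1 - cos (t * real_of_int x)"
  have a: "0 \<le> ?a" "?a \<le> 2" using cos_ge_minus_one[of "t * real_of_int x"] by auto
  have "norm (kern x t) = ?a * inverse (norm (1 - chf p t))"
    unfolding kern_def norm_divide norm_of_real using a by (simp only: abs_of_nonneg divide_inverse)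
  also have "\<dots> \<le> ?a * (1 / (K * t\<^sup>2) + c)"
    using c(2)[of t] t False a by (intro mult_left_mono) auto
  also have "\<dots> = 1 / K * (?a / t\<^sup>2) + ?a * c"
    by (simp only: distrib_left times_divide_eq_right times_divide_eq_left divide_divide_eq_left mult_1_left mult_1_right mult.commute)
  also have "\<dots> \<le> 1 / K * (5 / 2 * ((real_of_int x)\<^sup>2 / (1 + (real_of_int x * t)\<^sup>2))) + 2 * c"
    using K a c False by (intro add_mono mult_left_mono mult_right_mono one_minus_cos_div_square_le) auto
  also have "1 / K * (5 / 2 * ((real_of_int x)\<^sup>2 / (1 + (real_of_int x * t)\<^sup>2)))
      = 5 / (2 * K) * ((real_of_int x)\<^sup>2 / (1 + (real_of_int x * t)\<^sup>2))"
    by (simp only: times_divide_times_eq mult_1_left mult.assoc[symmetric] mult.commute[of K])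
  finally show ?thesis .
qed

lemma kern_bounded: "\<exists>B. \<forall>t. 0 \<le> t \<longrightarrow> t \<le> pi \<longrightarrow> norm (kern x t) \<le> B"
proof -
  obtain c where c: "0 \<le> c" "\<And>t. 0 < t \<Longrightarrow> t \<le> pi \<Longrightarrow> inverse (norm (1 - chf p t)) \<le> 1 / (1 * t\<^sup>2) + c"
    using inverse_one_minus_chf_bound[of 1] by auto
  have "norm (kern x t) \<le> 5 / (2 * 1) * (real_of_int x)\<^sup>2 + 2 * c" if t: "0 \<le> t" "t \<le> pi" for t
  proof -
    have "(real_of_int x)\<^sup>2 / (1 + (real_of_int x * t)\<^sup>2) \<le> (real_of_int x)\<^sup>2 / 1"
      by (intro divide_left_mono) (auto simp: add_pos_nonneg)
    then have "5 / (2 * 1) * ((real_of_int x)\<^sup>2 / (1 + (real_of_int x * t)\<^sup>2)) \<le> 5 / (2 * 1) * (real_of_int x)\<^sup>2"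
      by (intro mult_left_mono) auto
    moreover have "norm (kern x t) \<le> 5 / (2 * 1) * ((real_of_int x)\<^sup>2 / (1 + (real_of_int x * t)\<^sup>2)) + 2 * c"
      by (rule norm_kern_le[OF _ c t]) simp
    ultimately show ?thesis by linarith
  qed
  then show ?thesis by blast
qed

lemma set_integrable_Re_kern: "set_integrable lborel {0..pi} (\<lambda>t. Re (kern x t))"
proof -
  obtain B where B: "\<forall>t. 0 \<le> t \<longrightarrow> t \<le> pi \<longrightarrow> norm (kern x t) \<le> B" using kern_bounded by blast
  show ?thesis
  proof (rule set_integrable_bounded_Icc[where B=B])
    fix t :: real assume "0 \<le> t" "t \<le> pi"
    then show "norm (Re (kern x t)) \<le> B" using B abs_Re_le_cmod[of "kern x t"] by fastforce
  qed measurable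
qed

lemma chf_neq_1: "chf p t \<noteq> 1" if "0 < t" "t \<le> pi"
  using Re_chf_less_1[OF that] by auto

lemma pot_sum_kern:
  assumes t: "0 \<le> t" "t \<le> pi"
  shows "(1 - cos (t * real_of_int x)) * Re (\<Sum>k<n. chf p t ^ k) = Re (kern x t) - Re (chf p t ^ n * kern x t)"
proof (cases "t = 0")
  case True
  then show ?thesis by (simp add: kern_def)
next
  case False
  then have "chf p t \<noteq> 1" using chf_neq_1[of t] t by simp
  then have "(\<Sum>k<n. chf p t ^ k) = (1 - chf p t ^ n) / (1 - chf p t)"
    using geometric_sum[of "chf p t" n] by (metis minus_diff_eq minus_divide_divide)
  moreover have "u * ((1 - v) / w) = u / w - v * (u / w)" for u v w :: complex
    by (simp add: right_diff_distrib diff_divide_distrib mult.commute)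
  ultimately have "of_real (1 - cos (t * real_of_int x)) * (\<Sum>k<n. chf p t ^ k) = kern x t - chf p t ^ n * kern x t"
    by (simp only: kern_def)
  then have "Re (of_real (1 - cos (t * real_of_int x)) * (\<Sum>k<n. chf p t ^ k)) = Re (kern x t - chf p t ^ n * kern x t)"
    by (rule arg_cong)
  moreover have "Re (of_real u * w) = u * Re w" for u w by simp
  ultimately show ?thesis by (simp only: minus_complex.simps)
qed

lemma pot_sum_symmetrized_tendsto:
  "(\<lambda>n. pot_sum p n x + pot_sum p n (- x)) \<longlonglongrightarrow> 2 / pi * (LBINT t:{0..pi}. Re (kern x t))"
proof -
  obtain B where B: "\<And>t. 0 \<le> t \<Longrightarrow> t \<le> pi \<Longrightarrow> norm (kern x t) \<le> B" using kern_bounded by blast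
  have i: "set_integrable lborel {0..pi} (\<lambda>t. Re (chf p t ^ n * kern x t))" for n
  proof (rule set_integrable_bounded_Icc[where B="1 * B"])
    fix t :: real assume t: "0 \<le> t" "t \<le> pi"
    have "norm (Re (chf p t ^ n * kern x t)) \<le> norm (chf p t ^ n) * norm (kern x t)"
      unfolding real_norm_def norm_mult[symmetric] by (rule abs_Re_le_cmod)
    also have "\<dots> \<le> 1 * B" using B[OF t] by (intro mult_mono norm_chf_power_le) auto
    finally show "norm (Re (chf p t ^ n * kern x t)) \<le> 1 * B" .
  qed measurable
  have e: "pot_sum p n x + pot_sum p n (- x)
      = 2 / pi * ((LBINT t:{0..pi}. Re (kern x t)) - (LBINT t:{0..pi}. Re (chf p t ^ n * kern x t)))" for n
  proof -
    have "(LBINT t:{0..pi}. (1 - cos (t * real_of_int x)) * Re (\<Sum>k<n. chf p t ^ k))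
        = (LBINT t:{0..pi}. Re (kern x t) - Re (chf p t ^ n * kern x t))"
      by (intro set_lebesgue_integral_cong) (use pot_sum_kern in auto)
    also have "\<dots> = (LBINT t:{0..pi}. Re (kern x t)) - (LBINT t:{0..pi}. Re (chf p t ^ n * kern x t))"
      by (rule set_integral_diff(2)[OF set_integrable_Re_kern i])
    finally show ?thesis unfolding pot_sum_symmetrized by simp
  qed
  have "(\<lambda>n. 2 / pi * ((LBINT t:{0..pi}. Re (kern x t)) - (LBINT t:{0..pi}. Re (chf p t ^ n * kern x t))))
      \<longlonglongrightarrow> 2 / pi * ((LBINT t:{0..pi}. Re (kern x t)) - 0)"
    by (intro tendsto_mult tendsto_diff tendsto_const chf_power_integral_tendsto_0[OF kern_measurable B])
  then show ?thesis unfolding e by simp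
qed

text \<open>
  The slope \<open>5/K\<close> can be made arbitrarily small, uniformly in the number of terms.  Sublinearity is what rules
  out the linear harmonic functions of a centred walk in the uniqueness argument.
\<close>

lemma pot_sum_sublinear:
  assumes K: "0 < K"
  obtains c where "0 \<le> c" "\<And>n x. pot_sum p n x \<le> 5 / K * \<bar>real_of_int x\<bar> + c"
proof -
  obtain c where c: "0 \<le> c" "\<And>t. 0 < t \<Longrightarrow> t \<le> pi \<Longrightarrow> inverse (norm (1 - chf p t)) \<le> 1 / (K * t\<^sup>2) + c"
    using inverse_one_minus_chf_bound[OF K] by metis
  have "pot_sum p n x \<le> 5 / K * \<bar>real_of_int x\<bar> + 8 * c" for n and x :: int
  proof -
    let ?L = "\<lambda>t. (real_of_int x)\<^sup>2 / (1 + (real_of_int x * t)\<^sup>2)"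
    have nz: "1 + (real_of_int x * t)\<^sup>2 \<noteq> 0" for t :: real
      by (metis add_pos_nonneg less_irrefl zero_le_power2 zero_less_one)
    have iL: "set_integrable lborel {0..pi} ?L"
      by (rule borel_integrable_atLeastAtMost') (auto intro!: continuous_intros simp: nz)
    have ic: "set_integrable lborel {0..pi} (\<lambda>t. C :: real)" for C
      by (rule borel_integrable_atLeastAtMost') auto
    have pt: "(1 - cos (t * real_of_int x)) * Re (\<Sum>k<n. chf p t ^ k) \<le> 5 / K * ?L t + 4 * c"
      if t: "0 \<le> t" "t \<le> pi" for t
    proof -
      have "Re (kern x t) \<le> norm (kern x t)" by (rule complex_Re_le_cmod)
      moreover have "- Re (chf p t ^ n * kern x t) \<le> norm (chf p t ^ n * kern x t)"
        using abs_Re_le_cmod[of "chf p t ^ n * kern x t"] by linarith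
      moreover have "norm (chf p t ^ n * kern x t) \<le> 1 * norm (kern x t)"
        unfolding norm_mult by (intro mult_right_mono norm_chf_power_le) auto
      moreover have "norm (kern x t) \<le> 5 / (2 * K) * ?L t + 2 * c"
        by (rule norm_kern_le[OF K c t])
      ultimately have "(1 - cos (t * real_of_int x)) * Re (\<Sum>k<n. chf p t ^ k) \<le> 2 * (5 / (2 * K) * ?L t + 2 * c)"
        unfolding pot_sum_kern[OF t] by argo
      moreover have "2 * (5 / (2 * K) * L + 2 * c) = 5 / K * L + 4 * c" for L
        using K by (simp add: field_simps)
      ultimately show ?thesis by simp
    qed
    have "pot_sum p n x \<le> pot_sum p n x + pot_sum p n (- x)" using pot_sum_nonneg by simp
    also have "\<dots> = 2 / pi * (LBINT t:{0..pi}. (1 - cos (t * real_of_int x)) * Re (\<Sum>k<n. chf p t ^ k))"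
      by (rule pot_sum_symmetrized)
    also have "\<dots> \<le> 2 / pi * (LBINT t:{0..pi}. 5 / K * ?L t + 4 * c)"
    proof (intro mult_left_mono set_integral_mono)
      show "set_integrable lborel {0..pi} (\<lambda>t. (1 - cos (t * real_of_int x)) * Re (\<Sum>k<n. chf p t ^ k))"
        by (rule borel_integrable_atLeastAtMost') (auto intro!: continuous_intros continuous_on_chf)
      show "set_integrable lborel {0..pi} (\<lambda>t. 5 / K * ?L t + 4 * c)"
        by (intro set_integral_add(1) set_integrable_mult_right iL ic)
    qed (use pt in auto)
    also have "(LBINT t:{0..pi}. 5 / K * ?L t + 4 * c) = 5 / K * (LBINT t:{0..pi}. ?L t) + 4 * c * pi"
    proof -
      have "(LBINT t:{0..pi}. 5 / K * ?L t + 4 * c) = (LBINT t:{0..pi}. 5 / K * ?L t) + (LBINT t:{0..pi}. 4 * c)"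
        by (intro set_integral_add(2) set_integrable_mult_right iL ic)
      moreover have "(LBINT t:{0..pi}. 4 * c) = 4 * c * pi" by (simp add: set_lebesgue_integral_def)
      ultimately show ?thesis by (simp only: set_integral_mult_right)
    qed
    also have "2 / pi * \<dots> \<le> 2 / pi * (5 / K * (\<bar>real_of_int x\<bar> * (pi / 2)) + 4 * c * pi)"
      using K by (intro mult_left_mono add_right_mono integral_Lorentzian_le) auto
    also have "\<dots> = 5 / K * \<bar>real_of_int x\<bar> + 8 * c" by (simp add: field_simps)
    finally show ?thesis .
  qed
  then show ?thesis using that[of "8 * c"] c by auto
qed

text \<open>
  Pointwise limits of the partial sums along a subsequence; they all turn out to be equal.
\<close>

definition potential_limit :: "(int \<Rightarrow> real) \<Rightarrow> bool" where
  "potential_limit a \<longleftrightarrow> (\<exists>r :: nat \<Rightarrow> nat. strict_mono r \<and> (\<forall>x. (\<lambda>n. pot_sum p (r n) x) \<longlonglongrightarrow> a x))"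

text \<open>
  The bound \<open>5\<bar>x\<bar> + c\<close> for the partial sums is integrable with respect to the step because the step has a first
  moment, so expectation and limit can be exchanged.
\<close>

lemma potential_limit_Poisson:
  assumes "potential_limit a"
  shows "integrable (measure_pmf p) (\<lambda>k. a (x + k))"
    and "expect p (\<lambda>k. a (x + k)) = a x + (if x = 0 then 1 else 0)"
proof -
  obtain r where r: "strict_mono r" and lim: "\<And>x. (\<lambda>n. pot_sum p (r n) x) \<longlonglongrightarrow> a x"
    using assms unfolding potential_limit_def by blast
  obtain c where c: "0 \<le> c" "\<And>n x. pot_sum p n x \<le> 5 / 1 * \<bar>real_of_int x\<bar> + c"
    using pot_sum_sublinear[of 1] by auto
  let ?w = "\<lambda>k. 5 * \<bar>real_of_int x\<bar> + 5 * \<bar>real_of_int k\<bar> + c"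
  have w: "integrable (measure_pmf p) ?w" by simp
  have le: "norm (pot_sum p n (x + k)) \<le> ?w k" for n k
  proof -
    have "\<bar>real_of_int (x + k)\<bar> \<le> \<bar>real_of_int x\<bar> + \<bar>real_of_int k\<bar>" by simp
    then show ?thesis using c(2)[of n "x + k"] pot_sum_nonneg[of p n "x + k"] by simp
  qed
  show "integrable (measure_pmf p) (\<lambda>k. a (x + k))"
    by (rule integrable_dominated_convergence[OF _ _ w, where s="\<lambda>n k. pot_sum p (r n) (x + k)"])
       (use lim le in auto)
  have l1: "(\<lambda>n. expect p (\<lambda>k. pot_sum p (r n) (x + k))) \<longlonglongrightarrow> expect p (\<lambda>k. a (x + k))"
    by (rule integral_dominated_convergence[OF _ _ w]) (use lim le in auto)
  have v: "(\<lambda>n. walk_prob p (r n) (- x)) \<longlonglongrightarrow> 0"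
    using LIMSEQ_subseq_LIMSEQ[OF walk_prob_tendsto_0 r] by (simp add: comp_def)
  have l2: "(\<lambda>n. expect p (\<lambda>k. pot_sum p (r n) (x + k))) \<longlonglongrightarrow> a x - 0 + (if x = 0 then 1 else 0)"
    unfolding expectation_pot_sum by (intro tendsto_intros lim v)
  show "expect p (\<lambda>k. a (x + k)) = a x + (if x = 0 then 1 else 0)"
    using LIMSEQ_unique[OF l1 l2] by simp
qed

lemma potential_limit_bounds:
  assumes "potential_limit a"
  shows "a 0 = 0" "0 \<le> a x" 
    and "(\<And>n x. pot_sum p n x \<le> f x) \<Longrightarrow> a x \<le> f x"
    and "(\<And>n x. pot_sum p n (x + y) - pot_sum p n x \<le> C) \<Longrightarrow> a (x + y) - a x \<le> C"
proof -
  obtain r where r: "strict_mono r" and lim: "\<And>x. (\<lambda>n. pot_sum p (r n) x) \<longlonglongrightarrow> a x"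
    using assms unfolding potential_limit_def by blast
  show "a 0 = 0" using LIMSEQ_unique[OF lim[of 0]] by simp
  show "0 \<le> a x" by (rule LIMSEQ_le_const[OF lim]) (use pot_sum_nonneg in auto)
  show "a x \<le> f x" if "\<And>n x. pot_sum p n x \<le> f x"
    by (rule LIMSEQ_le_const2[OF lim]) (use that in auto)
  show "a (x + y) - a x \<le> C" if "\<And>n x. pot_sum p n (x + y) - pot_sum p n x \<le> C"
    by (rule LIMSEQ_le_const2[OF tendsto_diff[OF lim lim]]) (use that in auto)
qed

text \<open>
  The difference \<open>h\<close> of two limits is harmonic, since the sources cancel, and has bounded increments.  Hence
  \<open>h(x + 1) - h(x)\<close> is bounded and harmonic, so it is constant; \<open>h\<close> is linear, and being sublinear it vanishes.
\<close>

lemma potential_limit_unique: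
  assumes a: "potential_limit a" and b: "potential_limit b"
  shows "a = b"
proof -
  define h where "h x = a x - b x" for x
  obtain c where c: "0 \<le> c" "\<And>n x. pot_sum p n x \<le> 5 / 1 * \<bar>real_of_int x\<bar> + c"
    using pot_sum_sublinear[of 1] by auto
  have up: "a (x + 1) - a x \<le> 5 + c" "a (x + - 1) - a x \<le> 5 + c" if "potential_limit a" for a x
    using c(2)[of _ 1] c(2)[of _ "-1"]
    by (auto intro!: potential_limit_bounds(4)[OF that] pot_sum_increment_le simp del: add_uminus_conv_diff)
  have inc: "\<bar>a (x + 1) - a x\<bar> \<le> 5 + c" if "potential_limit a" for a x
    using up(1)[OF that, of x] up(2)[OF that, of "x + 1"] by (simp add: abs_le_iff)
  have gB: "\<bar>h (x + 1) - h x\<bar> \<le> 2 * (5 + c)" for x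
    using inc[OF a, of x] inc[OF b, of x] unfolding h_def abs_le_iff by argo
  have hi: "integrable (measure_pmf p) (\<lambda>k. h (x + k))" for x
    unfolding h_def using potential_limit_Poisson(1)[OF a] potential_limit_Poisson(1)[OF b] by auto
  have hh: "expect p (\<lambda>k. h (x + k)) = h x" for x
    unfolding h_def using potential_limit_Poisson[OF a] potential_limit_Poisson[OF b] by simp
  have const: "h (x + 1) - h x = h (0 + 1) - h 0" for x
  proof (rule bounded_harmonic_const[OF irreducible, where g="\<lambda>x. h (x + 1) - h x"])
    show "\<bar>h (x + 1) - h x\<bar> \<le> 2 * (5 + c)" for x by (rule gB)
    show "expect p (\<lambda>k. h (x + k + 1) - h (x + k)) = h (x + 1) - h x" for x
      using hi[of "x + 1"] hi[of x] hh[of "x + 1"] hh[of x] by (simp add: add_ac)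
  qed
  define d where "d = h 1 - h 0"
  have h0: "h 0 = 0" using potential_limit_bounds(1)[OF a] potential_limit_bounds(1)[OF b] by (simp add: h_def)
  have step: "h (x + 1) = h x + d" for x using const[of x] by (simp add: d_def)
  have lin: "h (int n) = real n * d" for n
  proof (induction n)
    case (Suc n)
    then show ?case using step[of "int n"] by (simp add: algebra_simps)
  qed (simp add: h0)
  have linneg: "h (- int n) = - (real n * d)" for n
  proof (induction n)
    case (Suc n)
    then show ?case using step[of "- int (Suc n)"] by (simp add: algebra_simps)
  qed (simp add: h0)
  \<comment> \<open>Both limits have slope at most e / 2, so the slope d of their difference is at most e.\<close>
  have "\<bar>d\<bar> \<le> 0 + e" if e: "0 < e" for e
  proof (rule ccontr)
    assume d: "\<not> \<bar>d\<bar> \<le> 0 + e"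
    obtain c where c: "0 \<le> c" "\<And>n x. pot_sum p n x \<le> 5 / (10 / e) * \<bar>real_of_int x\<bar> + c"
      using pot_sum_sublinear[of "10 / e"] e by auto
    have "real n * (\<bar>d\<bar> - e) \<le> 2 * c" for n
    proof -
      have "a (int n) \<le> 5 / (10 / e) * \<bar>real_of_int (int n)\<bar> + c"
        by (rule potential_limit_bounds(3)[OF a, where f="\<lambda>x. 5 / (10 / e) * \<bar>real_of_int x\<bar> + c", OF c(2)])
      moreover have "b (int n) \<le> 5 / (10 / e) * \<bar>real_of_int (int n)\<bar> + c"
        by (rule potential_limit_bounds(3)[OF b, where f="\<lambda>x. 5 / (10 / e) * \<bar>real_of_int x\<bar> + c", OF c(2)])
      moreover have "0 \<le> a (int n)" "0 \<le> b (int n)"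
        using potential_limit_bounds(2) a b by auto
      ultimately have "\<bar>h (int n)\<bar> \<le> 2 * (5 / (10 / e) * real n + c)" unfolding h_def by (simp add: abs_le_iff)
      also have "\<dots> = real n * e + 2 * c" by simp
      finally show ?thesis unfolding lin by (simp add: abs_mult algebra_simps)
    qed
    moreover have "\<exists>n. 2 * c < real n * (\<bar>d\<bar> - e)"
      using reals_Archimedean3[of "\<bar>d\<bar> - e"] d by auto
    ultimately show False by (meson not_le)
  qed
  then have "\<bar>d\<bar> \<le> 0" by (rule field_le_epsilon)
  then have "h x = 0" for x
    using lin[of "nat x"] linneg[of "nat (- x)"] by (cases "0 \<le> x") auto
  then show "a = b" unfolding h_def by (intro ext) (metis right_minus_eq)
qed

text \<open>
  The pointwise bounds confine the partial sums to a product of compact intervals, which is compact by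
  Tychonoff's theorem and sequentially compact because the index set is countable.
\<close>

lemma potential_limit_exists:
  fixes s :: "nat \<Rightarrow> nat"
  assumes s: "strict_mono s"
  obtains r a where "strict_mono r" "potential_limit a" "\<And>x. (\<lambda>n. pot_sum p (s (r n)) x) \<longlonglongrightarrow> a x"
proof -
  obtain c where c: "0 \<le> c" "\<And>n x. pot_sum p n x \<le> 5 / 1 * \<bar>real_of_int x\<bar> + c"
    using pot_sum_sublinear[of 1] by auto
  define S where "S = (\<Pi>\<^sub>E x\<in>(UNIV :: int set). {0..5 / 1 * \<bar>real_of_int x\<bar> + c})"
  have "compactin (product_topology (\<lambda>_ :: int. euclidean :: real topology) UNIV) S"
    unfolding S_def compactin_PiE by simp
  then have "compact S" by (simp add: euclidean_product_topology)
  then have sc: "seq_compact S" by (rule compact_imp_seq_compact)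
  have "\<forall>n. pot_sum p (s n) \<in> S" using pot_sum_nonneg c(2) unfolding S_def by auto
  from seq_compactE[OF sc this]
  obtain a r where r: "strict_mono (r :: nat \<Rightarrow> nat)" and l: "((\<lambda>n. pot_sum p (s n)) \<circ> r) \<longlonglongrightarrow> a" by metis
  have lx: "(\<lambda>n. pot_sum p (s (r n)) x) \<longlonglongrightarrow> a x" for x
    using continuous_on_tendsto_compose[where f="\<lambda>g. g x" and s=UNIV, OF continuous_on_product_coordinates l]
    by (simp add: comp_def)
  have "strict_mono (s \<circ> r)" using s r by (rule strict_mono_o)
  then have "potential_limit a" unfolding potential_limit_def using lx by (auto simp: comp_def)
  then show ?thesis using that r lx by blast
qed

lemma pot_sum_convergent: "convergent (\<lambda>n. pot_sum p n x)"
proof -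
  obtain r0 a where a: "potential_limit a"
    using potential_limit_exists[of "\<lambda>n. n"] by (metis strict_mono_def)
  have "(\<lambda>n. pot_sum p n x) \<longlonglongrightarrow> a x"
  proof (rule tendstoI, rule ccontr)
    fix e :: real assume e: "0 < e" and "\<not> (\<forall>\<^sub>F n in sequentially. dist (pot_sum p n x) (a x) < e)"
    then obtain s where s: "strict_mono (s :: nat \<Rightarrow> nat)" and far: "\<And>n. \<not> dist (pot_sum p (s n) x) (a x) < e"
      using not_eventually_sequentiallyD by metis
    obtain r b where b: "strict_mono r" "potential_limit b" "\<And>x. (\<lambda>n. pot_sum p (s (r n)) x) \<longlonglongrightarrow> b x"
      using potential_limit_exists[OF s] by metis
    have "(\<lambda>n. pot_sum p (s (r n)) x) \<longlonglongrightarrow> a x"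
      using b(3)[of x] potential_limit_unique[OF a b(2)] by simp
    then show False using tendstoD[OF _ e] far by fastforce
  qed
  then show ?thesis by (rule convergentI)
qed

lemma pot_sum_tendsto_potential: "(\<lambda>n. pot_sum p n x) \<longlonglongrightarrow> potential p x"
proof -
  obtain l where l: "(\<lambda>n. pot_sum p n x) \<longlonglongrightarrow> l" using pot_sum_convergent unfolding convergent_def by blast
  then have "(\<lambda>k. pmf (walk_law p k) 0 - pmf (walk_law p k) (- x)) sums l"
    unfolding sums_def pot_sum_eq .
  then have "potential p x = l" unfolding potential_def by (rule sums_unique[symmetric])
  with l show ?thesis by simp
qed

lemma sym_potential_eq: "sym_potential p x = (LBINT t:{0..pi}. Re (kern x t)) / pi"
proof -
  have "(\<lambda>n. pot_sum p n x + pot_sum p n (- x)) \<longlonglongrightarrow> potential p x + potential p (- x)"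
    by (intro tendsto_add pot_sum_tendsto_potential)
  from LIMSEQ_unique[OF this pot_sum_symmetrized_tendsto] show ?thesis
    unfolding sym_potential_def by simp
qed

end

section \<open>Tail functions as expectations\<close>

text \<open>
  Integrals against a tail function \<open>y \<mapsto> P[a(X) > y]\<close> become expectations of integrals up to the random end
  point \<open>a(X)\<close>.  The functions \<open>\<eta>\<close>, \<open>\<alpha>\<close> and \<open>\<beta>\<^sub>\<plusminus>\<close> are all evaluated in this way.
\<close>

lemma tail_Fubini:
  fixes a :: "int \<Rightarrow> real" and w :: "real \<Rightarrow> real"
  assumes a: "integrable (measure_pmf p) a" and w: "w \<in> borel_measurable borel" "\<And>y. \<bar>w y\<bar> \<le> W"
  shows "(LBINT y:{l..}. measure_pmf.prob p {k. y < a k} * w y) = expect p (\<lambda>k. LBINT y:{l..a k}. w y)"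
    and "integrable (measure_pmf p) (\<lambda>k. LBINT y:{l..a k}. w y)"
proof -
  define f where "f k y = indicator {l..} y * (indicator {..<a k} y * w y)" for k y
  have ae: "AE y in lborel. f k y = indicator {l..a k} y *\<^sub>R w y" for k
  proof -
    have "AE y in lborel. y \<noteq> a k" by (rule AE_lborel_singleton)
    then show ?thesis by eventually_elim (auto simp: f_def indicator_def)
  qed
  have fm: "f k \<in> borel_measurable lborel" for k
    unfolding f_def[abs_def] using w(1) by measurable
  have iw: "integrable lborel (\<lambda>y. indicator {l..a k} y *\<^sub>R w y)" for k
    using set_integrable_bounded_Icc[OF w(1), of l "a k" W] w(2) unfolding set_integrable_def by simp
  have fi: "integrable lborel (f k)" for k
    using iw[of k] integrable_cong_AE[OF fm _ ae, of k] borel_measurable_integrable[OF iw] by blast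
  have fe: "(\<integral>y. f k y \<partial>lborel) = (LBINT y:{l..a k}. w y)" for k
    unfolding set_lebesgue_integral_def using fm borel_measurable_integrable[OF iw] ae by (rule integral_cong_AE)
  have W: "0 \<le> W" using w(2)[of 0] by linarith
  have nb: "(\<integral>y. norm (f k y) \<partial>lborel) \<le> W * (\<bar>a k\<bar> + \<bar>l\<bar>)" for k
  proof -
    have "(\<integral>y. norm (f k y) \<partial>lborel) \<le> (\<integral>y. indicator {l..a k} y *\<^sub>R W \<partial>lborel)"
    proof (rule integral_mono_AE)
      show "AE y in lborel. norm (f k y) \<le> indicator {l..a k} y *\<^sub>R W"
        using ae[of k] by eventually_elim (use w(2) in \<open>auto simp: indicator_def\<close>)
    qed (use fi in \<open>auto simp: emeasure_lborel_Icc_eq\<close>)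
    also have "\<dots> = max 0 (a k - l) * W" by (simp add: max_def)
    also have "\<dots> \<le> (\<bar>a k\<bar> + \<bar>l\<bar>) * W" using W by (intro mult_right_mono) auto
    finally show ?thesis by (simp add: mult.commute)
  qed
  have ni: "integrable (measure_pmf p) (\<lambda>k. \<integral>y. norm (f k y) \<partial>lborel)"
  proof (rule Bochner_Integration.integrable_bound)
    show "integrable (measure_pmf p) (\<lambda>k. W * (\<bar>a k\<bar> + \<bar>l\<bar>))"
      by (intro integrable_mult_right Bochner_Integration.integrable_add integrable_abs a) auto
    show "AE k in measure_pmf p. norm (\<integral>y. norm (f k y) \<partial>lborel) \<le> norm (W * (\<bar>a k\<bar> + \<bar>l\<bar>))"
    proof (rule AE_I2)
      fix k
      have "0 \<le> (\<integral>y. norm (f k y) \<partial>lborel)" by (intro integral_nonneg_AE AE_I2) simp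
      then have "norm (\<integral>y. norm (f k y) \<partial>lborel) = (\<integral>y. norm (f k y) \<partial>lborel)" by (simp only: real_norm_def abs_of_nonneg)
      also have "\<dots> \<le> W * (\<bar>a k\<bar> + \<bar>l\<bar>)" by (rule nb)
      also have "\<dots> \<le> norm (W * (\<bar>a k\<bar> + \<bar>l\<bar>))" unfolding real_norm_def by (rule abs_ge_self)
      finally show "norm (\<integral>y. norm (f k y) \<partial>lborel) \<le> norm (W * (\<bar>a k\<bar> + \<bar>l\<bar>))" .
    qed
  qed simp
  have pr: "measure_pmf.prob p {k. y < a k} = expect p (\<lambda>k. indicator {..<a k} y)" for y
  proof -
    have "(\<lambda>k. indicator {..<a k} y :: real) = indicator {k. y < a k}" by (auto simp: indicator_def fun_eq_iff)
    then show ?thesis by simp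
  qed
  have "(LBINT y:{l..}. measure_pmf.prob p {k. y < a k} * w y) = (\<integral>y. expect p (\<lambda>k. f k y) \<partial>lborel)"
    unfolding set_lebesgue_integral_def f_def pr by (simp add: mult_ac)
  also have "\<dots> = expect p (\<lambda>k. LBINT y:{l..a k}. w y)"
    unfolding pmf_lborel_Fubini(2)[OF fi ni] fe ..
  finally show "(LBINT y:{l..}. measure_pmf.prob p {k. y < a k} * w y) = expect p (\<lambda>k. LBINT y:{l..a k}. w y)" .
  show "integrable (measure_pmf p) (\<lambda>k. LBINT y:{l..a k}. w y)"
  proof (rule Bochner_Integration.integrable_bound[OF ni])
    show "AE k in measure_pmf p. norm (LBINT y:{l..a k}. w y) \<le> norm (\<integral>y. norm (f k y) \<partial>lborel)"
      unfolding fe[symmetric] by (intro AE_I2 order_trans[OF integral_norm_bound]) simp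
  qed simp
qed

lemma mu_eq: "0 \<le> y \<Longrightarrow> mu p y = measure_pmf.prob p {k. y < \<bar>real_of_int k\<bar>}"
proof -
  assume y: "0 \<le> y"
  have "{k. y < \<bar>real_of_int k\<bar>} = {k. real_of_int k < - y} \<union> {k. real_of_int k > y}" by auto
  moreover have "{k. real_of_int k < - y} \<inter> {k. real_of_int k > y} = {}" using y by auto
  ultimately show ?thesis
    unfolding mu_def mu_minus_def mu_plus_def by (simp add: measure_pmf.finite_measure_Union)
qed

lemma LBINT_const_Icc: "(LBINT y:{a..b}. c) = max 0 (b - a) * (c :: real)"
  by (simp add: set_lebesgue_integral_def max_def)

lemma LBINT_FTC:
  fixes F f :: "real \<Rightarrow> real"
  assumes "a \<le> b" "\<And>y. (F has_real_derivative f y) (at y)" "continuous_on UNIV f"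
  shows "(LBINT y:{a..b}. f y) = F b - F a"
proof -
  have "set_integrable lborel {a..b} f"
    by (rule borel_integrable_atLeastAtMost') (rule continuous_on_subset[OF assms(3)], simp)
  moreover have "(f has_integral (F b - F a)) {a..b}"
    by (rule fundamental_theorem_of_calculus[OF assms(1)])
       (use assms(2) in \<open>auto simp: has_real_derivative_iff_has_vector_derivative intro: has_vector_derivative_at_within\<close>)
  ultimately show ?thesis using set_borel_integral_eq_integral(2) integral_unique by metis
qed

text \<open>
  Agrees with \<open>\<eta>\<close> on the half-line \<open>x \<ge> 0\<close> and is Lipschitz on all of \<open>\<real>\<close>, which makes the fundamental theorem
  of calculus directly applicable to \<open>m\<close>.
\<close>

definition overshoot :: "int pmf \<Rightarrow> real \<Rightarrow> real" where
  "overshoot p x = expect p (\<lambda>k. max 0 (\<bar>real_of_int k\<bar> - x))"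

text \<open>
  This is \<open>c(x) = \<integral>\<^sub>0\<^sup>x y \<mu>(y) dy = m(x) - x \<eta>(x)\<close>, in a form that is evidently monotone.
\<close>

definition trunc :: "int pmf \<Rightarrow> real \<Rightarrow> real" where
  "trunc p x = expect p (\<lambda>k. min ((real_of_int k)\<^sup>2) (x\<^sup>2)) / 2"

lemma has_real_derivative_mult_abs: "((\<lambda>u. u * \<bar>u\<bar>) has_real_derivative 2 * \<bar>u\<bar>) (at u)" for u :: real
proof -
  consider "u = 0" | "u > 0" | "u < 0" by linarith
  then show ?thesis
  proof cases
    case 1
    have "((\<lambda>h :: real. \<bar>h\<bar>) \<longlongrightarrow> \<bar>0\<bar>) (at 0)" by (intro tendsto_intros)
    then have "((\<lambda>h :: real. (h * \<bar>h\<bar>) / h) \<longlongrightarrow> \<bar>0\<bar>) (at 0)"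
      by (rule Lim_transform_eventually) (auto simp: eventually_at_filter)
    then show ?thesis using 1 by (simp add: has_field_derivative_iff)
  next
    case 2
    have "((\<lambda>u. u * u) has_real_derivative 2 * \<bar>u\<bar>) (at u)" using 2 by (auto intro!: derivative_eq_intros)
    then show ?thesis
      by (rule has_field_derivative_transform_within_open[where S="{0<..}"]) (use 2 in auto)
  next
    case 3
    have "((\<lambda>u. - (u * u)) has_real_derivative 2 * \<bar>u\<bar>) (at u)" using 3 by (auto intro!: derivative_eq_intros)
    then show ?thesis
      by (rule has_field_derivative_transform_within_open[where S="{..<0}"]) (use 3 in auto)
  qed
qed

lemma LBINT_overshoot:
  fixes a x :: real
  assumes a: "0 \<le> a" and x: "0 \<le> x"
  shows "(LBINT s:{0..x}. max 0 (a - s)) = x * max 0 (a - x) + min (a\<^sup>2) (x\<^sup>2) / 2"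
proof -
  \<comment> \<open>A primitive of max 0 (a - s) without case distinction, by max 0 u = (u + \<bar>u\<bar>) / 2.\<close>
  define G where "G s = - ((a - s)\<^sup>2 + (a - s) * \<bar>a - s\<bar>) / 4" for s
  have d: "(G has_real_derivative max 0 (a - s)) (at s)" for s
  proof -
    have "((\<lambda>s. (a - s) * \<bar>a - s\<bar>) has_real_derivative 2 * \<bar>a - s\<bar> * (- 1)) (at s)"
      by (rule DERIV_chain2[OF has_real_derivative_mult_abs]) (auto intro!: derivative_eq_intros)
    then have "(G has_real_derivative - ((2 * (a - s) * (- 1)) + 2 * \<bar>a - s\<bar> * (- 1)) / 4) (at s)"
      unfolding G_def
      by (intro DERIV_cdivide DERIV_minus DERIV_add) (auto intro!: derivative_eq_intros)
    moreover have "- ((2 * (a - s) * (- 1)) + 2 * \<bar>a - s\<bar> * (- 1)) / 4 = max 0 (a - s)"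
      by (auto simp: max_def abs_if)
    ultimately show ?thesis by simp
  qed
  have "(LBINT s:{0..x}. max 0 (a - s)) = G x - G 0"
    by (rule LBINT_FTC[OF x d]) (auto intro!: continuous_intros)
  also have "\<dots> = x * max 0 (a - x) + min (a\<^sup>2) (x\<^sup>2) / 2"
  proof (cases "a \<le> x")
    case True
    then have "a\<^sup>2 \<le> x\<^sup>2" using a by (intro power_mono)
    then show ?thesis using True a by (simp add: G_def power2_eq_square algebra_simps)
  next
    case False
    then have "x\<^sup>2 \<le> a\<^sup>2" using x by (intro power_mono) auto
    then show ?thesis using False a by (simp add: G_def min_def power2_eq_square field_simps)
  qed
  finally show ?thesis .
qed

context heavy_walk
begin

lemma eta_eq: assumes x: "0 \<le> x" shows "eta p x = overshoot p x"
proof -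
  have "eta p x = (LBINT y:{x..}. measure_pmf.prob p {k. y < \<bar>real_of_int k\<bar>} * 1)"
    unfolding eta_def by (intro set_lebesgue_integral_cong) (use x mu_eq in auto)
  also have "\<dots> = overshoot p x"
    unfolding overshoot_def
    by (subst tail_Fubini(1)[OF integrable_abs_step, where W=1]) (simp_all only: LBINT_const_Icc mult_1_right, simp_all)
  finally show ?thesis .
qed

lemma integrable_overshoot: "integrable (measure_pmf p) (\<lambda>k. max 0 (\<bar>real_of_int k\<bar> - x))"
  by (intro integrable_max Bochner_Integration.integrable_diff integrable_abs_step) simp_all

lemma integrable_min_square: "integrable (measure_pmf p) (\<lambda>k. min ((real_of_int k)\<^sup>2) (x\<^sup>2))"
  by (rule integrable_bounded_pmf[where B="x\<^sup>2"]) auto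

lemma overshoot_Lipschitz: "\<bar>overshoot p x - overshoot p y\<bar> \<le> \<bar>x - y\<bar>"
proof -
  have "overshoot p x - overshoot p y
     = expect p (\<lambda>k. max 0 (\<bar>real_of_int k\<bar> - x) - max 0 (\<bar>real_of_int k\<bar> - y))"
    unfolding overshoot_def by (simp add: integrable_overshoot)
  also have "norm \<dots> \<le> expect p (\<lambda>k. norm (max 0 (\<bar>real_of_int k\<bar> - x) - max 0 (\<bar>real_of_int k\<bar> - y)))"
    by (rule integral_norm_bound)
  also have "\<dots> \<le> \<bar>x - y\<bar>"
    by (intro expectation_le_const integrable_norm Bochner_Integration.integrable_diff integrable_overshoot) auto
  finally show ?thesis by simp
qed

lemma continuous_on_overshoot: "continuous_on S (overshoot p)"
  unfolding continuous_on_iff dist_real_def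
  using overshoot_Lipschitz order_le_less_trans by blast

lemma m_fun_eq_integral: "m_fun p x = integral {0..x} (overshoot p)"
proof -
  have "m_fun p x = (LBINT s:{0..x}. overshoot p s)"
    unfolding m_fun_def by (intro set_lebesgue_integral_cong) (use eta_eq in auto)
  also have "\<dots> = integral {0..x} (overshoot p)"
    by (intro set_borel_integral_eq_integral(2) borel_integrable_atLeastAtMost' continuous_on_overshoot)
  finally show ?thesis .
qed

lemma m_fun_deriv: assumes "0 < x" shows "(m_fun p has_real_derivative overshoot p x) (at x)"
proof -
  have "((\<lambda>x. integral {0..x} (overshoot p)) has_real_derivative overshoot p x) (at x within {0..x + 1})"
    by (rule integral_has_real_derivative[OF continuous_on_overshoot]) (use assms in auto)
  moreover have "at x within {0..x + 1} = at x" by (rule at_within_interior) (use assms in auto)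
  moreover have "m_fun p = (\<lambda>x. integral {0..x} (overshoot p))" by (rule ext, rule m_fun_eq_integral)
  ultimately show ?thesis by simp
qed

lemma m_fun_eq: assumes x: "0 \<le> x" shows "m_fun p x = x * overshoot p x + trunc p x"
proof -
  let ?f = "\<lambda>k s. indicator {0..x} s *\<^sub>R max 0 (\<bar>real_of_int k\<bar> - s)"
  have fi: "integrable lborel (?f k)" for k
    unfolding set_integrable_def[symmetric]
    by (rule borel_integrable_atLeastAtMost') (intro continuous_intros)
  have ni: "integrable (measure_pmf p) (\<lambda>k. \<integral>s. norm (?f k s) \<partial>lborel)"
  proof -
    have "(\<integral>s. norm (?f k s) \<partial>lborel) = x * max 0 (\<bar>real_of_int k\<bar> - x) + min ((real_of_int k)\<^sup>2) (x\<^sup>2) / 2" for k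
      using LBINT_overshoot[of "\<bar>real_of_int k\<bar>" x] x unfolding set_lebesgue_integral_def by simp
    then show ?thesis using integrable_overshoot integrable_min_square by simp
  qed
  have "m_fun p x = (\<integral>s. expect p (\<lambda>k. ?f k s) \<partial>lborel)"
    unfolding m_fun_def set_lebesgue_integral_def
    by (intro Bochner_Integration.integral_cong) (auto simp: indicator_def eta_eq overshoot_def)
  also have "\<dots> = expect p (\<lambda>k. \<integral>s. ?f k s \<partial>lborel)"
    by (rule pmf_lborel_Fubini(2)[OF fi ni])
  also have "\<dots> = expect p (\<lambda>k. x * max 0 (\<bar>real_of_int k\<bar> - x) + min ((real_of_int k)\<^sup>2) (x\<^sup>2) / 2)"
    using LBINT_overshoot[of "\<bar>real_of_int _\<bar>" x] x unfolding set_lebesgue_integral_def by simp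
  also have "\<dots> = x * overshoot p x + trunc p x"
    unfolding overshoot_def trunc_def using integrable_overshoot integrable_min_square by simp
  finally show ?thesis .
qed

text \<open>
  The truncated integral is the expectation of \<open>(1 - cos (t min(R, \<bar>X\<bar>)))/t\<close>, which is bounded by \<open>2/t\<close>, so the
  improper integral is evaluated by dominated convergence.
\<close>

lemma alpha_eq: assumes t: "0 < t" shows "alpha p t = (1 - Re (chf p t)) / t"
proof -
  define g where "g R k = (1 - cos (t * min R \<bar>real_of_int k\<bar>)) / t" for R and k :: int
  have e: "(LBINT y:{0..R}. mu p y * sin (t * y)) = expect p (g R)" if R: "0 \<le> R" for R
  proof -
    have "(LBINT y:{0..R}. mu p y * sin (t * y))
        = (LBINT y:{0..}. measure_pmf.prob p {k. y < \<bar>real_of_int k\<bar>} * (indicator {..R} y * sin (t * y)))"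
      unfolding set_lebesgue_integral_def
      by (intro Bochner_Integration.integral_cong) (auto simp: indicator_def mu_eq)
    also have "\<dots> = expect p (\<lambda>k. LBINT y:{0..\<bar>real_of_int k\<bar>}. indicator {..R} y * sin (t * y))"
      by (rule tail_Fubini(1)[OF integrable_abs_step, where W=1]) (auto simp: indicator_def)
    also have "\<dots> = expect p (g R)"
    proof (intro Bochner_Integration.integral_cong refl)
      fix k :: int
      have "(LBINT y:{0..\<bar>real_of_int k\<bar>}. indicator {..R} y * sin (t * y)) = (LBINT y:{0..min R \<bar>real_of_int k\<bar>}. sin (t * y))"
        unfolding set_lebesgue_integral_def by (intro Bochner_Integration.integral_cong) (auto simp: indicator_def)
      also have "\<dots> = - cos (t * min R \<bar>real_of_int k\<bar>) / t - (- cos (t * 0) / t)"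
        by (rule LBINT_FTC) (use R t in \<open>auto intro!: derivative_eq_intros continuous_intros\<close>)
      finally show "(LBINT y:{0..\<bar>real_of_int k\<bar>}. indicator {..R} y * sin (t * y)) = g R k"
        by (simp add: g_def diff_divide_distrib)
    qed
    finally show ?thesis .
  qed
  have lim: "((\<lambda>R. expect p (g R)) \<longlongrightarrow> expect p (\<lambda>k. (1 - cos (t * \<bar>real_of_int k\<bar>)) / t)) at_top"
  proof (rule integral_dominated_convergence_at_top[where w="\<lambda>_. 2 / t"])
    show "AE k in measure_pmf p. ((\<lambda>R. g R k) \<longlongrightarrow> (1 - cos (t * \<bar>real_of_int k\<bar>)) / t) at_top"
    proof (rule AE_I2)
      fix k :: int
      have "\<forall>\<^sub>F R in at_top. g R k = (1 - cos (t * \<bar>real_of_int k\<bar>)) / t"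
        using eventually_ge_at_top[of "\<bar>real_of_int k\<bar>"] by eventually_elim (simp add: g_def min_def)
      then show "((\<lambda>R. g R k) \<longlongrightarrow> (1 - cos (t * \<bar>real_of_int k\<bar>)) / t) at_top"
        by (rule tendsto_eventually)
    qed
    have "\<bar>g R k\<bar> \<le> 2 / t" for R k
    proof -
      have "\<bar>1 - cos (t * min R \<bar>real_of_int k\<bar>)\<bar> \<le> 2"
        using cos_ge_minus_one[of "t * min R \<bar>real_of_int k\<bar>"] by simp
      then show ?thesis using t unfolding g_def abs_divide by (simp add: divide_right_mono)
    qed
    then show "\<forall>\<^sub>F R in at_top. AE k in measure_pmf p. norm (g R k) \<le> 2 / t" by simp
  qed auto
  have "cos (t * \<bar>r\<bar>) = cos (t * r)" for r by (metis cos_abs_real abs_mult abs_of_pos t)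
  then have "expect p (\<lambda>k. (1 - cos (t * \<bar>real_of_int k\<bar>)) / t) = (1 - Re (chf p t)) / t"
    unfolding one_minus_Re_chf by simp
  moreover have "((\<lambda>R. LBINT y:{0..R}. mu p y * sin (t * y)) \<longlongrightarrow> expect p (\<lambda>k. (1 - cos (t * \<bar>real_of_int k\<bar>)) / t)) at_top"
    by (rule Lim_transform_eventually[OF lim])
       (use eventually_ge_at_top[of 0] in \<open>eventually_elim, simp add: e\<close>)
  ultimately show ?thesis unfolding alpha_def by (simp add: tendsto_Lim)
qed

lemma one_sided_beta:
  fixes a :: "int \<Rightarrow> real"
  assumes t: "0 < t" and a: "integrable (measure_pmf p) a" "\<And>k. 0 \<le> a k"
  shows "(LBINT y:{0..}. measure_pmf.prob p {k. y < a k} * (1 - cos (t * y)))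
      = expect p (\<lambda>k. a k - sin (t * a k) / t)"
proof -
  have "(LBINT y:{0..a k}. 1 - cos (t * y)) = (a k - sin (t * a k) / t) - (0 - sin (t * 0) / t)" for k
    by (rule LBINT_FTC) (use a(2)[of k] t in \<open>auto intro!: derivative_eq_intros continuous_intros\<close>)
  then show ?thesis
    by (subst tail_Fubini(1)[OF a(1), where W=2]) (auto simp: abs_le_iff intro: order_trans[OF _ add_mono])
qed

text \<open>
  The two one-sided integrals combine to \<open>E[X - sin(tX)/t]\<close>, and the mean is zero.
\<close>

lemma gamma_eq: assumes t: "0 < t" shows "gamma p t = - Im (chf p t) / t"
proof -
  let ?u = "\<lambda>k. max 0 (real_of_int k)" and ?v = "\<lambda>k. max 0 (- real_of_int k)"
  have u: "integrable (measure_pmf p) ?u" and v: "integrable (measure_pmf p) ?v"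
    by (auto intro!: integrable_max)
  have s: "integrable (measure_pmf p) (\<lambda>k. sin (t * a k) / t)" for a :: "int \<Rightarrow> real"
    by (intro integrable_divide integrable_bounded_pmf[where B=1]) auto
  have "beta_plus p t = (LBINT y:{0..}. measure_pmf.prob p {k. y < ?u k} * (1 - cos (t * y)))"
    unfolding beta_plus_def mu_plus_def
    by (intro set_lebesgue_integral_cong) (auto intro!: arg_cong[where f="measure_pmf.prob p"])
  then have bp: "beta_plus p t = expect p (\<lambda>k. ?u k - sin (t * ?u k) / t)"
    using one_sided_beta[OF t u] by simp
  have "beta_minus p t = (LBINT y:{0..}. measure_pmf.prob p {k. y < ?v k} * (1 - cos (t * y)))"
    unfolding beta_minus_def mu_minus_def
    by (intro set_lebesgue_integral_cong) (auto intro!: arg_cong[where f="measure_pmf.prob p"])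
  then have bm: "beta_minus p t = expect p (\<lambda>k. ?v k - sin (t * ?v k) / t)"
    using one_sided_beta[OF t v] by simp
  have "gamma p t = expect p (\<lambda>k. (?u k - sin (t * ?u k) / t) - (?v k - sin (t * ?v k) / t))"
    unfolding gamma_def bp bm by (intro Bochner_Integration.integral_diff[symmetric] Bochner_Integration.integrable_diff u v s)
  also have "\<dots> = expect p (\<lambda>k. real_of_int k - sin (t * real_of_int k) / t)"
    by (intro Bochner_Integration.integral_cong) (auto simp: max_def)
  also have "\<dots> = - Im (chf p t) / t"
    using s[of real_of_int] by (simp add: mean_zero Im_chf)
  finally show ?thesis .
qed

lemma one_minus_chf: "0 < t \<Longrightarrow> 1 - chf p t = Complex (t * alpha p t) (t * gamma p t)"
  by (simp add: alpha_eq gamma_eq complex_eq_iff)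

lemma Re_kern: assumes t: "0 < t"
  shows "Re (kern x t) = (1 - cos (t * real_of_int x)) * (alpha p t / (t * ((alpha p t)\<^sup>2 + (gamma p t)\<^sup>2)))"
proof -
  have "Re (of_real c / Complex u v) = c * (u / (u\<^sup>2 + v\<^sup>2))" for c u v
    by (simp add: Re_divide)
  moreover have "t * a / ((t * a)\<^sup>2 + (t * g)\<^sup>2) = a / (t * (a\<^sup>2 + g\<^sup>2))" for a g
  proof -
    have "(t * a)\<^sup>2 + (t * g)\<^sup>2 = t * (t * (a\<^sup>2 + g\<^sup>2))" by (simp add: power2_eq_square algebra_simps)
    then show ?thesis using t by simp
  qed
  ultimately show ?thesis unfolding kern_def one_minus_chf[OF t] by (simp only:)
qed

lemma alpha_pos: "0 < t \<Longrightarrow> t \<le> pi \<Longrightarrow> 0 < alpha p t"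
  using Re_chf_less_1[of t] by (simp add: alpha_eq)

lemma alpha_eq_expectation: "0 < t \<Longrightarrow> t * alpha p t = expect p (\<lambda>k. 1 - cos (t * real_of_int k))"
  by (simp add: alpha_eq one_minus_Re_chf)

lemma trunc_scaled: assumes t: "0 < t"
  shows "2 * t\<^sup>2 * trunc p (1 / t) = expect p (\<lambda>k. min 1 ((t * real_of_int k)\<^sup>2))"
proof -
  have "2 * t\<^sup>2 * trunc p (1 / t) = expect p (\<lambda>k. t\<^sup>2 * min ((real_of_int k)\<^sup>2) ((1 / t)\<^sup>2))"
    unfolding trunc_def by (subst integral_mult_right_zero) simp
  moreover have "t\<^sup>2 * min u ((1 / t)\<^sup>2) = min 1 (t\<^sup>2 * u)" for u
    using t by (simp add: min_mult_distrib_left power_divide min.commute)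
  ultimately show ?thesis by (simp add: power_mult_distrib)
qed

lemma integrable_min_1: "integrable (measure_pmf p) (\<lambda>k. min 1 ((t * real_of_int k)\<^sup>2))"
  by (rule integrable_bounded_pmf[where B=1]) auto

text \<open>
  Together with the next lemma: \<open>\<alpha>(t)\<close> is never much larger than \<open>t c(1/t)\<close>, and it can be much smaller only
  where \<open>\<eta>(1/t)\<close> makes up for it.
\<close>

lemma alpha_le_trunc: assumes t: "0 < t" shows "alpha p t \<le> 4 * t * trunc p (1 / t)"
proof -
  have "t * alpha p t \<le> expect p (\<lambda>k. 2 * min 1 ((t * real_of_int k)\<^sup>2))"
    unfolding alpha_eq_expectation[OF t]
    by (intro integral_mono integrable_one_minus_cos integrable_mult_right integrable_min_1 one_minus_cos_le_min)
  also have "\<dots> = 2 * (2 * t\<^sup>2 * trunc p (1 / t))"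
    unfolding trunc_scaled[OF t] by (rule integral_mult_right_zero)
  also have "\<dots> = t * (4 * t * trunc p (1 / t))" by (simp add: power2_eq_square)
  finally show ?thesis using t by simp
qed

lemma trunc_le_alpha_eta: assumes t: "0 < t"
  shows "2 * t * trunc p (1 / t) \<le> 3 * alpha p t + eta p (1 / t)"
proof -
  have "2 * t\<^sup>2 * trunc p (1 / t)
      \<le> expect p (\<lambda>k. 3 * (1 - cos (t * real_of_int k)) + t * max 0 (\<bar>real_of_int k\<bar> - 1 / t))"
    unfolding trunc_scaled[OF t]
  proof (intro integral_mono integrable_min_1 Bochner_Integration.integrable_add integrable_mult_right
      integrable_one_minus_cos integrable_overshoot)
    fix k :: int
    have "max 0 (\<bar>t * real_of_int k\<bar> - 1) = t * max 0 (\<bar>real_of_int k\<bar> - 1 / t)"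
      using t by (simp add: max_mult_distrib_left abs_mult right_diff_distrib)
    then show "min 1 ((t * real_of_int k)\<^sup>2) \<le> 3 * (1 - cos (t * real_of_int k)) + t * max 0 (\<bar>real_of_int k\<bar> - 1 / t)"
      using min_one_square_le[of "t * real_of_int k"] by simp
  qed
  also have "\<dots> = 3 * (t * alpha p t) + t * eta p (1 / t)"
  proof -
    have "0 \<le> 1 / t" using t by simp
    show ?thesis
      unfolding alpha_eq_expectation[OF t] eta_eq[OF \<open>0 \<le> 1 / t\<close>] overshoot_def
      by (simp only: Bochner_Integration.integral_add[OF integrable_mult_right[OF integrable_one_minus_cos]
            integrable_mult_right[OF integrable_overshoot]] integral_mult_right_zero)
  qed
  also have "\<dots> = t * (3 * alpha p t + eta p (1 / t))" by (simp add: algebra_simps)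
  finally have "t * (2 * t * trunc p (1 / t)) \<le> t * (3 * alpha p t + eta p (1 / t))"
    by (simp add: power2_eq_square mult_ac)
  then show ?thesis using t by simp
qed

end

section \<open>Averages of the oscillating integrand\<close>

lemma abs_sin_quotient_diff_le: "\<bar>sin u / c - sin v / c\<bar> \<le> 2 * (1 / c)" if "0 < c" for u v c :: real
proof -
  have "\<bar>sin u - sin v\<bar> \<le> 2" using abs_sin_le_one[of u] abs_sin_le_one[of v] by linarith
  then have "\<bar>sin u - sin v\<bar> / c \<le> 2 / c" using that by (intro divide_right_mono) auto
  then show ?thesis using that by (simp add: diff_divide_distrib[symmetric])
qed

lemma integral_one_minus_cos_ge:
  fixes a b x :: real
  assumes ab: "a \<le> b" and x: "0 < x"
  shows "(b - a) - 2 * (1 / x) \<le> integral {a..b} (\<lambda>t. 1 - cos (t * x))"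
proof -
  have "((\<lambda>t. 1 - cos (t * x)) has_integral ((b - a) - (sin (b * x) / x - sin (a * x) / x))) {a..b}"
    using has_integral_diff[OF has_integral_const_real[of "1::real" a b] has_integral_cos[OF ab]] ab x by simp
  then have "integral {a..b} (\<lambda>t. 1 - cos (t * x)) = (b - a) - (sin (b * x) / x - sin (a * x) / x)"
    by (rule integral_unique)
  then show ?thesis
    using order_trans[OF abs_ge_self abs_sin_quotient_diff_le[OF x, of "b * x" "a * x"]] by argo
qed

text \<open>
  On a block \<open>[s, 16s]\<close> the factor \<open>1 - cos tx\<close> does not conspire with the zeros of \<open>1 - cos tk\<close>, not even for \<open>k = x\<close>.
  If \<open>s\<bar>k\<bar> \<le> 1\<close>, then \<open>1 - cos tk\<close> is at least a multiple of \<open>(sk)\<^sup>2\<close> on \<open>[s, 3s]\<close>.  Otherwise expand the product: apart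
  from \<open>cos(t(x - k)) / 2 \<ge> -1/2\<close>, the oscillating terms integrate to \<open>O(s)\<close>, and a block of length \<open>15s\<close> is long
  enough to dominate them.
\<close>

lemma cos_product_integral_ge:
  fixes s x k :: real
  assumes s: "0 < s" and x: "2 \<le> x * s"
  shows "s / 3 * min 1 ((s * k)\<^sup>2) \<le> integral {s..16 * s} (\<lambda>t. (1 - cos (t * k)) * (1 - cos (t * x)))"
proof -
  have xp: "0 < x" using s x by (smt (verit) mult_nonneg_nonpos2 mult.commute)
  have ix: "1 / x \<le> s / 2" using x xp s by (simp add: field_simps)
  let ?f = "\<lambda>t. (1 - cos (t * k)) * (1 - cos (t * x))"
  have fi: "?f integrable_on {a..b}" for a b by (intro integrable_continuous_real continuous_intros)
  show ?thesis
  proof (cases "\<bar>s * k\<bar> \<le> 1")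
    case True
    let ?g = "\<lambda>t. (s * k)\<^sup>2 / 3 * (1 - cos (t * x))"
    have "s \<le> integral {s..3 * s} (\<lambda>t. 1 - cos (t * x))"
      using integral_one_minus_cos_ge[of s "3 * s" x] s xp ix by argo
    then have "(s * k)\<^sup>2 / 3 * s \<le> (s * k)\<^sup>2 / 3 * integral {s..3 * s} (\<lambda>t. 1 - cos (t * x))"
      by (intro mult_left_mono) auto
    also have "\<dots> = integral {s..3 * s} ?g"
      by (rule integral_mult_right[symmetric])
    also have "\<dots> \<le> integral {s..3 * s} ?f"
    proof (rule integral_le[OF _ fi])
      show "?g integrable_on {s..3 * s}" by (intro integrable_continuous_real continuous_intros)
      fix t assume t: "t \<in> {s..3 * s}"
      have "\<bar>s * k\<bar> \<le> \<bar>t * k\<bar>" using t s by (simp add: abs_mult mult_right_mono)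
      then have a: "(s * k)\<^sup>2 \<le> (t * k)\<^sup>2" by (simp add: abs_le_square_iff)
      have "\<bar>t * k\<bar> \<le> \<bar>3 * s * k\<bar>" using t s by (simp add: abs_mult mult_right_mono)
      then have "\<bar>t * k\<bar> \<le> 3" using True by (simp add: abs_mult)
      from one_minus_cos_ge_min[OF this] have "min 1 ((t * k)\<^sup>2) / 3 \<le> 1 - cos (t * k)" .
      moreover have "(s * k)\<^sup>2 \<le> min 1 ((t * k)\<^sup>2)"
        using a True by (simp add: abs_square_le_1)
      ultimately show "?g t \<le> ?f t" by (intro mult_right_mono) auto
    qed
    also have "\<dots> \<le> integral {s..16 * s} ?f"
      by (rule integral_subset_le) (use fi s in auto)
    finally have "(s * k)\<^sup>2 / 3 * s \<le> integral {s..16 * s} ?f" .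
    moreover have "min 1 ((s * k)\<^sup>2) = (s * k)\<^sup>2"
      using True by (intro min_absorb2) (simp add: abs_square_le_1)
    ultimately show ?thesis by (simp only: times_divide_eq_left mult.commute)
  next
    case False
    define l where "l = \<bar>k\<bar>"
    have l: "0 < l" "1 \<le> s * l" using False s unfolding l_def by (auto simp: abs_mult)
    have il: "1 / l \<le> s" using l by (simp add: field_simps)
    have ixl: "1 / (x + l) \<le> s"
    proof -
      have "1 / (x + l) \<le> 1 / l" using xp l by (intro divide_left_mono) auto
      then show ?thesis using il by linarith
    qed
    have ck: "cos (t * k) = cos (t * l)" for t unfolding l_def by (cases "0 \<le> k") auto
    let ?g = "\<lambda>t. (1 / 2 - cos (t * l) - cos (t * x)) + 1 / 2 * cos (t * (x + l))"
    define D where "D c = sin (16 * s * c) / c - sin (s * c) / c" for c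
    have D: "\<bar>D c\<bar> \<le> 2 * (1 / c)" if "0 < c" for c
      unfolding D_def by (rule abs_sin_quotient_diff_le[OF that])
    define V where "V = (1 / 2 * (16 * s - s) - D l - D x) + 1 / 2 * D (x + l)"
    have hc: "((\<lambda>t. 1 / 2 :: real) has_integral (1 / 2 * (16 * s - s))) {s..16 * s}"
      using has_integral_const_real[of "1 / 2 :: real" s "16 * s"] s by (simp add: mult.commute)
    have hg: "(?g has_integral V) {s..16 * s}"
      unfolding V_def D_def by (intro has_integral_add has_integral_diff has_integral_mult_right hc has_integral_cos) (use s xp l in auto)
    have "s / 3 \<le> V"
    proof -
      have "\<bar>D l\<bar> \<le> 2 * s" "\<bar>D x\<bar> \<le> s" "\<bar>D (x + l)\<bar> \<le> 2 * s"
        using D[OF l(1)] D[OF xp] D[of "x + l"] ix il ixl xp l(1) by linarith+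
      then show ?thesis using s unfolding V_def by argo
    qed
    also have "V = integral {s..16 * s} ?g" using integral_unique[OF hg] by simp
    also have "\<dots> \<le> integral {s..16 * s} ?f"
    proof (rule integral_le[OF _ fi])
      show "?g integrable_on {s..16 * s}" using hg by blast
      fix t :: real
      have "cos (t * x) * cos (t * l) = (cos (t * x - t * l) + cos (t * x + t * l)) / 2"
        by (simp add: cos_add cos_diff)
      moreover have "- 1 \<le> cos (t * x - t * l)" by simp
      ultimately have "cos (t * x + t * l) / 2 - 1 / 2 \<le> cos (t * x) * cos (t * l)"
        by argo
      then have "cos (t * (x + l)) / 2 - 1 / 2 \<le> cos (t * l) * cos (t * x)"
        by (simp only: distrib_left mult.commute)
      then show "?g t \<le> ?f t" unfolding ck by (simp add: algebra_simps)
    qed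
    finally have "s / 3 \<le> integral {s..16 * s} ?f" .
    moreover have "s / 3 * min 1 ((s * k)\<^sup>2) \<le> s / 3 * 1" using s by (intro mult_left_mono) auto
    ultimately show ?thesis by linarith
  qed
qed

section \<open>The comparison function x / m(x)\<close>

context heavy_walk
begin

lemma overshoot_nonneg: "0 \<le> overshoot p x"
  unfolding overshoot_def by (intro integral_nonneg_AE AE_I2) simp

lemma trunc_pos: assumes "0 < x" shows "0 < trunc p x"
proof -
  obtain a b where ab: "a \<in> set_pmf p" "b \<in> set_pmf p" "a \<noteq> b" by (rule support_has_two_points)
  then obtain k where k: "k \<in> set_pmf p" "k \<noteq> 0" by metis
  have "0 < pmf p k * min ((real_of_int k)\<^sup>2) (x\<^sup>2)"
    using k assms by (simp add: pmf_positive)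
  also have "\<dots> \<le> expect p (\<lambda>k. min ((real_of_int k)\<^sup>2) (x\<^sup>2))"
    by (rule pmf_times_le_expectation[OF integrable_min_square]) simp
  finally show ?thesis unfolding trunc_def by simp
qed

lemma trunc_mono: assumes "0 \<le> x" "x \<le> y" shows "trunc p x \<le> trunc p y"
proof -
  have "x\<^sup>2 \<le> y\<^sup>2" using assms by (intro power_mono) auto
  then have "expect p (\<lambda>k. min ((real_of_int k)\<^sup>2) (x\<^sup>2))
      \<le> expect p (\<lambda>k. min ((real_of_int k)\<^sup>2) (y\<^sup>2))"
    by (intro integral_mono integrable_min_square min.mono) auto
  then show ?thesis unfolding trunc_def by simp
qed

lemma trunc_le_m_fun: "0 < x \<Longrightarrow> trunc p x \<le> m_fun p x"
  using overshoot_nonneg[of x] by (simp add: m_fun_eq)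

lemma m_fun_pos: "0 < x \<Longrightarrow> 0 < m_fun p x"
  using trunc_pos[of x] trunc_le_m_fun[of x] by linarith

lemma m_fun_mono: assumes "0 < x" "x \<le> y" shows "m_fun p x \<le> m_fun p y"
proof (rule DERIV_nonneg_imp_nondecreasing[OF assms(2)])
  fix z assume "x \<le> z" "z \<le> y"
  then show "\<exists>d. (m_fun p has_real_derivative d) (at z) \<and> 0 \<le> d"
    using m_fun_deriv[of z] overshoot_nonneg[of z] assms by auto
qed

text \<open>
  The function with which the theorem compares the potential.
\<close>

definition ratio :: "real \<Rightarrow> real" where "ratio y = y / m_fun p y"

text \<open>
  The identity behind the theorem: since \<open>m' = \<eta>\<close>, the derivative of \<open>x/m(x)\<close> is \<open>(m - x\<eta>)/m\<^sup>2 = c/m\<^sup>2\<close>.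
\<close>

lemma ratio_deriv: assumes y: "0 < y"
  shows "(ratio has_real_derivative trunc p y / (m_fun p y)\<^sup>2) (at y)"
proof -
  have "((\<lambda>y. y / m_fun p y) has_real_derivative (1 * m_fun p y - y * overshoot p y) / (m_fun p y * m_fun p y)) (at y)"
    by (rule DERIV_divide[OF DERIV_ident m_fun_deriv[OF y]]) (use m_fun_pos[OF y] in simp)
  moreover have "1 * m_fun p y - y * overshoot p y = trunc p y" using y by (simp add: m_fun_eq)
  ultimately show ?thesis unfolding ratio_def[abs_def] by (simp add: power2_eq_square)
qed

lemma ratio_mono: assumes "0 < x" "x \<le> y" shows "ratio x \<le> ratio y"
proof (rule DERIV_nonneg_imp_nondecreasing[OF assms(2)])
  fix z assume "x \<le> z" "z \<le> y"
  then show "\<exists>d. (ratio has_real_derivative d) (at z) \<and> 0 \<le> d"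
    using ratio_deriv[of z] trunc_pos[of z] assms by (intro exI[of _ "trunc p z / (m_fun p z)\<^sup>2"]) auto
qed

lemma ratio_pos: "0 < y \<Longrightarrow> 0 < ratio y"
  using m_fun_pos by (simp add: ratio_def)

text \<open>
  Concavity of \<open>m\<close> in the form that \<open>x/m(x)\<close> increases.
\<close>

lemma m_fun_scale: assumes "0 < y" "1 \<le> c" shows "m_fun p (c * y) \<le> c * m_fun p y"
proof -
  have "y * 1 \<le> y * c" using assms by (intro mult_left_mono) auto
  then have "ratio y \<le> ratio (c * y)" using assms by (intro ratio_mono) (auto simp: mult.commute)
  then have "y * m_fun p (c * y) \<le> y * (c * m_fun p y)"
    using assms m_fun_pos[of y] m_fun_pos[of "c * y"] by (simp add: ratio_def divide_simps mult_ac)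
  then show ?thesis using assms by simp
qed

text \<open>
  \<open>m(x)/x = \<eta>(x) + c(x)/x\<close>, and both terms tend to \<open>0\<close> by dominated convergence with the integrable bound \<open>\<bar>X\<bar>\<close>.
\<close>

lemma ratio_at_top: "filterlim ratio at_top at_top"
proof -
  have o: "((\<lambda>x. overshoot p x) \<longlongrightarrow> expect p (\<lambda>k. 0)) at_top"
    unfolding overshoot_def
  proof (rule integral_dominated_convergence_at_top[where w="\<lambda>k. \<bar>real_of_int k\<bar>"])
    show "AE k in measure_pmf p. ((\<lambda>x. max 0 (\<bar>real_of_int k\<bar> - x)) \<longlongrightarrow> 0) at_top"
    proof (rule AE_I2)
      fix k :: int
      have "\<forall>\<^sub>F x in at_top. max 0 (\<bar>real_of_int k\<bar> - x) = 0"
        using eventually_ge_at_top[of "\<bar>real_of_int k\<bar>"] by eventually_elim simp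
      then show "((\<lambda>x. max 0 (\<bar>real_of_int k\<bar> - x)) \<longlongrightarrow> 0) at_top" by (rule tendsto_eventually)
    qed
    show "\<forall>\<^sub>F x in at_top. AE k in measure_pmf p. norm (max 0 (\<bar>real_of_int k\<bar> - x)) \<le> \<bar>real_of_int k\<bar>"
      using eventually_ge_at_top[of 0] by eventually_elim auto
  qed auto
  have c: "((\<lambda>x. expect p (\<lambda>k. min ((real_of_int k)\<^sup>2) (x\<^sup>2) / x)) \<longlongrightarrow> expect p (\<lambda>k. 0)) at_top"
  proof (rule integral_dominated_convergence_at_top[where w="\<lambda>k. \<bar>real_of_int k\<bar>"])
    show "AE k in measure_pmf p. ((\<lambda>x. min ((real_of_int k)\<^sup>2) (x\<^sup>2) / x) \<longlongrightarrow> 0) at_top"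
    proof (rule AE_I2)
      fix k :: int
      have "((\<lambda>x. (real_of_int k)\<^sup>2 / x) \<longlongrightarrow> 0) at_top"
        by (intro tendsto_divide_0[OF tendsto_const] filterlim_at_top_imp_at_infinity filterlim_ident)
      moreover have "\<forall>\<^sub>F x in at_top. (real_of_int k)\<^sup>2 / x = min ((real_of_int k)\<^sup>2) (x\<^sup>2) / x"
        using eventually_ge_at_top[of "\<bar>real_of_int k\<bar>"]
      proof eventually_elim
        case (elim x)
        then have "(real_of_int k)\<^sup>2 \<le> x\<^sup>2" by (metis abs_ge_zero power2_abs power_mono)
        then show ?case by (simp add: min_def)
      qed
      ultimately show "((\<lambda>x. min ((real_of_int k)\<^sup>2) (x\<^sup>2) / x) \<longlongrightarrow> 0) at_top"
        by (rule Lim_transform_eventually)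
    qed
    have bd0: "min ((real_of_int k)\<^sup>2) (x\<^sup>2) / x \<le> \<bar>real_of_int k\<bar>" if "0 < x" for x and k :: int
    proof (cases "\<bar>real_of_int k\<bar> \<le> x")
      case True
      have "min ((real_of_int k)\<^sup>2) (x\<^sup>2) \<le> \<bar>real_of_int k\<bar> * \<bar>real_of_int k\<bar>" by (simp add: power2_eq_square min_def)
      also have "\<dots> \<le> \<bar>real_of_int k\<bar> * x" using True by (intro mult_left_mono) auto
      finally show ?thesis using that by (simp add: divide_simps)
    next
      case False
      have "min ((real_of_int k)\<^sup>2) (x\<^sup>2) \<le> x * x" by (simp add: power2_eq_square min_def)
      also have "\<dots> \<le> \<bar>real_of_int k\<bar> * x" using False that by (intro mult_right_mono) auto
      finally show ?thesis using that by (simp add: divide_simps)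
    qed
    have bd: "norm (min ((real_of_int k)\<^sup>2) (x\<^sup>2) / x) \<le> \<bar>real_of_int k\<bar>" if "0 < x" for x and k :: int
    proof -
      have nn: "0 \<le> min ((real_of_int k)\<^sup>2) (x\<^sup>2) / x"
        using that by (intro divide_nonneg_pos) (simp_all add: min_def)
      show ?thesis unfolding real_norm_def abs_of_nonneg[OF nn] by (rule bd0[OF that])
    qed
    show "\<forall>\<^sub>F x in at_top. AE k in measure_pmf p. norm (min ((real_of_int k)\<^sup>2) (x\<^sup>2) / x) \<le> \<bar>real_of_int k\<bar>"
      using eventually_gt_at_top[of 0]
    proof (rule eventually_mono)
      fix x :: real assume "0 < x"
      then show "AE k in measure_pmf p. norm (min ((real_of_int k)\<^sup>2) (x\<^sup>2) / x) \<le> \<bar>real_of_int k\<bar>"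
        by (intro AE_I2 bd)
    qed
  qed auto
  have "((\<lambda>x. overshoot p x + expect p (\<lambda>k. min ((real_of_int k)\<^sup>2) (x\<^sup>2) / x) / 2) \<longlongrightarrow> 0 + 0 / 2) at_top"
    using o c by (intro tendsto_add tendsto_divide tendsto_const) simp_all
  moreover have "\<forall>\<^sub>F x in at_top. overshoot p x + expect p (\<lambda>k. min ((real_of_int k)\<^sup>2) (x\<^sup>2) / x) / 2 = inverse (ratio x)"
    using eventually_gt_at_top[of 0]
  proof eventually_elim
    case (elim x)
    have "inverse (ratio x) = (x * overshoot p x + trunc p x) / x"
      using elim by (simp only: ratio_def inverse_divide m_fun_eq less_imp_le)
    also have "\<dots> = overshoot p x + trunc p x / x"
      using elim by (simp add: add_divide_distrib)
    finally show ?case by (simp add: trunc_def)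
  qed
  ultimately have "((\<lambda>x. inverse (ratio x)) \<longlongrightarrow> 0 + 0 / 2) at_top"
    by (rule Lim_transform_eventually)
  then have lim: "((\<lambda>x. inverse (ratio x)) \<longlongrightarrow> 0) at_top"
    unfolding div_0 add_0_left .
  have "\<forall>\<^sub>F x in at_top. 0 < inverse (ratio x)"
    by (rule eventually_mono[OF eventually_gt_at_top[of 0]]) (simp add: ratio_pos)
  from filterlim_inverse_at_top[OF lim this] show ?thesis unfolding inverse_inverse_eq .
qed

lemma ratio_inverse_deriv: assumes t: "0 < t"
  shows "((\<lambda>t. ratio (1 / t)) has_real_derivative - (trunc p (1 / t) / (t\<^sup>2 * (m_fun p (1 / t))\<^sup>2))) (at t)"
proof -
  have "((\<lambda>t. ratio (1 / t)) has_real_derivative trunc p (1 / t) / (m_fun p (1 / t))\<^sup>2 * (- (1 / t\<^sup>2))) (at t)"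
    by (rule DERIV_chain2[OF ratio_deriv]) (use t in \<open>auto intro!: derivative_eq_intros simp: power2_eq_square\<close>)
  moreover have "trunc p (1 / t) / (m_fun p (1 / t))\<^sup>2 * (- (1 / t\<^sup>2)) = - (trunc p (1 / t) / (t\<^sup>2 * (m_fun p (1 / t))\<^sup>2))"
    by (simp add: mult.commute)
  ultimately show ?thesis by (simp only:)
qed

lemma has_integral_ratio: assumes "0 < a" "a \<le> b"
  shows "((\<lambda>t. trunc p (1 / t) / (t\<^sup>2 * (m_fun p (1 / t))\<^sup>2)) has_integral (ratio (1 / a) - ratio (1 / b))) {a..b}"
proof -
  have d: "((\<lambda>t. - ratio (1 / t)) has_real_derivative trunc p (1 / t) / (t\<^sup>2 * (m_fun p (1 / t))\<^sup>2)) (at t within {a..b})"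
    if "t \<in> {a..b}" for t
  proof -
    have "0 < t" using that assms by auto
    from DERIV_minus[OF ratio_inverse_deriv[OF this]] show ?thesis
      by (simp add: has_field_derivative_at_within)
  qed
  have "((\<lambda>t. trunc p (1 / t) / (t\<^sup>2 * (m_fun p (1 / t))\<^sup>2)) has_integral (- ratio (1 / b) - (- ratio (1 / a)))) {a..b}"
    by (rule fundamental_theorem_of_calculus[OF assms(2)])
       (use d in \<open>simp add: has_real_derivative_iff_has_vector_derivative\<close>)
  then show ?thesis by simp
qed

lemma Re_kern_integrable: assumes "0 \<le> a" "b \<le> pi" shows "(\<lambda>t. Re (kern x t)) integrable_on {a..b}"
proof -
  have "(\<lambda>t. Re (kern x t)) integrable_on {0..pi}"
    by (rule set_borel_integral_eq_integral(1)[OF set_integrable_Re_kern])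
  then show ?thesis by (rule integrable_on_subinterval) (use assms in auto)
qed

lemma sym_potential_integral: "pi * sym_potential p x = integral {0..pi} (\<lambda>t. Re (kern x t))"
  unfolding sym_potential_eq set_borel_integral_eq_integral(2)[OF set_integrable_Re_kern] by simp

lemma Re_kern_nonneg: assumes "0 \<le> t" "t \<le> pi" shows "0 \<le> Re (kern x t)"
proof (cases "t = 0")
  case False
  then show ?thesis using Re_kern[of t x] alpha_pos[of t] assms by simp
qed (simp add: kern_def)

lemma integral_Re_kern_le: assumes "0 \<le> a" "b \<le> pi"
  shows "integral {a..b} (\<lambda>t. Re (kern x t)) \<le> pi * sym_potential p x"
  unfolding sym_potential_integral
  by (rule integral_subset_le) (use assms Re_kern_integrable Re_kern_nonneg in auto)

section \<open>Upper bound for the potential\<close>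

lemma Re_kern_le_away:
  assumes "0 < t0"
  obtains D where "\<And>x t. t0 \<le> t \<Longrightarrow> t \<le> pi \<Longrightarrow> Re (kern x t) \<le> D"
proof -
  obtain c where c: "0 \<le> c" "\<And>t. 0 < t \<Longrightarrow> t \<le> pi \<Longrightarrow> inverse (norm (1 - chf p t)) \<le> 1 / (1 * t\<^sup>2) + c"
    using inverse_one_minus_chf_bound[of 1] by auto
  have "Re (kern x t) \<le> 2 * (1 / t0\<^sup>2 + c)" if t: "t0 \<le> t" "t \<le> pi" for x t
  proof -
    let ?a = "1 - cos (t * real_of_int x)"
    have a: "0 \<le> ?a" "?a \<le> 2" using cos_ge_minus_one[of "t * real_of_int x"] by auto
    have "Re (kern x t) \<le> norm (kern x t)" by (rule complex_Re_le_cmod)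
    also have "\<dots> = ?a * inverse (norm (1 - chf p t))"
      unfolding kern_def norm_divide norm_of_real using a by (simp only: abs_of_nonneg divide_inverse)
    also have "\<dots> \<le> 2 * (1 / t0\<^sup>2 + c)"
    proof (rule mult_mono[OF a(2)])
      have "inverse (norm (1 - chf p t)) \<le> 1 / (1 * t\<^sup>2) + c" using c(2) t assms by simp
      also have "1 / (1 * t\<^sup>2) \<le> 1 / t0\<^sup>2" using t assms by (auto intro!: divide_left_mono power_mono)
      finally show "inverse (norm (1 - chf p t)) \<le> 1 / t0\<^sup>2 + c" by simp
    qed auto
    finally show ?thesis .
  qed
  then show ?thesis by (rule that)
qed

lemma scaled_m_fun_eq: assumes "0 < t" shows "t * m_fun p (1 / t) = eta p (1 / t) + t * trunc p (1 / t)"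
  using assms by (simp add: m_fun_eq eta_eq distrib_left)

text \<open>
  Under the hypothesis, \<open>t m(1/t) = \<eta>(1/t) + t c(1/t) = O(\<alpha> + \<bar>\<gamma>\<bar>)\<close>, because \<open>t c(1/t)\<close> is controlled by \<open>\<alpha>\<close> and \<open>\<eta>\<close>.
  With \<open>\<alpha> \<le> 4 t c(1/t)\<close> the integrand is then at most a multiple of \<open>c(1/t)/(t m(1/t))\<^sup>2\<close>, which is minus the derivative of
  \<open>t \<mapsto> ratio (1/t)\<close>.
\<close>

lemma Re_kern_upper:
  assumes d: "0 < d" "d \<le> 1" and t: "0 < t" "t \<le> pi"
    and H: "d * eta p (1 / t) \<le> alpha p t + \<bar>gamma p t\<bar>"
  shows "Re (kern x t) \<le> (1 - cos (t * real_of_int x)) * (72 / d\<^sup>2 * (trunc p (1 / t) / (t\<^sup>2 * (m_fun p (1 / t))\<^sup>2)))"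
proof -
  let ?a = "alpha p t" and ?g = "\<bar>gamma p t\<bar>" and ?m = "m_fun p (1 / t)" and ?c = "trunc p (1 / t)"
  have a: "0 < ?a" using alpha_pos t by simp
  have m: "0 < ?m" using m_fun_pos t by simp
  have c: "0 < ?c" using trunc_pos t by simp
  have "d * (t * ?m) \<le> d * (3 / 2 * ?a + 3 / 2 * eta p (1 / t))"
    using trunc_le_alpha_eta[OF t(1)] d unfolding scaled_m_fun_eq[OF t(1)] by (intro mult_left_mono) auto
  also have "\<dots> = 3 / 2 * (d * ?a) + 3 / 2 * (d * eta p (1 / t))" by (simp add: algebra_simps)
  also have "d * ?a \<le> 1 * ?a" using d a by (intro mult_right_mono) auto
  also have "3 / 2 * (1 * ?a) + 3 / 2 * (d * eta p (1 / t)) \<le> 3 * (?a + ?g)" using H by simp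
  finally have "d * (t * ?m) \<le> 3 * (?a + ?g)" by simp
  then have "(d * (t * ?m))\<^sup>2 \<le> (3 * (?a + ?g))\<^sup>2" using d t m by (intro power_mono) auto
  also have "\<dots> \<le> 18 * (?a\<^sup>2 + (gamma p t)\<^sup>2)"
    using sum_squares_bound[of ?a ?g] by (simp add: power2_eq_square algebra_simps)
  finally have lower: "d\<^sup>2 * (t\<^sup>2 * ?m\<^sup>2) \<le> 18 * (?a\<^sup>2 + (gamma p t)\<^sup>2)" by (simp add: power_mult_distrib)
  have sq: "0 < ?a\<^sup>2 + (gamma p t)\<^sup>2" using a by (simp add: add_pos_nonneg)
  have "?a * (d\<^sup>2 * (t\<^sup>2 * ?m\<^sup>2)) \<le> (4 * t * ?c) * (18 * (?a\<^sup>2 + (gamma p t)\<^sup>2))"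
    by (rule mult_mono[OF alpha_le_trunc[OF t(1)] lower]) (use a t c in auto)
  moreover have "a / (t * W) \<le> 72 * c / (E * M)"
    if "a * (E * M) \<le> (4 * t * c) * (18 * W)" "0 < W" "0 < E" "0 < M" for a c W E M :: real
  proof -
    have EM: "0 < E * M" using that by simp
    have "a \<le> (4 * t * c) * (18 * W) / (E * M)" using that(1) unfolding pos_le_divide_eq[OF EM] .
    then have "a / (t * W) \<le> (4 * t * c) * (18 * W) / (E * M) / (t * W)"
      using that t by (intro divide_right_mono) auto
    also have "\<dots> = 72 * c / (E * M)" using that t by simp
    finally show ?thesis .
  qed
  moreover have "0 < d\<^sup>2" "0 < t\<^sup>2 * ?m\<^sup>2" using d t m by simp_all
  ultimately have "?a / (t * (?a\<^sup>2 + (gamma p t)\<^sup>2)) \<le> 72 * ?c / (d\<^sup>2 * (t\<^sup>2 * ?m\<^sup>2))"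
    using sq by blast
  then have "?a / (t * (?a\<^sup>2 + (gamma p t)\<^sup>2)) \<le> 72 / d\<^sup>2 * (?c / (t\<^sup>2 * ?m\<^sup>2))" by simp
  then show ?thesis unfolding Re_kern[OF t(1)] by (intro mult_left_mono) auto
qed

text \<open>
  The range of integration is split at \<open>1/x\<close> and at a fixed \<open>t\<^sub>0\<close>.  Below \<open>1/x\<close> the factor \<open>1 - cos tx \<le> (tx)\<^sup>2/2\<close> makes
  the integrand at most a multiple of \<open>x\<^sup>2/m(x)\<close>; between the two points the integral telescopes; beyond \<open>t\<^sub>0\<close> it
  is bounded in \<open>x\<close>, and \<open>x/m(x)\<close> tends to infinity.
\<close>

lemma sym_potential_upper_bound:
  assumes d: "0 < d" "d \<le> 1"
    and H: "\<forall>\<^sub>F t in at_right 0. d * eta p (1 / t) \<le> alpha p t + \<bar>gamma p t\<bar>"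
  shows "\<forall>\<^sub>F x :: int in at_top. sym_potential p x \<le> 144 / d\<^sup>2 * (real_of_int x / m_fun p (real_of_int x))"
proof -
  obtain b where b: "0 < b" "\<And>t. 0 < t \<Longrightarrow> t < b \<Longrightarrow> d * eta p (1 / t) \<le> alpha p t + \<bar>gamma p t\<bar>"
    using H unfolding eventually_at_right_field by auto
  define t0 where "t0 = min pi (b / 2)"
  have t0: "0 < t0" "t0 \<le> pi" "t0 < b" using b pi_gt_zero by (auto simp: t0_def)
  obtain D where D: "\<And>x t. t0 \<le> t \<Longrightarrow> t \<le> pi \<Longrightarrow> Re (kern x t) \<le> D"
    using Re_kern_le_away[OF t0(1)] by metis
  define A where "A = 72 / d\<^sup>2"
  have A: "0 < A" using d by (simp add: A_def)
  let ?h = "\<lambda>t. trunc p (1 / t) / (t\<^sup>2 * (m_fun p (1 / t))\<^sup>2)"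
  have main: "pi * sym_potential p x \<le> 5 / 2 * A * ratio (real_of_int x) + D * (pi - t0)"
    if x: "1 / t0 \<le> real_of_int x" "0 < x" for x :: int
  proof -
    let ?x = "real_of_int x" and ?k = "\<lambda>t. Re (kern x t)"
    have xp: "0 < ?x" using x by simp
    have ix: "1 / ?x \<le> t0" using x t0 by (simp add: field_simps)
    have up: "?k t \<le> (1 - cos (t * ?x)) * (A * ?h t)" if "0 < t" "t \<le> t0" for t
      unfolding A_def using that t0 by (intro Re_kern_upper[OF d] b(2)) auto
    have h0: "0 \<le> ?h t" if "0 < t" for t using trunc_pos[of "1 / t"] that by simp
    have "integral {0..1 / ?x} ?k \<le> integral {0..1 / ?x} (\<lambda>t. A * ?x\<^sup>2 / 2 / m_fun p ?x)"
    proof (rule integral_le)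
      show "?k integrable_on {0..1 / ?x}" using ix t0 by (intro Re_kern_integrable) auto
      show "?k t \<le> A * ?x\<^sup>2 / 2 / m_fun p ?x" if t: "t \<in> {0..1 / ?x}" for t
      proof (cases "t = 0")
        case True
        then show ?thesis using A m_fun_pos[OF xp] by (simp add: kern_def)
      next
        case False
        then have tp: "0 < t" "t \<le> t0" using t ix by auto
        have mx: "m_fun p ?x \<le> m_fun p (1 / t)"
          using t tp xp by (intro m_fun_mono) (auto simp: field_simps)
        have "?k t \<le> (1 - cos (t * ?x)) * (A * ?h t)" by (rule up[OF tp])
        also have "\<dots> \<le> (t * ?x)\<^sup>2 / 2 * (A * ?h t)"
          by (intro mult_right_mono one_minus_cos_le mult_nonneg_nonneg h0 tp less_imp_le[OF A])
        also have "\<dots> = A * ?x\<^sup>2 / 2 * (trunc p (1 / t) / (m_fun p (1 / t))\<^sup>2)"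
          using tp by (simp add: power_mult_distrib)
        also have "\<dots> \<le> A * ?x\<^sup>2 / 2 * (m_fun p (1 / t) / (m_fun p (1 / t))\<^sup>2)"
          using A trunc_le_m_fun[of "1 / t"] tp by (intro mult_left_mono divide_right_mono) auto
        also have "\<dots> = A * ?x\<^sup>2 / 2 * (1 / m_fun p (1 / t))"
          by (simp add: power2_eq_square)
        also have "\<dots> \<le> A * ?x\<^sup>2 / 2 * (1 / m_fun p ?x)"
          using A mx m_fun_pos[OF xp] m_fun_pos[of "1 / t"] tp by (intro mult_left_mono divide_left_mono) auto
        finally show ?thesis by simp
      qed
    qed auto
    also have "\<dots> = A / 2 * ratio ?x" using xp by (simp add: ratio_def power2_eq_square)
    finally have I1: "integral {0..1 / ?x} ?k \<le> A / 2 * ratio ?x" .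
    have hi: "((\<lambda>t. 2 * A * ?h t) has_integral 2 * A * (ratio (1 / (1 / ?x)) - ratio (1 / t0))) {1 / ?x..t0}"
      by (intro has_integral_mult_right has_integral_ratio) (use ix xp in auto)
    have "integral {1 / ?x..t0} ?k \<le> integral {1 / ?x..t0} (\<lambda>t. 2 * A * ?h t)"
    proof (rule integral_le)
      show "?k integrable_on {1 / ?x..t0}" using xp t0 by (intro Re_kern_integrable) auto
      show "(\<lambda>t. 2 * A * ?h t) integrable_on {1 / ?x..t0}" using hi by blast
      fix t assume t: "t \<in> {1 / ?x..t0}"
      have tp: "0 < t" using t xp by (metis atLeastAtMost_iff divide_pos_pos less_le_trans zero_less_one)
      have "?k t \<le> (1 - cos (t * ?x)) * (A * ?h t)" using t tp by (intro up) auto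
      also have "\<dots> \<le> 2 * (A * ?h t)"
      proof (rule mult_right_mono)
        show "1 - cos (t * ?x) \<le> 2" using cos_ge_minus_one[of "t * ?x"] by linarith
        show "0 \<le> A * ?h t" by (intro mult_nonneg_nonneg h0 tp less_imp_le[OF A])
      qed
      finally show "?k t \<le> 2 * A * ?h t" by simp
    qed
    also have "\<dots> = 2 * A * (ratio (1 / (1 / ?x)) - ratio (1 / t0))" by (rule integral_unique[OF hi])
    also have "\<dots> \<le> 2 * A * ratio ?x" using A ratio_pos[of "1 / t0"] t0 by (intro mult_left_mono) auto
    finally have I2: "integral {1 / ?x..t0} ?k \<le> 2 * A * ratio ?x" .
    have "integral {t0..pi} ?k \<le> integral {t0..pi} (\<lambda>t. D)"
      by (rule integral_le) (use D t0 in \<open>auto intro!: Re_kern_integrable\<close>)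
    then have I3: "integral {t0..pi} ?k \<le> D * (pi - t0)" using t0 by (simp add: mult.commute)
    have "integral {0..pi} ?k = integral {0..1 / ?x} ?k + integral {1 / ?x..t0} ?k + integral {t0..pi} ?k"
    proof -
      have "integral {0..1 / ?x} ?k + integral {1 / ?x..t0} ?k = integral {0..t0} ?k"
        using ix xp t0 by (intro Henstock_Kurzweil_Integration.integral_combine Re_kern_integrable) auto
      moreover have "integral {0..t0} ?k + integral {t0..pi} ?k = integral {0..pi} ?k"
        using t0 by (intro Henstock_Kurzweil_Integration.integral_combine Re_kern_integrable) auto
      ultimately show ?thesis by simp
    qed
    then show ?thesis using I1 I2 I3 unfolding sym_potential_integral by linarith
  qed
  have "\<forall>\<^sub>F y :: real in at_top. D * (pi - t0) \<le> A * ratio y"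
  proof -
    have "\<forall>\<^sub>F y in at_top. D * (pi - t0) / A \<le> ratio y"
      using ratio_at_top unfolding filterlim_at_top by blast
    then show ?thesis by eventually_elim (use A in \<open>simp add: divide_simps mult_ac\<close>)
  qed
  then have ev: "\<forall>\<^sub>F y :: real in at_top. 1 / t0 \<le> y \<and> 0 < y \<and> D * (pi - t0) \<le> A * ratio y"
    using eventually_ge_at_top[of "1 / t0"] eventually_gt_at_top[of 0] by eventually_elim auto
  have "filterlim (real_of_int) at_top at_top" by (rule filterlim_real_of_int_at_top)
  from eventually_compose_filterlim[OF ev this] show ?thesis
  proof eventually_elim
    case (elim x)
    then have "pi * sym_potential p x \<le> 5 / 2 * A * ratio (real_of_int x) + A * ratio (real_of_int x)"
      using main[of x] by auto
    also have "\<dots> \<le> pi * (2 * A * ratio (real_of_int x))"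
    proof -
      have "7 / 2 * (A * ratio (real_of_int x)) \<le> (pi * 2) * (A * ratio (real_of_int x))"
        using pi_gt3 A ratio_pos[of "real_of_int x"] elim by (intro mult_right_mono) auto
      then show ?thesis by simp
    qed
    finally have "sym_potential p x \<le> 2 * A * ratio (real_of_int x)" by simp
    then show ?case by (simp add: A_def ratio_def)
  qed
qed

section \<open>Lower bound for the potential\<close>

lemma alpha_block_integral_ge:
  assumes s: "0 < s" and x: "2 \<le> real_of_int x * s"
  shows "2 / 3 * s ^ 3 * trunc p (1 / s)
      \<le> integral {s..16 * s} (\<lambda>t. (1 - cos (t * real_of_int x)) * (t * alpha p t))"
proof -
  let ?f = "\<lambda>k t. (1 - cos (t * real_of_int k)) * (1 - cos (t * real_of_int x))"
  have c2: "\<bar>1 - cos u\<bar> \<le> 2" for u :: real using cos_ge_minus_one[of u] cos_le_one[of u] by simp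
  have bd: "norm (?f k t) \<le> 2 * 2" for k t
    unfolding real_norm_def abs_mult by (intro mult_mono c2) auto
  have fm: "?f k \<in> borel_measurable borel" for k by measurable
  have ex: "expect p (\<lambda>k. ?f k t) = (1 - cos (t * real_of_int x)) * (t * alpha p t)" if "0 < t" for t
    unfolding alpha_eq_expectation[OF that] by (simp only: integral_mult_left_zero mult.commute)
  have hk: "(LBINT t:{s..16 * s}. ?f k t) = integral {s..16 * s} (?f k)" for k
    by (rule set_borel_integral_eq_integral(2)[OF set_integrable_bounded_Icc[OF fm bd]])
  have "2 / 3 * s ^ 3 * trunc p (1 / s) = s / 3 * (2 * s\<^sup>2 * trunc p (1 / s))"
    by (simp add: power2_eq_square power3_eq_cube)
  also have "\<dots> = expect p (\<lambda>k. s / 3 * min 1 ((s * real_of_int k)\<^sup>2))"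
    unfolding trunc_scaled[OF s] by (rule integral_mult_right_zero[symmetric])
  also have "\<dots> \<le> expect p (\<lambda>k. LBINT t:{s..16 * s}. ?f k t)"
  proof (rule integral_mono)
    show "integrable (measure_pmf p) (\<lambda>k. s / 3 * min 1 ((s * real_of_int k)\<^sup>2))"
      by (intro integrable_mult_right integrable_min_1)
    show "integrable (measure_pmf p) (\<lambda>k. LBINT t:{s..16 * s}. ?f k t)"
    proof (rule integrable_bounded_pmf)
      fix k
      have "norm (LBINT t:{s..16 * s}. ?f k t) \<le> (LBINT t:{s..16 * s}. norm (?f k t))"
        by (rule set_integral_norm_bound[OF set_integrable_bounded_Icc[OF fm bd]])
      also have "\<dots> \<le> (LBINT t:{s..16 * s}. 2 * 2)"
        using bd by (intro set_integral_mono set_integrable_norm set_integrable_bounded_Icc[OF fm bd])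
           (auto intro!: borel_integrable_atLeastAtMost')
      finally show "norm (LBINT t:{s..16 * s}. ?f k t) \<le> (LBINT t:{s..16 * s}. 2 * 2)" .
    qed
    show "s / 3 * min 1 ((s * real_of_int k)\<^sup>2) \<le> (LBINT t:{s..16 * s}. ?f k t)" for k
      unfolding hk by (rule cos_product_integral_ge[OF s x])
  qed
  also have "\<dots> = (LBINT t:{s..16 * s}. expect p (\<lambda>k. ?f k t))"
    by (rule pmf_Icc_Fubini(2)[OF fm bd, symmetric])
  also have "\<dots> = integral {s..16 * s} (\<lambda>t. expect p (\<lambda>k. ?f k t))"
    by (rule set_borel_integral_eq_integral(2)[OF pmf_Icc_Fubini(1)[OF fm bd]])
  also have "\<dots> = integral {s..16 * s} (\<lambda>t. (1 - cos (t * real_of_int x)) * (t * alpha p t))"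
    by (rule integral_cong) (use s ex in auto)
  finally show ?thesis .
qed

text \<open>
  On the block \<open>[s, 16s]\<close> the function \<open>t \<mapsto> m(1/t)\<close> varies by at most a factor \<open>16\<close>; here \<open>3840 = 15 * 16\<^sup>2\<close>.
\<close>

lemma ratio_block_le:
  assumes s: "0 < s"
  shows "ratio (1 / s) - ratio (1 / (16 * s)) \<le> 3840 * trunc p (1 / s) / (s * (m_fun p (1 / s))\<^sup>2)"
proof -
  let ?M = "m_fun p (1 / s)" and ?c = "trunc p (1 / s)"
  have M: "0 < ?M" and c: "0 < ?c" using s by (auto intro: m_fun_pos trunc_pos)
  have h: "trunc p (1 / t) / (t\<^sup>2 * (m_fun p (1 / t))\<^sup>2) \<le> ?c / (s\<^sup>2 * (?M / 16)\<^sup>2)"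
    if t: "t \<in> {s..16 * s}" for t
  proof -
    have tp: "0 < t" using t s by auto
    have "m_fun p (1 / s) \<le> 16 * m_fun p (1 / (16 * s))"
      using m_fun_scale[of "1 / (16 * s)" 16] s by simp
    also have "m_fun p (1 / (16 * s)) \<le> m_fun p (1 / t)"
      using t tp s by (intro m_fun_mono) (auto simp: frac_le)
    finally have a: "?M / 16 \<le> m_fun p (1 / t)" by simp
    have b: "trunc p (1 / t) \<le> ?c" using t tp s by (intro trunc_mono) (auto simp: frac_le)
    have "s\<^sup>2 * (?M / 16)\<^sup>2 \<le> t\<^sup>2 * (m_fun p (1 / t))\<^sup>2"
      using a t s M by (intro mult_mono power_mono) auto
    then show ?thesis using b c s M by (intro frac_le) auto
  qed
  have hi: "((\<lambda>t. trunc p (1 / t) / (t\<^sup>2 * (m_fun p (1 / t))\<^sup>2)) has_integral (ratio (1 / s) - ratio (1 / (16 * s)))) {s..16 * s}"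
    by (rule has_integral_ratio) (use s in auto)
  have hc: "((\<lambda>t. ?c / (s\<^sup>2 * (?M / 16)\<^sup>2)) has_integral (16 * s - s) * (?c / (s\<^sup>2 * (?M / 16)\<^sup>2))) {s..16 * s}"
    using has_integral_const_real[of "?c / (s\<^sup>2 * (?M / 16)\<^sup>2)" s "16 * s"] s by simp
  have "ratio (1 / s) - ratio (1 / (16 * s)) \<le> (16 * s - s) * (?c / (s\<^sup>2 * (?M / 16)\<^sup>2))"
    by (rule has_integral_le[OF hi hc h])
  also have "\<dots> = 3840 * ?c / (s * ?M\<^sup>2)"
    using s M by (simp add: power_divide power2_eq_square)
  finally show ?thesis .
qed

text \<open>
  If \<open>\<alpha> + \<bar>\<gamma>\<bar> \<le> e t m(1/t)\<close>, the integrand is at least \<open>e\<^sup>-\<^sup>2 (1 - cos tx) \<alpha>(t) / (t\<^sup>3 m(1/t)\<^sup>2)\<close>.  The numerator \<open>\<alpha>\<close> may be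
  tiny at individual \<open>t\<close>, but its average over a block is of order \<open>t c(1/t)\<close>, so that the integral over the
  block is at least a multiple of the increment of \<open>ratio\<close>.  The constant is \<open>377487360 = (3/2) * 16\<^sup>4 * 3840\<close>.
\<close>

lemma Re_kern_block_ge:
  assumes e: "0 < e" and t0: "t0 \<le> pi"
    and H: "\<And>t. 0 < t \<Longrightarrow> t \<le> t0 \<Longrightarrow> alpha p t + \<bar>gamma p t\<bar> \<le> e * (t * m_fun p (1 / t))"
    and s: "0 < s" "16 * s \<le> t0" and x: "2 \<le> real_of_int x * s"
  shows "1 / (377487360 * e\<^sup>2) * (ratio (1 / s) - ratio (1 / (16 * s))) \<le> integral {s..16 * s} (\<lambda>t. Re (kern x t))"
proof -
  let ?M = "m_fun p (1 / s)" and ?c = "trunc p (1 / s)"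
  define D where "D = 65536 * s ^ 4 * (e\<^sup>2 * ?M\<^sup>2)"
  have M: "0 < ?M" and c: "0 < ?c" using s by (auto intro: m_fun_pos trunc_pos)
  have D: "0 < D" using s e M by (simp add: D_def)
  have pt: "1 / D * ((1 - cos (t * real_of_int x)) * (t * alpha p t)) \<le> Re (kern x t)"
    if t: "t \<in> {s..16 * s}" for t
  proof -
    have tp: "0 < t" "t \<le> t0" "t \<le> pi" using t s t0 by auto
    have a: "0 < alpha p t" by (rule alpha_pos[OF tp(1,3)])
    let ?W = "(alpha p t)\<^sup>2 + (gamma p t)\<^sup>2"
    have W: "0 < ?W" using a by (simp add: add_pos_nonneg)
    have "?W \<le> (alpha p t + \<bar>gamma p t\<bar>)\<^sup>2" using a by (simp add: power2_eq_square algebra_simps)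
    also have "\<dots> \<le> (e * (16 * s * ?M))\<^sup>2"
    proof (rule power_mono)
      have "alpha p t + \<bar>gamma p t\<bar> \<le> e * (t * m_fun p (1 / t))" by (rule H[OF tp(1,2)])
      also have "\<dots> \<le> e * (16 * s * ?M)"
        using t tp s e m_fun_pos[of "1 / t"] by (intro mult_left_mono mult_mono m_fun_mono) (auto simp: frac_le)
      finally show "alpha p t + \<bar>gamma p t\<bar> \<le> e * (16 * s * ?M)" .
    qed (use a in simp)
    finally have W2: "?W \<le> (e * (16 * s * ?M))\<^sup>2" .
    have "t\<^sup>2 * ?W \<le> (16 * s)\<^sup>2 * (e * (16 * s * ?M))\<^sup>2"
      using t tp W W2 by (intro mult_mono power_mono) auto
    also have "\<dots> = D" by (simp add: D_def power_mult_distrib eval_nat_numeral)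
    finally have "t * alpha p t / D \<le> t * alpha p t / (t\<^sup>2 * ?W)"
      using a tp W D by (intro divide_left_mono) auto
    also have "\<dots> = alpha p t / (t * ?W)" using tp by (simp add: power2_eq_square)
    finally have "(1 - cos (t * real_of_int x)) * (t * alpha p t / D) \<le> (1 - cos (t * real_of_int x)) * (alpha p t / (t * ?W))"
      by (intro mult_left_mono) auto
    then show ?thesis unfolding Re_kern[OF tp(1)] by simp
  qed
  have "1 / (377487360 * e\<^sup>2) * (ratio (1 / s) - ratio (1 / (16 * s)))
      \<le> 1 / (377487360 * e\<^sup>2) * (3840 * ?c / (s * ?M\<^sup>2))"
    by (intro mult_left_mono ratio_block_le s) auto
  also have "\<dots> = 1 / D * (2 / 3 * s ^ 3 * ?c)"
    using s e M by (simp add: D_def eval_nat_numeral)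
  also have "\<dots> \<le> 1 / D * integral {s..16 * s} (\<lambda>t. (1 - cos (t * real_of_int x)) * (t * alpha p t))"
    using D by (intro mult_left_mono alpha_block_integral_ge s x) auto
  also have "\<dots> = integral {s..16 * s} (\<lambda>t. 1 / D * ((1 - cos (t * real_of_int x)) * (t * alpha p t)))"
    by (rule integral_mult_right[symmetric])
  also have "\<dots> \<le> integral {s..16 * s} (\<lambda>t. Re (kern x t))"
  proof (rule integral_le[OF _ _ pt])
    have "(\<lambda>t. (1 - cos (t * real_of_int x)) * (1 - Re (chf p t))) integrable_on {s..16 * s}"
      by (intro integrable_continuous_real continuous_intros continuous_on_chf)
    then have "(\<lambda>t. (1 - cos (t * real_of_int x)) * (t * alpha p t)) integrable_on {s..16 * s}"
      by (rule integrable_eq) (use s in \<open>auto simp: alpha_eq\<close>)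
    then show "(\<lambda>t. 1 / D * ((1 - cos (t * real_of_int x)) * (t * alpha p t))) integrable_on {s..16 * s}"
      by (rule integrable_on_mult_right)
    show "(\<lambda>t. Re (kern x t)) integrable_on {s..16 * s}"
      by (rule Re_kern_integrable) (use s t0 in auto)
  qed
  finally show ?thesis .
qed

lemma Re_kern_blocks_ge:
  assumes e: "0 < e" and t0: "t0 \<le> pi"
    and H: "\<And>t. 0 < t \<Longrightarrow> t \<le> t0 \<Longrightarrow> alpha p t + \<bar>gamma p t\<bar> \<le> e * (t * m_fun p (1 / t))"
    and s: "0 < s" and x: "2 \<le> real_of_int x * s"
  shows "16 ^ n * s \<le> t0 \<Longrightarrow>
     1 / (377487360 * e\<^sup>2) * (ratio (1 / s) - ratio (1 / (16 ^ n * s))) \<le> integral {s..16 ^ n * s} (\<lambda>t. Re (kern x t))"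
proof (induction n)
  case (Suc n)
  let ?u = "16 ^ n * s"
  have u: "0 < ?u" "s \<le> ?u" "16 * ?u \<le> t0" using s Suc.prems by (auto simp: mult_ac)
  have "real_of_int x * s \<le> real_of_int x * ?u"
  proof (rule mult_left_mono[OF u(2)])
    have "0 < real_of_int x" by (rule zero_less_mult_pos2[OF _ s]) (use x in linarith)
    then show "0 \<le> real_of_int x" by simp
  qed
  then have xu: "2 \<le> real_of_int x * ?u" using x by linarith
  have "1 / (377487360 * e\<^sup>2) * (ratio (1 / ?u) - ratio (1 / (16 * ?u))) \<le> integral {?u..16 * ?u} (\<lambda>t. Re (kern x t))"
    by (rule Re_kern_block_ge[OF e t0 H u(1,3) xu])
  moreover have "1 / (377487360 * e\<^sup>2) * (ratio (1 / s) - ratio (1 / ?u)) \<le> integral {s..?u} (\<lambda>t. Re (kern x t))"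
    by (rule Suc.IH) (use u in linarith)
  moreover have "integral {s..?u} (\<lambda>t. Re (kern x t)) + integral {?u..16 * ?u} (\<lambda>t. Re (kern x t)) = integral {s..16 * ?u} (\<lambda>t. Re (kern x t))"
    using u s t0 by (intro Henstock_Kurzweil_Integration.integral_combine Re_kern_integrable) auto
  moreover have "1 / (377487360 * e\<^sup>2) * (ratio (1 / s) - ratio (1 / (16 * ?u)))
     = 1 / (377487360 * e\<^sup>2) * (ratio (1 / s) - ratio (1 / ?u)) + 1 / (377487360 * e\<^sup>2) * (ratio (1 / ?u) - ratio (1 / (16 * ?u)))"
    unfolding distrib_left[symmetric] by simp
  ultimately show ?case unfolding power_Suc mult.assoc by linarith
qed simp

text \<open>
  The blocks start at \<open>2/x\<close> and stop within a factor \<open>16\<close> of \<open>t\<^sub>0\<close>.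
\<close>

lemma sym_potential_lower_bound:
  assumes e: "0 < e" and t0: "0 < t0" "t0 \<le> pi"
    and H: "\<And>t. 0 < t \<Longrightarrow> t \<le> t0 \<Longrightarrow> alpha p t + \<bar>gamma p t\<bar> \<le> e * (t * m_fun p (1 / t))"
    and x: "2 \<le> real_of_int x * t0"
  shows "1 / (377487360 * e\<^sup>2) * (ratio (real_of_int x) / 2 - ratio (16 / t0)) \<le> pi * sym_potential p x"
proof -
  have xp: "0 < real_of_int x" by (rule zero_less_mult_pos2[OF _ t0(1)]) (use x in linarith)
  define s where "s = 2 / real_of_int x"
  have s: "0 < s" "s \<le> t0" "2 \<le> real_of_int x * s" using x xp by (auto simp: s_def field_simps)
  obtain N :: nat where N: "t0 / s < 16 ^ N" using real_arch_pow[of 16 "t0 / s"] by auto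
  define L where "L = (LEAST n. t0 < 16 ^ n * s)"
  have ex: "\<exists>n. t0 < 16 ^ n * s" using N s by (auto simp: field_simps)
  have L: "t0 < 16 ^ L * s" unfolding L_def by (rule LeastI_ex[OF ex])
  have "L \<noteq> 0"
  proof
    assume "L = 0"
    with L have "t0 < s" by simp
    with s(2) show False by linarith
  qed
  then obtain n where n: "L = Suc n" by (cases L) auto
  have n0: "16 ^ n * s \<le> t0"
    using not_less_Least[of n "\<lambda>n. t0 < 16 ^ n * s"] n unfolding L_def by (simp add: not_less)
  have n1: "t0 / 16 \<le> 16 ^ n * s" using L unfolding n by simp
  have nonneg: "0 \<le> 1 / (377487360 * e\<^sup>2)" by simp
  have "ratio (1 / (16 ^ n * s)) \<le> ratio (16 / t0)"
  proof (rule ratio_mono)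
    have "1 / (16 ^ n * s) \<le> 1 / (t0 / 16)" using n1 t0 s by (intro divide_left_mono) auto
    then show "1 / (16 ^ n * s) \<le> 16 / t0" by simp
  qed (use s in simp)
  moreover have "ratio (real_of_int x) / 2 \<le> ratio (1 / s)"
  proof -
    have "m_fun p (1 / s) \<le> m_fun p (real_of_int x)"
      using xp by (intro m_fun_mono) (auto simp: s_def)
    then have "(1 / s) / m_fun p (real_of_int x) \<le> (1 / s) / m_fun p (1 / s)"
      using s m_fun_pos[of "1 / s"] by (intro divide_left_mono mult_pos_pos) auto
    moreover have "(1 / s) / m_fun p (real_of_int x) = ratio (real_of_int x) / 2"
      by (simp add: s_def ratio_def)
    ultimately show ?thesis by (simp add: ratio_def)
  qed
  ultimately have "ratio (real_of_int x) / 2 - ratio (16 / t0) \<le> ratio (1 / s) - ratio (1 / (16 ^ n * s))" by argo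
  from mult_left_mono[OF this nonneg]
  have "1 / (377487360 * e\<^sup>2) * (ratio (real_of_int x) / 2 - ratio (16 / t0))
      \<le> 1 / (377487360 * e\<^sup>2) * (ratio (1 / s) - ratio (1 / (16 ^ n * s)))" .
  also have "\<dots> \<le> integral {s..16 ^ n * s} (\<lambda>t. Re (kern x t))"
    by (rule Re_kern_blocks_ge[OF e t0(2) H s(1,3) n0])
  also have "\<dots> \<le> pi * sym_potential p x"
    by (rule integral_Re_kern_le) (use s n0 t0 in auto)
  finally show ?thesis .
qed

text \<open>
  The lower bound carries the factor \<open>e\<^sup>-\<^sup>2\<close>, and the limit hypothesis allows \<open>e\<close> to be arbitrarily small.
\<close>

lemma sym_potential_ratio_at_top:
  assumes lim: "((\<lambda>t. (alpha p t + \<bar>gamma p t\<bar>) / (t * m_fun p (1 / t))) \<longlongrightarrow> 0) (at_right 0)"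
  shows "filterlim (\<lambda>x :: int. sym_potential p x / (real_of_int x / m_fun p (real_of_int x))) at_top at_top"
proof -
  have "\<forall>\<^sub>F x :: int in at_top. Z \<le> sym_potential p x / (real_of_int x / m_fun p (real_of_int x))"
    if Z: "0 < Z" for Z :: real
  proof -
    \<comment> \<open>The constant in the lower bound becomes 4 * pi * Z.\<close>
    define e where "e = sqrt (1 / (4 * 377487360 * pi * Z))"
    have e: "0 < e" using Z by (simp add: e_def)
    have e2: "1 / (377487360 * e\<^sup>2) = 4 * pi * Z" using Z by (simp add: e_def)
    have "\<forall>\<^sub>F t in at_right 0. (alpha p t + \<bar>gamma p t\<bar>) / (t * m_fun p (1 / t)) < e"
      using order_tendstoD(2)[OF lim e] .
    then obtain b where b: "0 < b" "\<And>t. 0 < t \<Longrightarrow> t < b \<Longrightarrow> (alpha p t + \<bar>gamma p t\<bar>) / (t * m_fun p (1 / t)) < e"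
      unfolding eventually_at_right_field by auto
    define t0 where "t0 = min pi (b / 2)"
    have t0: "0 < t0" "t0 \<le> pi" "t0 < b" using b pi_gt_zero by (auto simp: t0_def)
    have H: "alpha p t + \<bar>gamma p t\<bar> \<le> e * (t * m_fun p (1 / t))" if "0 < t" "t \<le> t0" for t
    proof -
      have "0 < t * m_fun p (1 / t)" using m_fun_pos[of "1 / t"] that by simp
      then show ?thesis using b(2)[of t] that t0 by (simp add: pos_divide_less_eq)
    qed
    have ev: "\<forall>\<^sub>F y :: real in at_top. 2 / t0 \<le> y \<and> 0 < y \<and> 4 * ratio (16 / t0) \<le> ratio y"
    proof (intro eventually_conj eventually_ge_at_top eventually_gt_at_top)
      show "\<forall>\<^sub>F y in at_top. 4 * ratio (16 / t0) \<le> ratio y"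
        using ratio_at_top unfolding filterlim_at_top by blast
    qed
    have "filterlim (real_of_int) at_top at_top" by (rule filterlim_real_of_int_at_top)
    from eventually_compose_filterlim[OF ev this] show ?thesis
    proof eventually_elim
      case (elim x)
      have r: "0 < ratio (real_of_int x)" using elim by (simp add: ratio_pos)
      have "4 * pi * Z * (ratio (real_of_int x) / 4) \<le> 4 * pi * Z * (ratio (real_of_int x) / 2 - ratio (16 / t0))"
        using elim Z by (intro mult_left_mono) auto
      also have "\<dots> \<le> pi * sym_potential p x"
        unfolding e2[symmetric] by (rule sym_potential_lower_bound[OF e t0(1,2) H]) (use elim t0 in \<open>auto simp: field_simps\<close>)
      finally have "pi * (Z * ratio (real_of_int x)) \<le> pi * sym_potential p x" by (simp add: mult_ac)
      then have "Z * ratio (real_of_int x) \<le> sym_potential p x" by simp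
      then show ?case unfolding ratio_def[symmetric] pos_le_divide_eq[OF r] .
    qed
  qed
  then show ?thesis unfolding filterlim_at_top_gt[where c=0] by blast
qed

end

section \<open>A lacunary walk\<close>

text \<open>
  A symmetric walk with \<open>P[\<bar>X\<bar> = M\<^sub>k]\<close> proportional to \<open>2\<^sup>-\<^sup>k / M\<^sub>k\<close> for \<open>M\<^sub>k = 2^(k\<^sup>2)\<close>.  The quotient
  \<open>x/m(x)\<close> is of order \<open>2\<^sup>k\<close> between \<open>M\<^sub>k\<^sub>-\<^sub>1\<close> and \<open>M\<^sub>k\<close>.  At \<open>t = \<pi>/M\<^sub>k\<close> the single scale \<open>M\<^sub>k\<close> makes \<open>\<alpha>(t)\<close> comparable to
  \<open>t m(1/t)\<close>.  For \<open>t\<close> near the geometric mean of \<open>1/M\<^sub>k\<^sub>-\<^sub>1\<close> and \<open>1/M\<^sub>k\<close>, however, \<open>\<alpha>(t)\<close> is smaller than \<open>t m(1/t)\<close> by a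
  large factor, and since \<open>\<gamma> = 0\<close> these \<open>t\<close> make the potential at least of order \<open>4\<^sup>k\<close> at all \<open>x \<ge> M\<^sub>k\<close>.
\<close>

definition scale :: "nat \<Rightarrow> int" where "scale k = 2 ^ (k\<^sup>2)"

definition weight :: "nat \<Rightarrow> real" where "weight k = (1/2) ^ k / real_of_int (scale k)"

definition level_pmf :: "nat pmf" where "level_pmf = embed_pmf (\<lambda>k. weight k / (\<Sum>k. weight k))"

definition lacunary :: "int pmf" where
  "lacunary = map_pmf (\<lambda>(k, b). if b then scale k else - scale k) (pair_pmf level_pmf (bernoulli_pmf (1/2)))"

abbreviation rscale :: "nat \<Rightarrow> real" where "rscale k \<equiv> real_of_int (scale k)"

lemma scale_ge_1: "1 \<le> rscale k" by (simp add: scale_def)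

lemma scale_pos: "0 < rscale k" using scale_ge_1[of k] by linarith

lemma scale_mono: "j \<le> k \<Longrightarrow> rscale j \<le> rscale k"
  by (simp add: scale_def power_increasing power_mono)

lemma weight_pos: "0 < weight k" using scale_pos[of k] by (simp add: weight_def)

lemma weight_le: "weight k \<le> (1/2) ^ k"
  using scale_ge_1[of k] by (simp add: weight_def divide_le_eq mult_left_le)

lemma weight_times_scale: "weight k * rscale k = (1/2) ^ k"
  using scale_pos[of k] by (simp add: weight_def)

lemma weight_sums: "weight sums (\<Sum>k. weight k)" "1 \<le> (\<Sum>k. weight k)" "(\<Sum>k. weight k) \<le> 2"
proof -
  have g: "(\<lambda>k. (1/2 :: real) ^ k) sums 2" using geometric_sums[of "1/2 :: real"] by simp
  have s: "summable weight"
    by (rule summable_comparison_test'[OF sums_summable[OF g], of 0])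
       (use weight_le weight_pos in \<open>auto simp: less_imp_le\<close>)
  then show "weight sums (\<Sum>k. weight k)" by (rule summable_sums)
  have "weight 0 \<le> (\<Sum>k. weight k)"
    using sum_le_suminf[OF s, of "{0}"] weight_pos by (auto simp: less_imp_le)
  then show "1 \<le> (\<Sum>k. weight k)" by (simp add: weight_def scale_def)
  show "(\<Sum>k. weight k) \<le> 2"
    using suminf_le[OF weight_le s sums_summable[OF g]] sums_unique[OF g] by simp
qed

definition norm_const :: real where "norm_const = 1 / (\<Sum>k. weight k)"

lemma norm_const: "1/2 \<le> norm_const" "norm_const \<le> 1"
  using weight_sums(2,3) by (auto simp: norm_const_def field_simps)

lemma pmf_level: "pmf level_pmf k = norm_const * weight k"
proof -
  have nn: "0 \<le> weight k / (\<Sum>k. weight k)" for k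
    using weight_pos[of k] weight_sums(2) by simp
  have "(\<lambda>k. weight k / (\<Sum>k. weight k)) sums ((\<Sum>k. weight k) / (\<Sum>k. weight k))"
    by (intro sums_divide weight_sums(1))
  then have sums1: "(\<lambda>k. weight k / (\<Sum>k. weight k)) sums 1" using weight_sums(2) by simp
  have "(\<integral>\<^sup>+ k. ennreal (weight k / (\<Sum>k. weight k)) \<partial>count_space UNIV) = 1"
    unfolding nn_integral_count_space_nat
    using suminf_ennreal_eq[OF nn sums1] by simp
  then show ?thesis unfolding level_pmf_def
    by (subst pmf_embed_pmf) (use nn in \<open>auto simp: norm_const_def\<close>)
qed

lemma expectation_nat_sums:
  fixes f :: "nat \<Rightarrow> real"
  assumes "integrable (measure_pmf q) f"
  shows "(\<lambda>k. pmf q k * f k) sums expect q f"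
proof -
  have "integrable (count_space UNIV) (\<lambda>k. pmf q k *\<^sub>R f k)"
    using assms unfolding measure_pmf_eq_density by (subst (asm) integrable_density) auto
  then have "(\<lambda>k. pmf q k *\<^sub>R f k) sums (\<integral>k. pmf q k *\<^sub>R f k \<partial>count_space UNIV)"
    by (rule sums_integral_count_space_nat)
  also have "(\<integral>k. pmf q k *\<^sub>R f k \<partial>count_space UNIV) = expect q f"
    unfolding measure_pmf_eq_density by (subst integral_density) auto
  finally show ?thesis by simp
qed

text \<open>
  Scales below \<open>j\<close> are summed exactly, and those from \<open>j\<close> on by comparison with a geometric series.
\<close>

lemma expectation_level_le:
  fixes f :: "nat \<Rightarrow> real"
  assumes i: "integrable (measure_pmf q) f"
    and tail: "\<And>k. j \<le> k \<Longrightarrow> pmf q k * f k \<le> D * (1/2) ^ k"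
  shows "expect q f \<le> (\<Sum>k<j. pmf q k * f k) + 2 * D * (1/2) ^ j"
proof -
  have s: "(\<lambda>k. pmf q k * f k) sums expect q f" by (rule expectation_nat_sums[OF i])
  have "(\<lambda>k. (1/2 :: real) ^ k) sums 2" using geometric_sums[of "1/2 :: real"] by simp
  then have g: "(\<lambda>k. D * (1/2) ^ j * (1/2) ^ k) sums (D * (1/2) ^ j * 2)" by (rule sums_mult)
  have "expect q f = (\<Sum>k. pmf q k * f k)" by (rule sums_unique[OF s])
  also have "\<dots> = (\<Sum>k. pmf q (k + j) * f (k + j)) + (\<Sum>k<j. pmf q k * f k)"
    by (rule suminf_split_initial_segment[OF sums_summable[OF s]])
  also have "(\<Sum>k. pmf q (k + j) * f (k + j)) \<le> (\<Sum>k. D * (1/2) ^ j * (1/2) ^ k)"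
  proof (rule suminf_le)
    show "pmf q (k + j) * f (k + j) \<le> D * (1/2) ^ j * (1/2) ^ k" for k
      using tail[of "k + j"] by (simp add: power_add mult_ac)
    show "summable (\<lambda>k. pmf q (k + j) * f (k + j))"
      by (rule summable_ignore_initial_segment[OF sums_summable[OF s]])
    show "summable (\<lambda>k. D * (1/2) ^ j * (1/2) ^ k)" by (rule sums_summable[OF g])
  qed
  also have "\<dots> = D * (1/2) ^ j * 2" by (rule sums_unique[OF g, symmetric])
  finally show ?thesis by simp
qed

lemma lacunary_even:
  fixes f :: "int \<Rightarrow> real"
  assumes f: "\<And>k. f (- k) = f k"
  shows "expect lacunary f = expect level_pmf (\<lambda>k. f (scale k))"
    and "integrable (measure_pmf lacunary) f \<longleftrightarrow> integrable (measure_pmf level_pmf) (\<lambda>k. f (scale k))"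
proof -
  have e: "f (case z of (k, b) \<Rightarrow> if b then scale k else - scale k) = f (scale (fst z))" for z
    using f by (auto simp: case_prod_unfold)
  let ?P = "pair_pmf level_pmf (bernoulli_pmf (1/2))"
  have m: "expect level_pmf (\<lambda>k. f (scale k)) = expect ?P (\<lambda>z. f (scale (fst z)))"
    using integral_map_pmf[of fst ?P "\<lambda>k. f (scale k)"] unfolding map_fst_pair_pmf .
  have i: "integrable (measure_pmf level_pmf) (\<lambda>k. f (scale k)) \<longleftrightarrow> integrable (measure_pmf ?P) (\<lambda>z. f (scale (fst z)))"
    using integrable_map_pmf_eq[of fst ?P "\<lambda>k. f (scale k)"] unfolding map_fst_pair_pmf .
  show "expect lacunary f = expect level_pmf (\<lambda>k. f (scale k))"
    unfolding lacunary_def integral_map_pmf e m ..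
  show "integrable (measure_pmf lacunary) f \<longleftrightarrow> integrable (measure_pmf level_pmf) (\<lambda>k. f (scale k))"
    unfolding lacunary_def integrable_map_pmf_eq e i ..
qed

lemma lacunary_symmetric: "map_pmf uminus lacunary = lacunary"
proof -
  have h: "map_pmf Not (bernoulli_pmf (1/2)) = bernoulli_pmf (1/2)"
  proof (rule pmf_eqI)
    fix b
    have "pmf (map_pmf Not (bernoulli_pmf (1/2))) (Not (Not b)) = pmf (bernoulli_pmf (1/2)) (Not b)"
      by (rule pmf_map_inj') (simp add: inj_def)
    then show "pmf (map_pmf Not (bernoulli_pmf (1/2))) b = pmf (bernoulli_pmf (1/2)) b"
      by (cases b) simp_all
  qed
  let ?g = "\<lambda>(k, b). if b then scale k else - scale k"
  have "map_pmf uminus lacunary = map_pmf (\<lambda>z. ?g (apsnd Not z)) (pair_pmf level_pmf (bernoulli_pmf (1/2)))"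
    unfolding lacunary_def map_pmf_comp by (intro map_pmf_cong) auto
  also have "\<dots> = map_pmf ?g (pair_pmf level_pmf (map_pmf Not (bernoulli_pmf (1/2))))"
    unfolding pair_map_pmf2 map_pmf_comp ..
  finally show ?thesis unfolding h lacunary_def .
qed

lemma lacunary_odd:
  fixes f :: "int \<Rightarrow> real"
  assumes f: "\<And>k. f (- k) = - f k"
  shows "expect lacunary f = 0"
proof -
  have "expect lacunary f = expect (map_pmf uminus lacunary) f"
    by (simp only: lacunary_symmetric)
  also have "\<dots> = - expect lacunary f" by (simp add: f)
  finally show ?thesis by simp
qed

lemma lacunary_support: "scale k \<in> set_pmf lacunary" "- scale k \<in> set_pmf lacunary"
proof -
  have "k \<in> set_pmf level_pmf" using weight_pos[of k] norm_const by (simp add: set_pmf_iff pmf_level)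
  then have mem: "(k, True) \<in> set_pmf (pair_pmf level_pmf (bernoulli_pmf (1/2)))"
      "(k, False) \<in> set_pmf (pair_pmf level_pmf (bernoulli_pmf (1/2)))"
    by (auto simp: set_pmf_bernoulli)
  show "scale k \<in> set_pmf lacunary"
    unfolding lacunary_def set_map_pmf by (rule image_eqI[OF _ mem(1)]) simp
  show "- scale k \<in> set_pmf lacunary"
    unfolding lacunary_def set_map_pmf by (rule image_eqI[OF _ mem(2)]) simp
qed

lemma irreducible_walk_nearest_neighbour:
  assumes "1 \<in> set_pmf p" "- 1 \<in> set_pmf p"
  shows "irreducible_walk p"
proof -
  have step: "\<exists>n. y + k \<in> set_pmf (walk_law p n)" if ex: "\<exists>n. y \<in> set_pmf (walk_law p n)" and k: "k \<in> set_pmf p" for y k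
  proof -
    obtain n where "y \<in> set_pmf (walk_law p n)" using ex by blast
    then have "y + k \<in> set_pmf (walk_law p (Suc n))"
      using k unfolding walk_law_Suc set_map_pmf set_pair_pmf by (intro image_eqI[of _ _ "(k, y)"]) auto
    then show ?thesis by blast
  qed
  have all: "\<exists>n. y \<in> set_pmf (walk_law p n)" for y
  proof (induction y rule: int_induct[where k=0])
    case base
    show ?case by (rule exI[of _ 0]) (simp add: walk_law_0)
  next
    case (step1 i)
    then show ?case using step[of i 1] assms by simp
  next
    case (step2 i)
    then show ?case using step[of i "- 1"] assms by simp
  qed
  show ?thesis unfolding irreducible_walk_def
  proof (intro allI)
    fix x y :: int
    obtain n where "y - x \<in> set_pmf (walk_law p n)" using all by blast
    then have "y \<in> set_pmf (map_pmf (\<lambda>s. x + s) (walk_law p n))"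
      unfolding set_map_pmf by (intro image_eqI[of _ _ "y - x"]) auto
    then have "0 < pmf (map_pmf (\<lambda>s. x + s) (walk_law p n)) y" by (rule pmf_positive)
    then show "\<exists>n. 0 < pmf (map_pmf (\<lambda>s. x + s) (walk_law p n)) y" ..
  qed
qed

lemma lacunary_standing: "standing_assms lacunary"
  unfolding standing_assms_def
proof (intro conjI)
  show "irreducible_walk lacunary"
    using lacunary_support[of 0] by (intro irreducible_walk_nearest_neighbour) (simp_all add: scale_def)
  have "integrable (measure_pmf level_pmf) (\<lambda>k. rscale k)"
  proof (rule integrableI_nonneg)
    have "(\<integral>\<^sup>+ k. ennreal (rscale k) \<partial>measure_pmf level_pmf)
        = (\<integral>\<^sup>+ k. ennreal (pmf level_pmf k) * ennreal (rscale k) \<partial>count_space UNIV)"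
      unfolding measure_pmf_eq_density by (subst nn_integral_density) auto
    also have "\<dots> = (\<integral>\<^sup>+ k. ennreal (norm_const * (1/2) ^ k) \<partial>count_space UNIV)"
    proof (intro nn_integral_cong)
      fix k
      have "ennreal (pmf level_pmf k) * ennreal (rscale k) = ennreal (pmf level_pmf k * rscale k)"
        by (rule ennreal_mult'[symmetric]) (simp add: less_imp_le scale_pos)
      then show "ennreal (pmf level_pmf k) * ennreal (rscale k) = ennreal (norm_const * (1/2) ^ k)"
        by (simp only: pmf_level mult.assoc weight_times_scale)
    qed
    also have "\<dots> = ennreal (norm_const * 2)"
      unfolding nn_integral_count_space_nat
      by (rule suminf_ennreal_eq)
         (use norm_const geometric_sums[of "1/2 :: real"] in \<open>auto intro!: sums_mult\<close>)
    finally show "(\<integral>\<^sup>+ k. ennreal (rscale k) \<partial>measure_pmf level_pmf) < \<infinity>" by simp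
  qed (auto simp: scale_def)
  then have "integrable (measure_pmf lacunary) (\<lambda>k. \<bar>real_of_int k\<bar>)"
    using lacunary_even(2)[of "\<lambda>k. \<bar>real_of_int k\<bar>"] scale_pos by (simp add: abs_of_pos)
  then show "integrable (measure_pmf lacunary) real_of_int"
    using integrable_abs_iff[of real_of_int "measure_pmf lacunary"] by simp
  show "expect lacunary real_of_int = 0"
    by (rule lacunary_odd) simp
  show "(\<integral>\<^sup>+ k. ennreal ((real_of_int k)\<^sup>2) \<partial>measure_pmf lacunary) = \<infinity>"
  proof (rule ccontr)
    assume fin: "(\<integral>\<^sup>+ k. ennreal ((real_of_int k)\<^sup>2) \<partial>measure_pmf lacunary) \<noteq> \<infinity>"
    then have "integrable (measure_pmf lacunary) (\<lambda>k. (real_of_int k)\<^sup>2)"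
      by (intro integrableI_nonneg) (auto simp: less_top)
    then have i: "integrable (measure_pmf level_pmf) (\<lambda>k. (rscale k)\<^sup>2)"
      using lacunary_even(2)[of "\<lambda>k. (real_of_int k)\<^sup>2"] by simp
    have "(\<lambda>k. pmf level_pmf k * (rscale k)\<^sup>2) \<longlonglongrightarrow> 0"
      using expectation_nat_sums[OF i] sums_summable summable_LIMSEQ_zero by blast
    then have "\<forall>\<^sub>F k in sequentially. pmf level_pmf k * (rscale k)\<^sup>2 < 1 / 2"
      by (rule order_tendstoD) simp
    then obtain k where k: "pmf level_pmf k * (rscale k)\<^sup>2 < 1 / 2"
      using eventually_happens by fastforce
    have "pmf level_pmf k * (rscale k)\<^sup>2 = norm_const * ((1/2) ^ k * rscale k)"
      using weight_times_scale[of k] by (simp add: pmf_level power2_eq_square mult.assoc[symmetric])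
    moreover have "1 \<le> (1/2 :: real) ^ k * rscale k"
    proof -
      have "k \<le> k\<^sup>2" by (simp add: power2_eq_square)
      then have "(2 :: real) ^ k \<le> 2 ^ (k\<^sup>2)" by (intro power_increasing) auto
      then show ?thesis by (simp add: scale_def power_divide field_simps)
    qed
    moreover have "1 / 2 * 1 \<le> norm_const * ((1/2) ^ k * rscale k)"
      by (rule mult_mono[OF norm_const(1) calculation(2)]) (use norm_const in auto)
    ultimately show False using k by linarith
  qed
qed

interpretation lac: heavy_walk lacunary
  by unfold_locales (rule lacunary_standing)

lemma lacunary_gamma: "0 < t \<Longrightarrow> gamma lacunary t = 0"
  using lacunary_odd[of "\<lambda>k. sin (t * real_of_int k)"] by (simp add: lac.gamma_eq Im_chf)

lemma lacunary_alpha: "0 < t \<Longrightarrow> t * alpha lacunary t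
    = expect level_pmf (\<lambda>k. 1 - cos (t * rscale k))"
  unfolding lac.alpha_eq_expectation by (rule lacunary_even(1)) simp

text \<open>
  The terms \<open>2\<^sup>-\<^sup>k M\<^sub>k\<close> at least double from \<open>k = 1\<close> on, so the last one dominates the sum.
\<close>

lemma sum_weight_square_le:
  "(\<Sum>k<Suc i. pmf level_pmf k * (rscale k)\<^sup>2) \<le> 2 * norm_const * ((1/2) ^ i * rscale i)"
proof (induction i)
  case 0
  show ?case using norm_const by (simp add: pmf_level weight_def scale_def)
next
  case (Suc i)
  have e: "pmf level_pmf k * (rscale k)\<^sup>2 = norm_const * ((1/2) ^ k * rscale k)" for k
    using weight_times_scale[of k] by (simp add: pmf_level power2_eq_square mult.assoc[symmetric])
  have s: "rscale (Suc i) = 2 * 4 ^ i * rscale i"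
  proof -
    have "(Suc i)\<^sup>2 = i\<^sup>2 + 2 * i + 1" by (simp add: power2_eq_square)
    then show ?thesis by (simp add: scale_def power_add power_mult)
  qed
  show ?case
  proof (cases "i = 0")
    case True
    then show ?thesis using norm_const by (simp add: e scale_def pmf_level weight_def)
  next
    case False
    have "(4 :: real) ^ 1 \<le> 4 ^ i" using False by (intro power_increasing) auto
    then have q: "2 * ((1/2 :: real) ^ i * rscale i) \<le> (1/2) ^ Suc i * rscale (Suc i)"
      unfolding s using scale_pos[of i] by (simp add: mult_left_mono)
    have "(\<Sum>k<Suc (Suc i). pmf level_pmf k * (rscale k)\<^sup>2)
        \<le> norm_const * (2 * ((1/2) ^ i * rscale i)) + norm_const * ((1/2) ^ Suc i * rscale (Suc i))"
      using Suc.IH unfolding sum.lessThan_Suc[of _ "Suc i"] e[of "Suc i"] by simp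
    also have "\<dots> \<le> norm_const * ((1/2) ^ Suc i * rscale (Suc i)) + norm_const * ((1/2) ^ Suc i * rscale (Suc i))"
      using norm_const by (intro add_right_mono mult_left_mono q) auto
    finally show ?thesis by (simp only: mult_2 distrib_right)
  qed
qed

lemma pmf_level_times: "pmf level_pmf k * rscale k = norm_const * (1/2) ^ k"
  by (simp only: pmf_level mult.assoc weight_times_scale)

lemma lacunary_trunc_ge: "norm_const * (1/2) ^ j * rscale j / 2 \<le> trunc lacunary (rscale j)"
proof -
  let ?M = "rscale j"
  have i: "integrable (measure_pmf level_pmf) (\<lambda>k. min ((rscale k)\<^sup>2) (?M\<^sup>2))"
    by (rule integrable_bounded_pmf[where B="?M\<^sup>2"]) auto
  have "norm_const * (1/2) ^ j * ?M = pmf level_pmf j * min ((rscale j)\<^sup>2) (?M\<^sup>2)"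
    by (simp add: pmf_level_times[symmetric] power2_eq_square)
  also have "\<dots> \<le> expect level_pmf (\<lambda>k. min ((rscale k)\<^sup>2) (?M\<^sup>2))"
    by (rule pmf_times_le_expectation[OF i]) simp
  also have "\<dots> = expect lacunary (\<lambda>k. min ((real_of_int k)\<^sup>2) (?M\<^sup>2))"
    by (rule lacunary_even(1)[symmetric]) simp
  finally show ?thesis unfolding trunc_def by simp
qed

lemma lacunary_ratio_le:
  assumes "0 < x" "x \<le> rscale j"
  shows "lac.ratio x \<le> 4 * 2 ^ j"
proof -
  let ?M = "rscale j"
  have M: "0 < ?M" by (rule scale_pos)
  have "1 / 2 * ((1/2) ^ j * ?M / 2) \<le> norm_const * ((1/2) ^ j * ?M / 2)"
    using norm_const M by (intro mult_right_mono) auto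
  also have "\<dots> \<le> m_fun lacunary ?M"
    using lacunary_trunc_ge[of j] lac.trunc_le_m_fun[OF M] by simp
  finally have m: "1 / 2 * ((1/2) ^ j * ?M / 2) \<le> m_fun lacunary ?M" .
  have "lac.ratio x \<le> lac.ratio ?M" by (rule lac.ratio_mono[OF assms])
  also have "\<dots> \<le> ?M / (1 / 2 * ((1/2) ^ j * ?M / 2))"
    unfolding lac.ratio_def using m M lac.m_fun_pos[OF M] by (intro divide_left_mono mult_pos_pos) auto
  also have "\<dots> = 4 * 2 ^ j" using M by (simp add: power_divide)
  finally show ?thesis .
qed

text \<open>
  Scales up to \<open>M\<^sub>i\<close> contribute at most \<open>(tM\<^sub>k)\<^sup>2/2\<close> and the larger ones at most \<open>2\<close>; at \<open>t\<close> of order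
  \<open>2^(-i\<^sup>2 - i)\<close>, which is \<open>(M\<^sub>i M\<^sub>i\<^sub>+\<^sub>1)^(-1/2)\<close> up to a constant, both contributions balance.
\<close>

lemma lacunary_alpha_le:
  assumes t: "0 < t" "t \<le> 2 * (1/2) ^ (i\<^sup>2 + i)"
  shows "t * alpha lacunary t \<le> 5 * (1/2) ^ (i\<^sup>2 + 3 * i)"
proof -
  let ?q = "(1/2 :: real) ^ (i\<^sup>2 + 3 * i)"
  define D where "D = 2 * norm_const / rscale (Suc i)"
  have int: "integrable (measure_pmf level_pmf) (\<lambda>k. 1 - cos (t * rscale k))"
    by (rule integrable_one_minus_cos)
  have tail: "pmf level_pmf k * (1 - cos (t * rscale k)) \<le> D * (1/2) ^ k" if "Suc i \<le> k" for k
  proof -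
    have "pmf level_pmf k * (1 - cos (t * rscale k)) \<le> pmf level_pmf k * 2"
      using cos_ge_minus_one[of "t * rscale k"] by (intro mult_left_mono) auto
    also have "\<dots> = 2 * norm_const * (1/2) ^ k / rscale k" by (simp add: pmf_level weight_def)
    also have "\<dots> \<le> 2 * norm_const * (1/2) ^ k / rscale (Suc i)"
      using norm_const scale_mono[OF that] scale_pos by (intro divide_left_mono mult_pos_pos) auto
    finally show ?thesis by (simp add: D_def)
  qed
  have s: "rscale i = 2 ^ (i\<^sup>2)" "rscale (Suc i) = 2 ^ (i\<^sup>2) * 4 ^ i * 2"
  proof -
    have "(Suc i)\<^sup>2 = i\<^sup>2 + 2 * i + 1" by (simp add: power2_eq_square)
    then show "rscale i = 2 ^ (i\<^sup>2)" "rscale (Suc i) = 2 ^ (i\<^sup>2) * 4 ^ i * 2"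
      by (simp_all add: scale_def power_add power_mult)
  qed
  have "(\<Sum>k<Suc i. pmf level_pmf k * (1 - cos (t * rscale k)))
      \<le> (\<Sum>k<Suc i. t\<^sup>2 / 2 * (pmf level_pmf k * (rscale k)\<^sup>2))"
  proof (rule sum_mono)
    fix k
    have "pmf level_pmf k * (1 - cos (t * rscale k)) \<le> pmf level_pmf k * ((t * rscale k)\<^sup>2 / 2)"
      by (intro mult_left_mono one_minus_cos_le) simp
    then show "pmf level_pmf k * (1 - cos (t * rscale k)) \<le> t\<^sup>2 / 2 * (pmf level_pmf k * (rscale k)\<^sup>2)"
      by (simp add: power_mult_distrib mult_ac)
  qed
  also have "\<dots> \<le> t\<^sup>2 / 2 * (2 * norm_const * ((1/2) ^ i * rscale i))"
    unfolding sum_distrib_left[symmetric] by (intro mult_left_mono sum_weight_square_le) simp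
  also have "\<dots> \<le> (2 * (1/2) ^ (i\<^sup>2 + i))\<^sup>2 / 2 * (2 * norm_const * ((1/2) ^ i * rscale i))"
    using t norm_const scale_pos[of i] by (intro mult_right_mono divide_right_mono power_mono) auto
  also have "\<dots> = 4 * norm_const * ?q"
  proof -
    have "(2 * (1/2 :: real) ^ (i\<^sup>2 + i))\<^sup>2 * ((1/2) ^ i * 2 ^ (i\<^sup>2)) = 4 * ?q"
      by (simp add: power_add power_mult power_divide power2_eq_square power3_eq_cube field_simps)
    then show ?thesis unfolding s by (simp add: mult_ac)
  qed
  finally have S: "(\<Sum>k<Suc i. pmf level_pmf k * (1 - cos (t * rscale k))) \<le> 4 * norm_const * ?q" .
  have T: "2 * D * (1/2) ^ Suc i = norm_const * ?q"
  proof -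
    have "(4 :: real) ^ i = 2 ^ i * 2 ^ i" "(8 :: real) ^ i = 2 ^ i * (2 ^ i * 2 ^ i)"
      by (simp_all add: power_mult_distrib[symmetric])
    then show ?thesis unfolding D_def s
      by (simp add: power_add power_mult power_divide power3_eq_cube field_simps)
  qed
  have "t * alpha lacunary t \<le> 5 * norm_const * ?q"
    using expectation_level_le[OF int tail, of "Suc i"] S unfolding lacunary_alpha[OF t(1)] T by linarith
  also have "\<dots> \<le> 5 * 1 * ?q" using norm_const by (intro mult_right_mono mult_left_mono) auto
  finally show ?thesis by simp
qed

text \<open>
  The integral over \<open>[T, 2T]\<close> with \<open>T = 2^(-i\<^sup>2 - i)\<close> suffices; the condition on \<open>x\<close> ensures that \<open>1 - cos tx\<close>
  oscillates within this interval and averages to at least \<open>1/2\<close>.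
\<close>

lemma lacunary_sym_potential_ge:
  assumes i: "1 \<le> i" and x: "rscale (Suc i) \<le> real_of_int x"
  shows "4 ^ i / 10 \<le> pi * sym_potential lacunary x"
proof -
  define T :: real where "T = (1/2) ^ (i\<^sup>2 + i)"
  define q :: real where "q = (1/2) ^ (i\<^sup>2 + 3 * i)"
  have T: "0 < T" "2 * T \<le> pi"
  proof -
    have "T \<le> 1" by (simp add: T_def power_le_one)
    then show "0 < T" "2 * T \<le> pi" using pi_gt3 by (auto simp: T_def)
  qed
  have q: "0 < q" by (simp add: q_def)
  have xp: "0 < real_of_int x" using x scale_pos[of "Suc i"] by linarith
  have ix: "2 * (1 / real_of_int x) \<le> T / 2"
  proof -
    have "(Suc i)\<^sup>2 = (i\<^sup>2 + i) + i + 1" by (simp add: power2_eq_square)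
    then have "rscale (Suc i) = 2 ^ (i\<^sup>2 + i) * (2 ^ i * 2)" by (simp add: scale_def power_add)
    moreover have "(2 :: real) ^ 1 \<le> 2 ^ i" using i by (intro power_increasing) auto
    moreover have "(2 :: real) ^ (i\<^sup>2 + i) * (2 ^ 1 * 2) \<le> 2 ^ (i\<^sup>2 + i) * (2 ^ i * 2)"
      by (intro mult_left_mono mult_right_mono calculation(2)) simp_all
    ultimately have "2 ^ (i\<^sup>2 + i) * (2 ^ 1 * 2) \<le> real_of_int x" using x by linarith
    then have "2 ^ (i\<^sup>2 + i) * (2 * 2) \<le> real_of_int x" by simp
    then have "1 / real_of_int x \<le> 1 / (2 ^ (i\<^sup>2 + i) * (2 * 2))" using xp by (intro divide_left_mono mult_pos_pos) auto
    also have "\<dots> = T / 4" by (simp add: T_def power_divide)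
    finally show ?thesis by simp
  qed
  let ?h = "\<lambda>t. 1 / (5 * q) * (1 - cos (t * real_of_int x))"
  have "T / 2 \<le> integral {T..2 * T} (\<lambda>t. 1 - cos (t * real_of_int x))"
    using integral_one_minus_cos_ge[of T "2 * T" "real_of_int x"] T(1) xp ix by argo
  then have "1 / (5 * q) * (T / 2) \<le> 1 / (5 * q) * integral {T..2 * T} (\<lambda>t. 1 - cos (t * real_of_int x))"
    using q by (intro mult_left_mono) auto
  also have "\<dots> = integral {T..2 * T} ?h"
    by (rule integral_mult_right[symmetric])
  also have "\<dots> \<le> integral {T..2 * T} (\<lambda>t. Re (lac.kern x t))"
  proof (rule integral_le)
    show "?h integrable_on {T..2 * T}" by (intro integrable_continuous_real continuous_intros)
    show "(\<lambda>t. Re (lac.kern x t)) integrable_on {T..2 * T}" by (rule lac.Re_kern_integrable) (use T in auto)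
    fix t assume t: "t \<in> {T..2 * T}"
    have tp: "0 < t" "t \<le> pi" using t T by auto
    have a: "0 < alpha lacunary t" by (rule lac.alpha_pos[OF tp])
    have "t * alpha lacunary t \<le> 5 * q"
      unfolding q_def by (rule lacunary_alpha_le) (use t tp in \<open>auto simp: T_def\<close>)
    then have "1 / (5 * q) \<le> 1 / (t * alpha lacunary t)" using tp a q by (intro divide_left_mono mult_pos_pos) auto
    also have "\<dots> = alpha lacunary t / (t * ((alpha lacunary t)\<^sup>2 + (gamma lacunary t)\<^sup>2))"
      using a tp by (simp add: lacunary_gamma power2_eq_square)
    finally show "?h t \<le> Re (lac.kern x t)"
      unfolding lac.Re_kern[OF tp(1)] by (subst mult.commute) (intro mult_left_mono, auto)
  qed
  also have "\<dots> \<le> pi * sym_potential lacunary x"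
    by (rule lac.integral_Re_kern_le) (use T in auto)
  also have "1 / (5 * q) * (T / 2) = 4 ^ i / 10"
  proof -
    have "(4 :: real) ^ i = 2 ^ i * 2 ^ i" "(8 :: real) ^ i = 2 ^ i * (2 ^ i * 2 ^ i)"
      by (simp_all add: power_mult_distrib[symmetric])
    then show ?thesis unfolding T_def q_def by (simp add: power_add power_mult power_divide power3_eq_cube field_simps)
  qed
  finally show ?thesis .
qed

text \<open>
  Between \<open>M\<^sub>i\<^sub>+\<^sub>1\<close> and \<open>M\<^sub>i\<^sub>+\<^sub>2\<close> the potential is at least of order \<open>4\<^sup>i\<close>, whereas \<open>x/m(x)\<close> is at most of order \<open>2\<^sup>i\<close>.
\<close>

lemma lacunary_ratio_at_top:
  "filterlim (\<lambda>x :: int. sym_potential lacunary x * m_fun lacunary (real_of_int x) / real_of_int x) at_top at_top"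
proof -
  have "\<forall>\<^sub>F x :: int in at_top. Z \<le> sym_potential lacunary x * m_fun lacunary (real_of_int x) / real_of_int x"
    if Z: "0 < Z" for Z :: real
  proof -
    obtain i0 where i0: "Z * (160 * pi) < 2 ^ i0" using real_arch_pow[of 2 "Z * (160 * pi)"] by auto
    show ?thesis
      using eventually_gt_at_top[of "scale (i0 + 2)"]
    proof eventually_elim
      case (elim x)
      have ex: "\<exists>n. x \<le> scale n"
      proof -
        have "x \<le> int (2 ^ nat x)" by (metis int_nat_eq less_exp less_imp_le max.cobounded1 nat_int_comparison(3) order_trans of_nat_le_iff nat_le_iff)
        also have "(2 :: nat) ^ nat x \<le> 2 ^ ((nat x)\<^sup>2)" by (intro power_increasing) (auto simp: power2_eq_square)
        finally show ?thesis by (auto simp: scale_def)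
      qed
      define L where "L = (LEAST n. x \<le> scale n)"
      have L: "x \<le> scale L" unfolding L_def by (rule LeastI_ex[OF ex])
      have "i0 + 2 < L"
      proof (rule ccontr)
        assume "\<not> i0 + 2 < L"
        then have "rscale L \<le> rscale (i0 + 2)" by (intro scale_mono) simp
        then show False using L elim by simp
      qed
      then obtain i where i: "L = Suc (Suc i)" "i0 < i" by (metis Suc_le_D Suc_less_eq add_2_eq_Suc' less_imp_le_nat Suc_lessE)
      have lo: "scale (Suc i) < x"
        using not_less_Least[of "Suc i" "\<lambda>n. x \<le> scale n"] i unfolding L_def by (simp add: not_le)
      have xp: "0 < real_of_int x" using lo scale_pos[of "Suc i"] by linarith
      have r: "0 < lac.ratio (real_of_int x)" by (rule lac.ratio_pos[OF xp])
      have R: "lac.ratio (real_of_int x) \<le> 4 * 2 ^ (Suc (Suc i))"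
        by (rule lacunary_ratio_le[OF xp]) (use L i in simp)
      have P: "4 ^ i / 10 \<le> pi * sym_potential lacunary x"
        by (rule lacunary_sym_potential_ge) (use i lo in auto)
      have "(2 :: real) ^ i0 \<le> 2 ^ i" using i by (intro power_increasing) auto
      then have "Z * (160 * pi) \<le> 2 ^ i" using i0 by linarith
      then have "Z * (160 * pi) * 2 ^ i \<le> 2 ^ i * 2 ^ i" by (intro mult_right_mono) auto
      then have "pi * (Z * (4 * 2 ^ (Suc (Suc i)))) \<le> 4 ^ i / 10"
        by (simp add: power_mult_distrib[symmetric] mult_ac)
      then have "pi * (Z * lac.ratio (real_of_int x)) \<le> pi * sym_potential lacunary x"
      proof -
        have "pi * (Z * lac.ratio (real_of_int x)) \<le> pi * (Z * (4 * 2 ^ (Suc (Suc i))))"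
          using Z by (intro mult_left_mono R) auto
        then show ?thesis using P \<open>pi * (Z * (4 * 2 ^ (Suc (Suc i)))) \<le> 4 ^ i / 10\<close> by linarith
      qed
      then have "Z * lac.ratio (real_of_int x) \<le> sym_potential lacunary x" by simp
      then have "Z \<le> sym_potential lacunary x / lac.ratio (real_of_int x)" unfolding pos_le_divide_eq[OF r] .
      then show ?case by (simp add: lac.ratio_def)
    qed
  qed
  then show ?thesis unfolding filterlim_at_top_gt[where c=0] by blast
qed

lemma lacunary_m_fun_le: "m_fun lacunary (rscale j) \<le> 3 * norm_const * (1/2) ^ j * rscale j"
proof -
  let ?M = "rscale j"
  let ?f = "\<lambda>k :: int. ?M * max 0 (\<bar>real_of_int k\<bar> - ?M) + min ((real_of_int k)\<^sup>2) (?M\<^sup>2) / 2"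
  have M: "0 < ?M" by (rule scale_pos)
  have int: "integrable (measure_pmf lacunary) ?f"
    by (intro Bochner_Integration.integrable_add integrable_mult_right integrable_divide lac.integrable_overshoot lac.integrable_min_square)
  have even: "?f (- k) = ?f k" for k by simp
  have "m_fun lacunary ?M = expect lacunary ?f"
    using M lac.integrable_overshoot lac.integrable_min_square by (simp add: lac.m_fun_eq overshoot_def trunc_def)
  also have "\<dots> = expect level_pmf (\<lambda>k. ?f (scale k))" by (rule lacunary_even(1)[where f="?f", OF even])
  also have "\<dots> \<le> (\<Sum>k<Suc j. pmf level_pmf k * ?f (scale k)) + 2 * (norm_const * ?M) * (1/2) ^ Suc j"
  proof (rule expectation_level_le)
    show "integrable (measure_pmf level_pmf) (\<lambda>k. ?f (scale k))" using int lacunary_even(2)[where f="?f", OF even] by simp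
    fix k assume "Suc j \<le> k"
    then have le: "?M \<le> rscale k" by (intro scale_mono) simp
    have "?f (scale k) \<le> ?M * (rscale k - ?M) + ?M\<^sup>2 / 2"
      using le scale_pos[of k] by (intro add_mono) auto
    also have "\<dots> \<le> ?M * rscale k" by (simp add: power2_eq_square algebra_simps)
    finally have "pmf level_pmf k * ?f (scale k) \<le> pmf level_pmf k * (?M * rscale k)"
      by (intro mult_left_mono) auto
    also have "\<dots> = norm_const * ?M * (1/2) ^ k" using pmf_level_times[of k] by (simp add: mult_ac)
    finally show "pmf level_pmf k * ?f (scale k) \<le> norm_const * ?M * (1/2) ^ k" .
  qed
  also have "(\<Sum>k<Suc j. pmf level_pmf k * ?f (scale k)) \<le> (\<Sum>k<Suc j. pmf level_pmf k * (rscale k)\<^sup>2)"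
  proof (intro sum_mono mult_left_mono)
    fix k assume "k \<in> {..<Suc j}"
    then have "rscale k \<le> ?M" by (intro scale_mono) simp
    then show "?f (scale k) \<le> (rscale k)\<^sup>2"
      using scale_pos[of k] by (simp add: max_def min_def)
  qed simp
  also have "\<dots> \<le> 2 * norm_const * ((1/2) ^ j * ?M)" by (rule sum_weight_square_le)
  finally show ?thesis by (simp add: mult_ac)
qed

text \<open>
  At \<open>t = \<pi>/M\<^sub>j\<close> the scale \<open>M\<^sub>j\<close> alone contributes \<open>1 - cos \<pi> = 2\<close>, its maximum, to \<open>t \<alpha>(t)\<close>.
\<close>

lemma lacunary_not_tendsto_0:
  "\<not> ((\<lambda>t. (alpha lacunary t + \<bar>gamma lacunary t\<bar>) / (t * m_fun lacunary (1 / t))) \<longlongrightarrow> 0) (at_right 0)"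
proof
  let ?Q = "\<lambda>t. (alpha lacunary t + \<bar>gamma lacunary t\<bar>) / (t * m_fun lacunary (1 / t))"
  assume lim: "(?Q \<longlongrightarrow> 0) (at_right 0)"
  define t where "t j = pi / rscale j" for j
  have tp: "0 < t j" for j using scale_pos[of j] by (simp add: t_def)
  have "t \<longlonglongrightarrow> 0"
  proof (rule tendsto_sandwich[OF _ _ tendsto_const])
    show "\<forall>\<^sub>F j in sequentially. 0 \<le> t j" using tp by (auto simp: less_imp_le)
    show "\<forall>\<^sub>F j in sequentially. t j \<le> pi * (1/2) ^ j"
    proof (rule always_eventually, rule allI)
      fix j :: nat
      have "(2 :: real) ^ j \<le> 2 ^ (j\<^sup>2)" by (intro power_increasing) (auto simp: power2_eq_square)
      then show "t j \<le> pi * (1/2) ^ j" by (simp add: t_def scale_def power_divide frac_le)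
    qed
    have "(\<lambda>j. pi * (1/2 :: real) ^ j) \<longlonglongrightarrow> pi * 0" by (intro tendsto_mult tendsto_const LIMSEQ_power_zero) simp
    then show "(\<lambda>j. pi * (1/2 :: real) ^ j) \<longlonglongrightarrow> 0" by simp
  qed
  moreover have "t j \<in> {0<..} \<and> t j \<noteq> 0" for j using tp[of j] by simp
  ultimately have "filterlim t (at_right 0) sequentially" by (simp add: filterlim_at)
  then have "(\<lambda>j. ?Q (t j)) \<longlonglongrightarrow> 0" by (rule filterlim_compose[OF lim])
  moreover have "2 / (3 * pi\<^sup>2) \<le> ?Q (t j)" for j
  proof -
    let ?M = "rscale j" and ?m = "m_fun lacunary (1 / t j)"
    have M: "0 < ?M" by (rule scale_pos)
    have int: "integrable (measure_pmf level_pmf) (\<lambda>k. 1 - cos (t j * rscale k))"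
      by (rule integrable_one_minus_cos)
    have "2 * norm_const * (1/2) ^ j / ?M = pmf level_pmf j * (1 - cos (t j * ?M))"
      using M by (simp add: t_def pmf_level weight_def)
    also have "\<dots> \<le> t j * alpha lacunary (t j)"
      unfolding lacunary_alpha[OF tp] by (rule pmf_times_le_expectation[OF int]) simp
    finally have a: "2 * norm_const * (1/2) ^ j / ?M \<le> t j * alpha lacunary (t j)" .
    have m0: "0 < ?m" using tp by (intro lac.m_fun_pos) simp
    have "?m \<le> m_fun lacunary ?M"
      using M tp pi_gt3 by (intro lac.m_fun_mono) (auto simp: t_def divide_le_eq)
    also have "\<dots> \<le> 3 * norm_const * (1/2) ^ j * ?M" by (rule lacunary_m_fun_le)
    finally have m: "?m \<le> 3 * norm_const * (1/2) ^ j * ?M" .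
    have nc: "0 < norm_const" using norm_const by linarith
    have "(t j)\<^sup>2 * ?m \<le> (pi / ?M)\<^sup>2 * (3 * norm_const * (1/2) ^ j * ?M)"
      unfolding t_def[of j, symmetric] by (intro mult_left_mono m) simp
    also have "\<dots> = 3 * pi\<^sup>2 * (norm_const * (1/2) ^ j / ?M)" using M by (simp add: power2_eq_square)
    finally have den: "(t j)\<^sup>2 * ?m \<le> 3 * pi\<^sup>2 * (norm_const * (1/2) ^ j / ?M)" .
    have w: "0 < norm_const * (1/2) ^ j / ?M" using nc M by simp
    have "2 / (3 * pi\<^sup>2) = 2 * (norm_const * (1/2) ^ j / ?M) / (3 * pi\<^sup>2 * (norm_const * (1/2) ^ j / ?M))"
      by (rule mult_divide_mult_cancel_right[symmetric]) (use w in linarith)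
    also have "\<dots> \<le> t j * alpha lacunary (t j) / ((t j)\<^sup>2 * ?m)"
    proof (rule frac_le[OF _ _ _ den])
      show num: "2 * (norm_const * (1/2) ^ j / ?M) \<le> t j * alpha lacunary (t j)" using a by simp
      show "0 \<le> t j * alpha lacunary (t j)" using num w by linarith
      show "0 < (t j)\<^sup>2 * ?m" using tp[of j] m0 by simp
    qed
    also have "\<dots> = ?Q (t j)" using tp[of j] by (simp add: lacunary_gamma power2_eq_square)
    finally show ?thesis .
  qed
  ultimately have "2 / (3 * pi\<^sup>2) \<le> (0 :: real)"
    by (intro LIMSEQ_le_const) auto
  then show False by (simp add: divide_le_0_iff)
qed

section \<open>The theorem\<close>

theorem theorem2:
  "(\<exists>C :: ereal \<Rightarrow> real. \<forall>p. standing_assms p \<and> delta_H p > 0 \<longrightarrow>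
      (\<forall>\<^sub>F x :: int in at_top.
         sym_potential p x \<le> C (delta_H p) * (real_of_int x / m_fun p (real_of_int x))))
   \<and>
   (\<forall>p. standing_assms p \<longrightarrow>
      ((\<lambda>t. (alpha p t + \<bar>gamma p t\<bar>) / (t * m_fun p (1 / t))) \<longlongrightarrow> 0) (at_right 0) \<longrightarrow>
      filterlim (\<lambda>x :: int. sym_potential p x / (real_of_int x / m_fun p (real_of_int x)))
        at_top at_top)
   \<and>
   (\<exists>p. standing_assms p \<and>
      filterlim (\<lambda>x :: int. sym_potential p x * m_fun p (real_of_int x) / real_of_int x)
        at_top at_top \<and>
      \<not> ((\<lambda>t. (alpha p t + \<bar>gamma p t\<bar>) / (t * m_fun p (1 / t))) \<longlongrightarrow> 0) (at_right 0))"
proof (intro conjI)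
  \<comment> \<open>The constant may depend on the lower limit only.  This picks a real number strictly between 0 and
    the lower limit, at most 1; the case distinction is needed because real_of_ereal sends infinity to 0.\<close>
  define d :: "ereal \<Rightarrow> real" where "d e = (if e = \<infinity> then 1 else min 1 (real_of_ereal e / 2))" for e
  show "\<exists>C :: ereal \<Rightarrow> real. \<forall>p. standing_assms p \<and> delta_H p > 0 \<longrightarrow>
      (\<forall>\<^sub>F x :: int in at_top.
         sym_potential p x \<le> C (delta_H p) * (real_of_int x / m_fun p (real_of_int x)))"
  proof (intro exI[of _ "\<lambda>e. 144 / (d e)\<^sup>2"] allI impI)
    fix p assume p: "standing_assms p \<and> delta_H p > 0"
    then interpret heavy_walk p by unfold_locales simp
    have d: "0 < d (delta_H p)" "d (delta_H p) \<le> 1" "ereal (d (delta_H p)) < delta_H p"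
      using p by (cases "delta_H p"; auto simp: d_def min_def)+
    have "\<forall>\<^sub>F t in at_right 0. ereal (d (delta_H p)) < ereal ((alpha p t + \<bar>gamma p t\<bar>) / eta p (1 / t))"
      using d(3) unfolding delta_H_def by (rule less_LiminfD)
    moreover have "\<forall>\<^sub>F t :: real in at_right 0. 0 < t" by (simp add: eventually_at_right_less)
    ultimately have "\<forall>\<^sub>F t in at_right 0. d (delta_H p) * eta p (1 / t) \<le> alpha p t + \<bar>gamma p t\<bar>"
    proof eventually_elim
      case (elim t)
      have "0 \<le> eta p (1 / t)" using elim overshoot_nonneg by (simp add: eta_eq)
      moreover have "eta p (1 / t) \<noteq> 0" using elim d(1) by auto
      ultimately have "0 < eta p (1 / t)" by simp
      then show ?case using elim by (simp add: pos_less_divide_eq)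
    qed
    then show "\<forall>\<^sub>F x :: int in at_top.
         sym_potential p x \<le> 144 / (d (delta_H p))\<^sup>2 * (real_of_int x / m_fun p (real_of_int x))"
      by (rule sym_potential_upper_bound[OF d(1,2)])
  qed
next
  show "\<forall>p. standing_assms p \<longrightarrow>
      ((\<lambda>t. (alpha p t + \<bar>gamma p t\<bar>) / (t * m_fun p (1 / t))) \<longlongrightarrow> 0) (at_right 0) \<longrightarrow>
      filterlim (\<lambda>x :: int. sym_potential p x / (real_of_int x / m_fun p (real_of_int x)))
        at_top at_top"
    using heavy_walk.sym_potential_ratio_at_top[OF heavy_walk.intro] by blast
next
  show "\<exists>p. standing_assms p \<and>
      filterlim (\<lambda>x :: int. sym_potential p x * m_fun p (real_of_int x) / real_of_int x)
        at_top at_top \<and>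
      \<not> ((\<lambda>t. (alpha p t + \<bar>gamma p t\<bar>) / (t * m_fun p (1 / t))) \<longlongrightarrow> 0) (at_right 0)"
    using lacunary_standing lacunary_ratio_at_top lacunary_not_tendsto_0 by blast
qed


end
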